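(* Let $V$ be a finite-dimensional real vector space and let $U,W_1,\dots,W_k$ be subspaces of $V$ such that $V=U\oplus\bigoplus_{i=1}^kW_i$ and $\dim W_i=1$ for $1\leq i\leq k$. Let $$\Lambda=\bigcup_{i=1}^k(U+W_i).$$ Then, for each finite subset $S\subset V$, the $\Lambda$-hull $G_\Lambda^{(\infty)}(S)$ is a semi-algebraic subset of $V$. Moreover, there exists an algorithm that, given $S\subset V=\mathbb R^d$ as input, produces a semi-algebraic description of $G_\Lambda^{(\infty)}(S)$ by a quantifier-free first-order formula in the language of the reals as its output (the decomposition $V=U\oplus\bigoplus_iW_i$ is regarded as fixed).
   Context: For a subset $\Lambda\subset V$ containing $\mathbf 0$ and $S\subset V$, define $$G_\Lambda(S)=\{\alpha x+(1-\alpha)y: x,y\in S,\ x-y\in\Lambda,\ 0<\alpha<1\},$$ $G_\Lambda^{(0)}(S)=S$, $G_\Lambda^{(t+1)}(S)=G_\Lambda(G_\Lambda^{(t)}(S))$ for $t\in\mathbb N$, and the $\Lambda$-hull of $S$ is $G_\Lambda^{(\infty)}(S)=\bigcup_{t\geq0}G_\Lambda^{(t)}(S)$. "Algorithm" means an algorithm performing arithmetic operations and comparisons on real numbers, and a semi-algebraic description is a quantifier-free formula with atoms $P=0$, $P>0$, with $P$ a polynomial with real coefficients. *)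

theory Defs
  imports Complex_Main "HOL-Library.FuncSet"
begin

section \<open>Lambda-hulls and direct sum decompositions\<close>

definition G_step :: "'v::real_vector set \<Rightarrow> 'v set \<Rightarrow> 'v set" where
  "G_step \<Lambda> S =
     {\<alpha> *\<^sub>R x + (1 - \<alpha>) *\<^sub>R y | \<alpha> x y.
        x \<in> S \<and> y \<in> S \<and> x - y \<in> \<Lambda> \<and> 0 < \<alpha> \<and> \<alpha> < 1}"

definition G_hull :: "'v::real_vector set \<Rightarrow> 'v set \<Rightarrow> 'v set" where
  "G_hull \<Lambda> S = (\<Union>t::nat. (G_step \<Lambda> ^^ t) S)"

text \<open>Internal direct sum: every vector is uniquely \<open>u + w 1 + \<dots> + w k\<close> with \<open>u \<in> U\<close> and
  \<open>w i \<in> W i\<close>; extensionality of \<open>w\<close> makes uniqueness meaningful.\<close>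

definition direct_sum_decomposition ::
    "'v::real_vector set \<Rightarrow> (nat \<Rightarrow> 'v set) \<Rightarrow> nat \<Rightarrow> bool" where
  "direct_sum_decomposition U W k \<longleftrightarrow>
     subspace U \<and> (\<forall>i\<in>{1..k}. subspace (W i)) \<and>
     (\<forall>v. \<exists>!p. fst p \<in> U \<and> snd p \<in> PiE {1..k} W \<and> v = fst p + (\<Sum>i=1..k. snd p i))"

text \<open>An ordered basis \<open>bs\<close> of the whole space identifies it with \<open>\<real>\<^sup>d\<close>, where
  \<open>d = length bs\<close>; coordinates are numbered from 0.\<close>

definition list_basis :: "'v::real_vector list \<Rightarrow> 'v set \<Rightarrow> bool" where
  "list_basis bs X \<longleftrightarrow> distinct bs \<and> independent (set bs) \<and> span (set bs) = X"

definition coords :: "'v::real_vector list \<Rightarrow> 'v \<Rightarrow> real list" where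
  "coords bs v = map (representation (set bs) v) bs"


section \<open>Quantifier-free formulas and semi-algebraic sets\<close>

datatype rpoly = PConst real | PVar nat | PAdd rpoly rpoly | PMul rpoly rpoly

datatype qf_formula =
    EqZero rpoly
  | GtZero rpoly
  | FNeg qf_formula
  | FConj qf_formula qf_formula
  | FDisj qf_formula qf_formula

fun poly_val :: "rpoly \<Rightarrow> real list \<Rightarrow> real" where
  "poly_val (PConst c) x = c"
| "poly_val (PVar i) x = x ! i"
| "poly_val (PAdd p q) x = poly_val p x + poly_val q x"
| "poly_val (PMul p q) x = poly_val p x * poly_val q x"

fun poly_vars :: "rpoly \<Rightarrow> nat set" where
  "poly_vars (PConst c) = {}"
| "poly_vars (PVar i) = {i}"
| "poly_vars (PAdd p q) = poly_vars p \<union> poly_vars q"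
| "poly_vars (PMul p q) = poly_vars p \<union> poly_vars q"

fun holds :: "qf_formula \<Rightarrow> real list \<Rightarrow> bool" where
  "holds (EqZero p) x \<longleftrightarrow> poly_val p x = 0"
| "holds (GtZero p) x \<longleftrightarrow> poly_val p x > 0"
| "holds (FNeg f) x \<longleftrightarrow> \<not> holds f x"
| "holds (FConj f g) x \<longleftrightarrow> holds f x \<and> holds g x"
| "holds (FDisj f g) x \<longleftrightarrow> holds f x \<or> holds g x"

fun formula_vars :: "qf_formula \<Rightarrow> nat set" where
  "formula_vars (EqZero p) = poly_vars p"
| "formula_vars (GtZero p) = poly_vars p"
| "formula_vars (FNeg f) = formula_vars f"
| "formula_vars (FConj f g) = formula_vars f \<union> formula_vars g"
| "formula_vars (FDisj f g) = formula_vars f \<union> formula_vars g"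

definition describes :: "'v::real_vector list \<Rightarrow> qf_formula \<Rightarrow> 'v set \<Rightarrow> bool" where
  "describes bs f A \<longleftrightarrow>
     formula_vars f \<subseteq> {..<length bs} \<and> A = {v. holds f (coords bs v)}"

text \<open>Polynomials are closed under linear substitutions, so the choice of basis is immaterial.\<close>

definition semialgebraic :: "'v::real_vector set \<Rightarrow> bool" where
  "semialgebraic A \<longleftrightarrow> (\<exists>bs f. list_basis bs UNIV \<and> describes bs f A)"


section \<open>Algorithms over the reals\<close>

text \<open>While programs over finitely many stacks of real numbers, with exact arithmetic, comparisons
  and emptiness tests; this is the computational model of Blum, Shub and Smale over sequences of
  reals of arbitrary finite length. The top of an empty stack reads as 0 and division by zero
  yields 0; programs can test for both situations.\<close>

datatype arith = Plus | Minus | Times | Divide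

datatype test =
    IsEmpty nat
  | TopLess nat nat
  | TNot test
  | TAnd test test

datatype prog =
    Skip
  | Push nat real
  | Copy nat nat
  | Pop nat
  | Arith arith nat nat nat
  | Seq prog prog
  | Cond test prog prog
  | Loop test prog

type_synonym store = "nat \<Rightarrow> real list"

fun top_of :: "real list \<Rightarrow> real" where
  "top_of [] = 0"
| "top_of (x # xs) = x"

fun arith_val :: "arith \<Rightarrow> real \<Rightarrow> real \<Rightarrow> real" where
  "arith_val Plus x y = x + y"
| "arith_val Minus x y = x - y"
| "arith_val Times x y = x * y"
| "arith_val Divide x y = x / y"

fun test_val :: "test \<Rightarrow> store \<Rightarrow> bool" where
  "test_val (IsEmpty a) s \<longleftrightarrow> s a = []"
| "test_val (TopLess a b) s \<longleftrightarrow> top_of (s a) < top_of (s b)"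
| "test_val (TNot t) s \<longleftrightarrow> \<not> test_val t s"
| "test_val (TAnd t u) s \<longleftrightarrow> test_val t s \<and> test_val u s"

text \<open>\<open>exec p s s'\<close>: started in store \<open>s\<close>, program \<open>p\<close> halts in store \<open>s'\<close>. The first argument of
  \<open>Push\<close>, \<open>Copy\<close> and \<open>Arith\<close> is the stack that receives the new top; operands stay on their
  stacks.\<close>

inductive exec :: "prog \<Rightarrow> store \<Rightarrow> store \<Rightarrow> bool" where
  exec_Skip: "exec Skip s s"
| exec_Push: "exec (Push a c) s (s(a := c # s a))"
| exec_Copy: "exec (Copy a b) s (s(a := top_of (s b) # s a))"
| exec_Pop: "exec (Pop a) s (s(a := tl (s a)))"
| exec_Arith:
    "exec (Arith opr a b c) s (s(a := arith_val opr (top_of (s b)) (top_of (s c)) # s a))"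
| exec_Seq: "exec p s s' \<Longrightarrow> exec q s' s'' \<Longrightarrow> exec (Seq p q) s s''"
| exec_CondT: "test_val t s \<Longrightarrow> exec p s s' \<Longrightarrow> exec (Cond t p q) s s'"
| exec_CondF: "\<not> test_val t s \<Longrightarrow> exec q s s' \<Longrightarrow> exec (Cond t p q) s s'"
| exec_LoopF: "\<not> test_val t s \<Longrightarrow> exec (Loop t p) s s"
| exec_LoopT:
    "test_val t s \<Longrightarrow> exec p s s' \<Longrightarrow> exec (Loop t p) s' s'' \<Longrightarrow> exec (Loop t p) s s''"

inductive_cases exec_elims:
  "exec Skip s s'" "exec (Push a c) s s'" "exec (Copy a b) s s'" "exec (Pop a) s s'"
  "exec (Arith opr a b c) s s'" "exec (Seq p q) s s'" "exec (Cond t p q) s s'"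
  "exec (Loop t p) s s'"

lemma exec_deterministic: "exec p s s' \<Longrightarrow> exec p s s'' \<Longrightarrow> s'' = s'"
proof (induction arbitrary: s'' rule: exec.induct)
  case (exec_Seq p s s1 q s2)
  from exec_Seq.prems show ?case
    by (rule exec_elims(6)) (use exec_Seq.IH in metis)
next
  case (exec_CondT t s p s1 q)
  from exec_CondT.prems show ?case
    by (rule exec_elims(7)) (use exec_CondT.IH exec_CondT.hyps in metis)+
next
  case (exec_CondF t s q s1 p)
  from exec_CondF.prems show ?case
    by (rule exec_elims(7)) (use exec_CondF.IH exec_CondF.hyps in metis)+
next
  case (exec_LoopF t s p)
  from exec_LoopF.prems show ?case
    by (rule exec_elims(8)) (use exec_LoopF.hyps in metis)+
next
  case (exec_LoopT t s p s1 s2)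
  from exec_LoopT.prems show ?case
    by (rule exec_elims(8)) (use exec_LoopT.IH exec_LoopT.hyps in metis)+
qed (erule exec_elims, simp)+

fun constants :: "prog \<Rightarrow> real set" where
  "constants (Push a c) = {c}"
| "constants (Seq p q) = constants p \<union> constants q"
| "constants (Cond t p q) = constants p \<union> constants q"
| "constants (Loop t p) = constants p"
| "constants Skip = {}"
| "constants (Copy a b) = {}"
| "constants (Pop a) = {}"
| "constants (Arith opr a b c) = {}"


section \<open>Input and output conventions\<close>

text \<open>A finite set is presented by an arbitrary enumeration \<open>xs\<close>, repetitions allowed. Stack 0
  initially holds the number of points followed by all their coordinates, the other stacks being
  empty. (The number of points is redundant unless the dimension is 0.)\<close>

definition input_store :: "'v::real_vector list \<Rightarrow> 'v list \<Rightarrow> store" where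
  "input_store bs xs =
     (\<lambda>_. [])(0 := real (length xs) # concat (map (coords bs) xs))"

text \<open>Formulas are output on stack 0 in prefix notation.\<close>

fun encode_poly :: "rpoly \<Rightarrow> real list" where
  "encode_poly (PConst c) = [0, c]"
| "encode_poly (PVar i) = [1, real i]"
| "encode_poly (PAdd p q) = 2 # encode_poly p @ encode_poly q"
| "encode_poly (PMul p q) = 3 # encode_poly p @ encode_poly q"

fun encode_formula :: "qf_formula \<Rightarrow> real list" where
  "encode_formula (EqZero p) = 0 # encode_poly p"
| "encode_formula (GtZero p) = 1 # encode_poly p"
| "encode_formula (FNeg f) = 2 # encode_formula f"
| "encode_formula (FConj f g) = 3 # encode_formula f @ encode_formula g"
| "encode_formula (FDisj f g) = 4 # encode_formula f @ encode_formula g"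

lemma encode_poly_prefix_free:
  "encode_poly p @ xs = encode_poly q @ ys \<Longrightarrow> p = q \<and> xs = ys"
proof (induction p arbitrary: q xs ys)
  case (PConst c)
  then show ?case by (cases q) auto
next
  case (PVar i)
  then show ?case by (cases q) auto
next
  case (PAdd p1 p2)
  from PAdd.prems obtain q1 q2 where "q = PAdd q1 q2" by (cases q) auto
  with PAdd.prems show ?case by simp (metis PAdd.IH)
next
  case (PMul p1 p2)
  from PMul.prems obtain q1 q2 where "q = PMul q1 q2" by (cases q) auto
  with PMul.prems show ?case by simp (metis PMul.IH)
qed

lemma encode_formula_prefix_free:
  "encode_formula f @ xs = encode_formula g @ ys \<Longrightarrow> f = g \<and> xs = ys"
proof (induction f arbitrary: g xs ys)
  case (EqZero p)
  from EqZero.prems obtain q where "g = EqZero q" by (cases g) auto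
  with EqZero.prems show ?case by simp (metis encode_poly_prefix_free)
next
  case (GtZero p)
  from GtZero.prems obtain q where "g = GtZero q" by (cases g) auto
  with GtZero.prems show ?case by simp (metis encode_poly_prefix_free)
next
  case (FNeg f)
  from FNeg.prems obtain g1 where "g = FNeg g1" by (cases g) auto
  with FNeg.prems show ?case by simp (metis FNeg.IH)
next
  case (FConj f1 f2)
  from FConj.prems obtain g1 g2 where "g = FConj g1 g2" by (cases g) auto
  with FConj.prems show ?case by simp (metis FConj.IH)
next
  case (FDisj f1 f2)
  from FDisj.prems obtain g1 g2 where "g = FDisj g1 g2" by (cases g) auto
  with FDisj.prems show ?case by simp (metis FDisj.IH)
qed

lemma inj_encode_formula: "inj encode_formula"
  by (rule injI) (metis append_Nil2 encode_formula_prefix_free)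

definition outputs_description ::
    "'v::real_vector list \<Rightarrow> prog \<Rightarrow> 'v list \<Rightarrow> 'v set \<Rightarrow> bool" where
  "outputs_description bs p xs A \<longleftrightarrow>
     (\<exists>s' f. exec p (input_store bs xs) s' \<and> s' 0 = encode_formula f \<and> describes bs f A)"

text \<open>The real constants available to an algorithm for a fixed decomposition: rational numbers and
  the coordinates of a basis \<open>us\<close> of \<open>U\<close> and of vectors \<open>w i\<close> spanning the lines \<open>W i\<close>. Arbitrary
  real constants are excluded, since a single one can encode an infinite table of answers.\<close>

definition decomposition_constants ::
    "'v::real_vector list \<Rightarrow> 'v list \<Rightarrow> (nat \<Rightarrow> 'v) \<Rightarrow> nat \<Rightarrow> real set" where
  "decomposition_constants bs us w k =
     \<rat> \<union> (\<Union>v \<in> set us \<union> w ` {1..k}. set (coords bs v))"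

end

theory Submission
  imports Defs "Jordan_Normal_Form.Determinant"
begin

text \<open>Let \<open>k > 0\<close> (for \<open>k = 0\<close> the set \<open>\<Lambda>\<close> is empty and the hull is \<open>S\<close>). Project the points of \<open>S\<close> to
  the lines \<open>W 1, \<dots>, W k\<close>; their coordinates form a finite grid. The fibre of the hull over a point
  of a grid box is the multi-affine interpolation of the convex fibres over the corners of the
  box, because the latter are stable under convex combinations along axes. A vector over a
  grid point \<open>a\<close> belongs to the hull iff the unit mass at \<open>a\<close> can be transported, by finitely many
  splittings along axes and stops at points of \<open>S\<close>, so that it is the weighted sum of the stops.
  This is reachability of the empty configuration in a continuous Petri net. As for all such nets
  (Fraca and Haddad), a flow \<open>x\<close> satisfying the conservation law is realised by a finite run iff its
  support can be fired forwards and backwards: one fires a little of \<open>x\<close> to make all places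
  positive, reserves a little of it for the end, and fires the rest in many equal rounds. Forward
  firing is automatic, since \<open>M - (sum_list a)\<^sup>2\<close> is a strictly decreasing potential; backward firing is
  witnessed by a chain of actions. So a vector is in the hull iff, for one of finitely many boxes
  and chains, a vector depending polynomially on it lies in a cone with computable generators,
  which Fourier--Motzkin elimination describes by linear inequalities.

  Programs manipulate binary trees that are kept in prefix notation on stack 0; a small calculus of
  computable functions with \<open>fold\<close> as the only recursion then covers the whole computation.\<close>

section \<open>Functions computed by stack programs\<close>

text \<open>A run may return to the same places again and again, and no bound on its length is used.
  A flow forgets the order of firing and is a single vector; for a fixed box and chain the
  conditions on it are linear, and chains can be chosen with distinct places, so finitely many of
  them suffice.

  A position off the grid is replaced by its hat measure, the product over the coordinates of the
  barycentric weights on the two neighbouring grid values. Convex combinations of arbitrary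
  positions along an axis are simulated by splittings between grid points
  (\<open>splits_hats\<close>); therefore no places outside the grid are needed. In the other
  direction the fibres of the hull enter only through axis-convexity, so every box around a position
  is as good as the smallest one.

  The program must convert input coordinates to a basis adapted to the decomposition, but its
  constants are the entries of the inverse matrix. Cramer's rule yields the required matrix inside
  the field of numbers computable from these constants.\<close>

datatype tr = Leaf real | Node tr tr

fun enc :: "tr \<Rightarrow> real list" where
  "enc (Leaf r) = [0, r]"
| "enc (Node a b) = 1 # enc a @ enc b"

text \<open>Stack 4 is empty in all stores of this form, so its top reads as 0 and
  \<open>TopLess 4 0\<close> asks whether the top of stack 0 is positive. This tells the tag 0 of a
  leaf from the tag 1 of a node, and likewise decides truth values.\<close>

definition mem :: "real list \<Rightarrow> real list \<Rightarrow> real list \<Rightarrow> real list \<Rightarrow> store" where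
  "mem a b c e = (\<lambda>_. [])(0 := a, 1 := b, 2 := c, 3 := e)"

definition st :: "real list \<Rightarrow> store" where
  "st a = mem a [] [] []"

lemma mem_simps [simp]:
  "mem a b c e 0 = a" "mem a b c e (Suc 0) = b" "mem a b c e 2 = c" "mem a b c e 3 = e"
  "mem a b c e 4 = []"
  "(mem a b c e)(0 := x) = mem x b c e" "(mem a b c e)(Suc 0 := x) = mem a x c e"
  "(mem a b c e)(2 := x) = mem a b x e" "(mem a b c e)(3 := x) = mem a b c x"
  by (auto simp: mem_def fun_eq_iff)

fun prog_seq :: "prog list \<Rightarrow> prog" where
  "prog_seq [] = Skip"
| "prog_seq (p # ps) = Seq p (prog_seq ps)"

fun loop_free :: "prog \<Rightarrow> bool" where
  "loop_free (Seq p q) = (loop_free p \<and> loop_free q)"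
| "loop_free (Cond t p q) = (loop_free p \<and> loop_free q)"
| "loop_free (Loop t p) = False"
| "loop_free _ = True"

text \<open>A functional reading of straight-line code, which the simplifier can evaluate. The last
  clause gives \<open>Loop\<close> a dummy value; \<open>loop_free\<close> keeps it out of
  \<open>exec_loop_free\<close>.\<close>

fun effect :: "prog \<Rightarrow> store \<Rightarrow> store" where
  "effect (Push a c) s = s(a := c # s a)"
| "effect (Copy a b) s = s(a := top_of (s b) # s a)"
| "effect (Pop a) s = s(a := tl (s a))"
| "effect (Arith f a b c) s = s(a := arith_val f (top_of (s b)) (top_of (s c)) # s a)"
| "effect (Seq p q) s = effect q (effect p s)"
| "effect (Cond t p q) s = (if test_val t s then effect p s else effect q s)"
| "effect _ s = s"

lemma exec_loop_free: "loop_free p \<Longrightarrow> effect p s = s' \<Longrightarrow> exec p s s'"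
  by (induction p arbitrary: s s')
     (auto intro: exec.intros exec_CondT exec_CondF split: if_splits)

lemma exec_prog_seq_Cons: "exec p s s' \<Longrightarrow> exec (prog_seq ps) s' s'' \<Longrightarrow> exec (prog_seq (p # ps)) s s''"
  by (auto intro: exec.intros)

lemma exec_prog_seq_Nil: "s = s' \<Longrightarrow> exec (prog_seq []) s s'"
  by (auto intro: exec.intros)

section \<open>Moving, copying, exchanging and discarding trees on the stacks\<close>

definition transfer :: "nat \<Rightarrow> nat \<Rightarrow> prog" where
  "transfer i j = Loop (TNot (IsEmpty i)) (prog_seq [Copy j i, Pop i])"

lemma exec_transfer:
  "i \<noteq> j \<Longrightarrow> exec (transfer i j) s (s(i := [], j := rev (s i) @ s j))"
proof (induction "s i" arbitrary: s)
  case Nil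
  then have "s(i := [], j := rev (s i) @ s j) = s" by auto
  with Nil show ?case
    unfolding transfer_def by (metis exec_LoopF test_val.simps(1,3))
next
  case (Cons x xs)
  define s1 where "s1 = s(j := x # s j, i := xs)"
  have 1: "exec (prog_seq [Copy j i, Pop i]) s s1"
    using Cons(3) Cons(2)[symmetric] by (intro exec_loop_free) (auto simp: s1_def fun_eq_iff)
  have "exec (transfer i j) s1 (s1(i := [], j := rev (s1 i) @ s1 j))"
    by (rule Cons(1)) (use Cons(3) in \<open>auto simp: s1_def\<close>)
  moreover have "s1(i := [], j := rev (s1 i) @ s1 j) = s(i := [], j := rev (s i) @ s j)"
    using Cons(2)[symmetric] Cons(3) by (auto simp: s1_def fun_eq_iff)
  moreover have "test_val (TNot (IsEmpty i)) s" using Cons(2)[symmetric] by simp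
  ultimately show ?case using 1 unfolding transfer_def by (metis exec_LoopT)
qed

text \<open>The height of stack 3 is the number of trees that remain to be read.\<close>

definition move_body :: prog where
  "move_body = Seq (Copy 1 0) (Cond (TopLess 4 0) (prog_seq [Pop 0, Push 3 0])
     (prog_seq [Pop 0, Copy 1 0, Pop 0, Pop 3]))"

definition move :: prog where
  "move = prog_seq [Push 3 0, Loop (TNot (IsEmpty 3)) move_body]"

lemma exec_move_loop:
  "exec (Loop (TNot (IsEmpty 3)) move_body)
     (mem (concat (map enc ts) @ r) b c (replicate (length ts) 0))
     (mem r (rev (concat (map enc ts)) @ b) c [])"
\<comment> \<open>A leaf removes one pending tree, whereas a node replaces one by two; doubling the
  sizes makes the measure drop in both cases.\<close>
proof (induction "2 * sum_list (map size ts) + length ts" arbitrary: ts b rule: less_induct)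
  case less
  show ?case
  proof (cases ts)
    case Nil
    then show ?thesis by (auto intro!: exec_LoopF)
  next
    case (Cons t us)
    show ?thesis
    proof (cases t)
      case (Leaf x)
      let ?s = "mem (concat (map enc us) @ r) (x # 0 # b) c (replicate (length us) 0)"
      have "exec move_body (mem (concat (map enc ts) @ r) b c (replicate (length ts) 0)) ?s"
        unfolding move_body_def Cons Leaf
        by (intro exec_loop_free) simp_all
      moreover have "exec (Loop (TNot (IsEmpty 3)) move_body) ?s
          (mem r (rev (concat (map enc us)) @ x # 0 # b) c [])"
        by (rule less) (simp add: Cons)
      moreover have "test_val (TNot (IsEmpty 3)) (mem (concat (map enc ts) @ r) b c (replicate (length ts) 0))"
        by (simp add: Cons)
      ultimately have "exec (Loop (TNot (IsEmpty 3)) move_body)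
          (mem (concat (map enc ts) @ r) b c (replicate (length ts) 0)) (mem r (rev (concat (map enc us)) @ x # 0 # b) c [])"
        by (blast intro: exec_LoopT)
      then show ?thesis by (simp add: Cons Leaf)
    next
      case (Node l m)
      let ?s = "mem (concat (map enc (l # m # us)) @ r) (1 # b) c (replicate (length (l # m # us)) 0)"
      have "exec move_body (mem (concat (map enc ts) @ r) b c (replicate (length ts) 0)) ?s"
        unfolding move_body_def Cons Node
        by (intro exec_loop_free) simp_all
      moreover have "exec (Loop (TNot (IsEmpty 3)) move_body) ?s
          (mem r (rev (concat (map enc (l # m # us))) @ 1 # b) c [])"
        by (rule less) (simp add: Cons Node)
      moreover have "test_val (TNot (IsEmpty 3)) (mem (concat (map enc ts) @ r) b c (replicate (length ts) 0))"
        by (simp add: Cons)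
      ultimately have "exec (Loop (TNot (IsEmpty 3)) move_body)
          (mem (concat (map enc ts) @ r) b c (replicate (length ts) 0)) (mem r (rev (concat (map enc (l # m # us))) @ 1 # b) c [])"
        by (blast intro: exec_LoopT)
      then show ?thesis by (simp add: Cons Node)
    qed
  qed
qed

lemma exec_move: "exec move (mem (enc t @ r) b c []) (mem r (rev (enc t) @ b) c [])"
proof -
  have "exec (Push 3 0) (mem (enc t @ r) b c []) (mem (enc t @ r) b c [0])"
    by (intro exec_loop_free) simp_all
  then show ?thesis
    unfolding move_def using exec_move_loop[of "[t]" r b c]
    by (intro exec_prog_seq_Cons exec_prog_seq_Nil refl) simp_all
qed

lemma exec_transfer_mem:
  "exec (transfer 1 0) (mem a b c e) (mem (rev b @ a) [] c e)"
  "exec (transfer 1 2) (mem a b c e) (mem a [] (rev b @ c) e)"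
  "exec (transfer 2 1) (mem a b c e) (mem a (rev c @ b) [] e)"
  "exec (transfer 2 3) (mem a b c e) (mem a b [] (rev c @ e))"
  "exec (transfer 3 0) (mem a b c e) (mem (rev e @ a) b c [])"
  using exec_transfer[of 1 0 "mem a b c e"] exec_transfer[of 1 2 "mem a b c e"]
    exec_transfer[of 2 1 "mem a b c e"] exec_transfer[of 2 3 "mem a b c e"]
    exec_transfer[of 3 0 "mem a b c e"] by simp_all

definition dup :: prog where
  "dup = prog_seq [move, Loop (TNot (IsEmpty 1)) (prog_seq [Copy 0 1, Copy 2 1, Pop 1]),
     transfer 2 1, transfer 1 0]"

lemma exec_dup: "exec dup (st (enc t @ r)) (st (enc t @ enc t @ r))"
proof -
  have loop: "exec (Loop (TNot (IsEmpty 1)) (prog_seq [Copy 0 1, Copy 2 1, Pop 1]))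
      (mem a b c []) (mem (rev b @ a) [] (rev b @ c) [])" for a b c
  proof (induction b arbitrary: a c)
    case (Cons x b)
    have "exec (prog_seq [Copy 0 1, Copy 2 1, Pop 1]) (mem a (x # b) c [])
        (mem (x # a) b (x # c) [])"
      by (intro exec_loop_free) simp_all
    then show ?case using Cons[of "x # a" "x # c"] by (auto intro: exec_LoopT)
  qed (auto intro!: exec_LoopF)
  show ?thesis
    unfolding dup_def st_def
    by (rule exec_prog_seq_Cons, rule exec_move, rule exec_prog_seq_Cons, rule loop,
        rule exec_prog_seq_Cons, rule exec_transfer_mem, rule exec_prog_seq_Cons, rule exec_transfer_mem, rule exec_prog_seq_Nil, simp)
qed

definition swap :: prog where
  "swap = prog_seq [move, transfer 1 2, move, transfer 2 3, transfer 3 0, transfer 1 0]"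

lemma exec_swap: "exec swap (st (enc t @ enc u @ r)) (st (enc u @ enc t @ r))"
  unfolding swap_def st_def
  by (rule exec_prog_seq_Cons, rule exec_move, rule exec_prog_seq_Cons, rule exec_transfer_mem,
      rule exec_prog_seq_Cons, rule exec_move, rule exec_prog_seq_Cons, rule exec_transfer_mem,
      rule exec_prog_seq_Cons, rule exec_transfer_mem, rule exec_prog_seq_Cons, rule exec_transfer_mem,
      rule exec_prog_seq_Nil, simp)

definition drop_top :: prog where
  "drop_top = prog_seq [move, Loop (TNot (IsEmpty 1)) (Pop 1)]"

lemma exec_drop_top: "exec drop_top (st (enc t @ r)) (st r)"
proof -
  have loop: "exec (Loop (TNot (IsEmpty 1)) (Pop 1)) (mem a b c []) (mem a [] c [])" for a b c
  proof (induction b)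
    case (Cons x b)
    have "exec (Pop 1) (mem a (x # b) c []) (mem a b c [])"
      by (intro exec_loop_free) simp_all
    then show ?case using Cons by (auto intro: exec_LoopT)
  qed (auto intro!: exec_LoopF)
  show ?thesis unfolding drop_top_def st_def
    by (rule exec_prog_seq_Cons, rule exec_move, rule exec_prog_seq_Cons, rule loop)
       (rule exec_prog_seq_Nil, simp)
qed

lemma constants_move_dup_swap_drop:
  "constants (transfer i j) = {}" "constants move = {0}" "constants dup = {0}"
  "constants swap = {0}" "constants drop_top = {0}"
  by (auto simp: transfer_def move_def move_body_def dup_def swap_def drop_top_def)

section \<open>Data represented by trees\<close>

class repr = fixes rep :: "'a \<Rightarrow> tr"

instantiation real :: repr begin
definition "rep (x :: real) = Leaf x"
instance ..
end

instantiation bool :: repr begin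
definition "rep (b :: bool) = Leaf (if b then 1 else 0)"
instance ..
end

instantiation unit :: repr begin
definition "rep (u :: unit) = Leaf 0"
instance ..
end

instantiation prod :: (repr, repr) repr begin
definition "rep (p :: 'a \<times> 'b) = Node (rep (fst p)) (rep (snd p))"
instance ..
end

text \<open>The empty list shares its code with the number 0, and a nonempty list with the pair of
  its head and tail; \<open>cmp_Nil\<close> and \<open>cmp_Cons\<close> thereby follow from the
  rules for 0 and for pairs.\<close>

instantiation list :: (repr) repr begin
fun rep_list :: "'a list \<Rightarrow> tr" where
  "rep_list [] = Leaf 0"
| "rep_list (x # xs) = Node (rep x) (rep_list xs)"
instance ..
end

text \<open>Polynomials and formulas are represented by their output strings, so that constructors
  become list operations and the final result only has to pass through
  \<open>write_output\<close>.\<close>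

instantiation rpoly :: repr begin
definition "rep p = rep (encode_poly p)"
instance ..
end

instantiation qf_formula :: repr begin
definition "rep f = rep (encode_formula f)"
instance ..
end

lemma st_simps [simp]: "st a 0 = a" "(st a)(0 := b) = st b"
  by (simp_all add: st_def)

lemma effect_st: "effect (Push 0 c) (st a) = st (c # a)" "effect (Pop 0) (st (c # a)) = st a"
  by simp_all

section \<open>A calculus of computable functions\<close>

locale stack_machine =
  fixes C :: "real set"
  assumes Rats_subset: "\<rat> \<subseteq> C"
begin

text \<open>The arbitrary rest \<open>r\<close> of stack 0 allows a program to be called as a
  subroutine above other data. The remaining stacks are empty before and after the call, hence free
  for scratch work.\<close>

definition cmp :: "('a::repr \<Rightarrow> 'b::repr) \<Rightarrow> bool" where
  "cmp f \<longleftrightarrow> (\<exists>p. constants p \<subseteq> C \<and>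
     (\<forall>x r. exec p (st (enc (rep x) @ r)) (st (enc (rep (f x)) @ r))))"

lemma Rat_consts [simp]: "0 \<in> C" "1 \<in> C" "numeral w \<in> C" "- 1 \<in> C" "real n \<in> C"
  using Rats_subset by auto

lemma cmpI:
  "(\<And>x r. exec p (st (enc (rep x) @ r)) (st (enc (rep (f x)) @ r))) \<Longrightarrow> constants p \<subseteq> C \<Longrightarrow> cmp f"
  by (auto simp: cmp_def)

lemma cmpE:
  assumes "cmp f"
  obtains p where "constants p \<subseteq> C"
    "\<And>x r. exec p (st (enc (rep x) @ r)) (st (enc (rep (f x)) @ r))"
  using assms unfolding cmp_def by blast

lemma cmp_id: "cmp (\<lambda>c. c)"
  by (rule cmpI[of Skip]) (auto intro: exec.intros)

lemma cmp_compose: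
  assumes "cmp g" "cmp f" shows "cmp (\<lambda>c. g (f c))"
proof -
  obtain p q where "constants p \<subseteq> C" "constants q \<subseteq> C"
    and "\<And>x r. exec p (st (enc (rep x) @ r)) (st (enc (rep (f x)) @ r))"
    and "\<And>x r. exec q (st (enc (rep x) @ r)) (st (enc (rep (g x)) @ r))"
    using assms unfolding cmp_def by blast
  then show ?thesis by (intro cmpI[of "Seq p q"]) (auto, blast intro: exec_Seq)
qed

lemma cmp_pair:
  assumes "cmp f" "cmp g" shows "cmp (\<lambda>c. (f c, g c))"
proof -
  obtain p q where *: "constants p \<subseteq> C" "constants q \<subseteq> C"
    and p: "\<And>x r. exec p (st (enc (rep x) @ r)) (st (enc (rep (f x)) @ r))"
    and q: "\<And>x r. exec q (st (enc (rep x) @ r)) (st (enc (rep (g x)) @ r))"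
    using assms unfolding cmp_def by blast
  show ?thesis
    by (rule cmpI[of "prog_seq [dup, p, swap, q, swap, Push 0 1]"],
        intro exec_prog_seq_Cons, rule exec_dup, rule p, rule exec_swap, rule q, rule exec_swap,
        rule exec_loop_free[OF _ refl], simp, rule exec_prog_seq_Nil)
       (use * in \<open>simp_all add: rep_prod_def constants_move_dup_swap_drop\<close>)
qed

lemma cmp_fst_prim: "cmp fst"
  by (intro cmpI[of "prog_seq [Pop 0, swap, drop_top]"] exec_prog_seq_Cons,
      rule exec_loop_free[OF _ refl], simp, unfold rep_prod_def enc.simps append.simps effect_st append_assoc,
      rule exec_swap, rule exec_drop_top, rule exec_prog_seq_Nil)
     (simp_all add: constants_move_dup_swap_drop)

lemma cmp_snd_prim: "cmp snd"
  by (intro cmpI[of "prog_seq [Pop 0, drop_top]"] exec_prog_seq_Cons,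
      rule exec_loop_free[OF _ refl], simp, unfold rep_prod_def enc.simps append.simps effect_st append_assoc,
      rule exec_drop_top, rule exec_prog_seq_Nil)
     (simp_all add: constants_move_dup_swap_drop)

lemma cmp_const: "x \<in> C \<Longrightarrow> cmp (\<lambda>c. x)"
  by (intro cmpI[of "prog_seq [drop_top, Push 0 x, Push 0 0]"] exec_prog_seq_Cons,
      rule exec_drop_top, (rule exec_loop_free[OF _ refl], simp)+, rule exec_prog_seq_Nil)
     (simp_all add: constants_move_dup_swap_drop rep_real_def)

lemma cmp_arith_prim: "cmp (\<lambda>c. arith_val a (fst c) (snd c))"
  by (rule cmpI[of "prog_seq [Pop 0, Pop 0, Copy 1 0, Pop 0, Pop 0, Arith a 1 1 0, Pop 0,
        Copy 0 1, Pop 1, Pop 1, Push 0 0]"], rule exec_loop_free)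
     (simp_all add: rep_prod_def rep_real_def st_def)

lemma cmp_less_prim: "cmp (\<lambda>c::real \<times> real. fst c < snd c)"
  by (rule cmpI[of "prog_seq [Pop 0, Pop 0, Copy 1 0, Pop 0, Pop 0,
        Cond (TopLess 1 0) (Push 2 1) (Push 2 0), Pop 0, Pop 1,
        Copy 0 2, Pop 2, Push 0 0]"], rule exec_loop_free)
     (simp_all add: rep_prod_def rep_real_def rep_bool_def st_def)

lemma cmp_if:
  assumes "cmp b" "cmp f" "cmp g" shows "cmp (\<lambda>c. if b c then f c else g c)"
proof -
  obtain p q t where *: "constants t \<subseteq> C" "constants p \<subseteq> C" "constants q \<subseteq> C"
    and t: "\<And>x r. exec t (st (enc (rep x) @ r)) (st (enc (rep (b x)) @ r))"
    and p: "\<And>x r. exec p (st (enc (rep x) @ r)) (st (enc (rep (f x)) @ r))"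
    and q: "\<And>x r. exec q (st (enc (rep x) @ r)) (st (enc (rep (g x)) @ r))"
    using assms unfolding cmp_def by blast
  let ?c = "Cond (TopLess 4 0) (prog_seq [Pop 0, p]) (prog_seq [Pop 0, q])"
  have 1: "exec (Pop 0) (st (v # a)) (st a)" for v a
    by (rule exec_loop_free) simp_all
  have c: "exec ?c (st ((if b x then 1 else 0) # enc (rep x) @ r))
      (st (enc (rep (if b x then f x else g x)) @ r))" for x r
  proof (cases "b x")
    case True
    then show ?thesis
      by (intro exec_CondT exec_prog_seq_Cons exec_prog_seq_Nil)
         (auto simp: st_def[of "_ # _"] intro!: 1[unfolded st_def[of "_ # _"]] p)
  next
    case False
    then show ?thesis
      by (intro exec_CondF exec_prog_seq_Cons exec_prog_seq_Nil)
         (auto simp: st_def[of "_ # _"] intro!: 1[unfolded st_def[of "_ # _"]] q)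
  qed
  show ?thesis
    by (rule cmpI[of "prog_seq [dup, t, Pop 0, ?c]"], intro exec_prog_seq_Cons,
        rule exec_dup, rule t, unfold rep_bool_def enc.simps append.simps, rule 1, rule c,
        rule exec_prog_seq_Nil)
       (use * in \<open>simp_all add: constants_move_dup_swap_drop\<close>)
qed

text \<open>Regroups a nonempty list and the value below it into head, tail and context, which is
  the shape of argument that \<open>h\<close> receives in \<open>cmp_case_list\<close> and
  \<open>cmp_fold\<close>.\<close>

definition uncons :: prog where
  "uncons = prog_seq [Pop 0, move, Push 0 1, transfer 1 0, Push 0 1]"

lemma exec_uncons:
  "exec uncons (st (1 # enc a @ enc b @ enc d @ r)) (st (enc (Node a (Node b d)) @ r))"
proof -
  have "exec (Pop 0) (st (1 # enc a @ enc b @ enc d @ r)) (mem (enc a @ enc b @ enc d @ r) [] [] [])"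
    "exec (Push 0 1) (mem (enc b @ enc d @ r) (rev (enc a) @ []) [] [])
       (mem (1 # enc b @ enc d @ r) (rev (enc a) @ []) [] [])"
    "exec (Push 0 1) (mem (rev (rev (enc a) @ []) @ 1 # enc b @ enc d @ r) [] [] [])
        (st (enc (Node a (Node b d)) @ r))"
    by (rule exec_loop_free; simp add: st_def)+
  then show ?thesis
    unfolding uncons_def
    by (blast intro: exec_prog_seq_Cons exec_prog_seq_Nil exec_move exec_transfer_mem)
qed

lemma constants_uncons: "constants uncons = {0, 1}"
  by (auto simp: uncons_def constants_move_dup_swap_drop)

lemma cmp_case_list:
  assumes "cmp f" "cmp g" "cmp (\<lambda>p. h (fst p) (fst (snd p)) (snd (snd p)))"
  shows "cmp (\<lambda>c. case f c of [] \<Rightarrow> g c | y # ys \<Rightarrow> h y ys c)"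
proof -
  obtain p q t where *: "constants t \<subseteq> C" "constants p \<subseteq> C" "constants q \<subseteq> C"
    and p: "\<And>x r. exec p (st (enc (rep x) @ r)) (st (enc (rep (f x)) @ r))"
    and q: "\<And>x r. exec q (st (enc (rep x) @ r)) (st (enc (rep (g x)) @ r))"
    and t: "\<And>x r. exec t (st (enc (rep x) @ r))
      (st (enc (rep (h (fst x) (fst (snd x)) (snd (snd x)))) @ r))"
    using assms unfolding cmp_def by blast
  let ?c = "Cond (TopLess 4 0) (Seq uncons t) (prog_seq [Pop 0, Pop 0, q])"
  have c: "exec ?c (st (enc (rep (f x)) @ enc (rep x) @ r))
    (st (enc (rep (case f x of [] \<Rightarrow> g x | y # ys \<Rightarrow> h y ys x)) @ r))" for x r
  proof (cases "f x")
    case Nil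
    have "exec (Pop 0) (st (v # a)) (st a)" for v a
      by (rule exec_loop_free) simp_all
    then have "exec (prog_seq [Pop 0, Pop 0, q]) (st (0 # 0 # enc (rep x) @ r)) (st (enc (rep (g x)) @ r))"
      using q by (blast intro: exec_prog_seq_Cons exec_prog_seq_Nil)
    then show ?thesis using Nil by (auto intro!: exec_CondF simp: st_def)
  next
    case (Cons y ys)
    have "exec (Seq uncons t) (st (1 # enc (rep y) @ enc (rep ys) @ enc (rep x) @ r))
        (st (enc (rep (h y ys x)) @ r))"
      using t[of "(y, ys, x)" r] exec_uncons[of "rep y" "rep ys" "rep x" r]
      by (auto intro: exec_Seq simp: rep_prod_def)
    then show ?thesis using Cons by (auto intro!: exec_CondT simp: st_def)
  qed
  show ?thesis
    by (rule cmpI[of "prog_seq [dup, p, ?c]"], intro exec_prog_seq_Cons,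
        rule exec_dup, rule p, rule c, rule exec_prog_seq_Nil)
       (use * in \<open>simp_all add: constants_move_dup_swap_drop constants_uncons\<close>)
qed

lemma cmp_fst: "cmp f \<Longrightarrow> cmp (\<lambda>c. fst (f c))"
  and cmp_snd: "cmp f \<Longrightarrow> cmp (\<lambda>c. snd (f c))"
  by (rule cmp_compose[OF cmp_fst_prim] cmp_compose[OF cmp_snd_prim], assumption)+

text \<open>List, accumulator and context lie consecutively on stack 0. The context \<open>c\<close>
  travels through the loop because \<open>h\<close> depends on it, and the tag of the remaining list
  controls the loop.\<close>

lemma cmp_fold:
  fixes f :: "'a::repr \<Rightarrow> 'b::repr list" and g :: "'a \<Rightarrow> 'c::repr"
  assumes "cmp f" "cmp g" "cmp (\<lambda>p. h (fst p) (fst (snd p)) (snd (snd p)))"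
  shows "cmp (\<lambda>c. fold (\<lambda>x a. h x a c) (f c) (g c))"
proof -
  have 1: "cmp (\<lambda>c. (f c, g c, c))"
    by (intro cmp_pair cmp_id assms)
  have 2: "cmp (\<lambda>p :: 'b \<times> 'b list \<times> 'c \<times> 'a. (fst (snd p),
      h (fst p) (fst (snd (snd p))) (snd (snd (snd p))), snd (snd (snd p))))"
    by (intro cmp_pair cmp_fst cmp_snd cmp_id
        cmp_compose[OF assms(3), of "\<lambda>p. (fst p, snd (snd p))", simplified])
  obtain p where *: "constants p \<subseteq> C"
    and p: "\<And>x r. exec p (st (enc (rep x) @ r)) (st (enc (rep (f x, g x, x)) @ r))"
    by (rule cmpE[OF 1]) (rule that)
  obtain q where **: "constants q \<subseteq> C"
    and q: "\<And>x :: 'b \<times> 'b list \<times> 'c \<times> 'a. \<And>r. exec q (st (enc (rep x) @ r)) (st (enc (rep (fst (snd x),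
       h (fst x) (fst (snd (snd x))) (snd (snd (snd x))), snd (snd (snd x)))) @ r))"
    by (rule cmpE[OF 2]) (rule that)
  have pop: "exec (Pop 0) (st (v # a)) (st a)" for v a
    by (rule exec_loop_free) simp_all
  \<comment> \<open>The final \<open>Pop 0\<close> strips the tag of the outer pair and exposes the
    tag of the remaining list to the loop test.\<close>
  let ?l = "Loop (TopLess 4 0) (prog_seq [uncons, q, Pop 0])"
  have loop: "exec ?l (st (enc (rep l) @ enc (rep (a, c)) @ r))
      (st (0 # 0 # enc (rep (fold (\<lambda>x a. h x a c) l a, c)) @ r))" for l a c r
  proof (induction l arbitrary: a)
    case Nil
    show ?case by (auto intro!: exec_LoopF simp: st_def)
  next
    case (Cons y ys)
    have "exec q (st (enc (Node (rep y) (Node (rep ys) (rep (a, c)))) @ r))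
       (st (1 # enc (rep ys) @ enc (rep (h y a c, c)) @ r))"
      using q[of "(y, ys, a, c)" r] by (simp add: rep_prod_def)
    then have "exec (prog_seq [uncons, q, Pop 0])
       (st (1 # enc (rep y) @ enc (rep ys) @ enc (rep (a, c)) @ r))
       (st (enc (rep ys) @ enc (rep (h y a c, c)) @ r))"
      by (blast intro: exec_prog_seq_Cons exec_prog_seq_Nil exec_uncons pop)
    moreover have "test_val (TopLess 4 0) (st (1 # enc (rep y) @ enc (rep ys) @ enc (rep (a, c)) @ r))"
      by (simp add: st_def)
    ultimately have "exec ?l (st (1 # enc (rep y) @ enc (rep ys) @ enc (rep (a, c)) @ r))
      (st (0 # 0 # enc (rep (fold (\<lambda>x a. h x a c) ys (h y a c), c)) @ r))"
      using Cons by (blast intro: exec_LoopT)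
    then show ?case by simp
  qed
  have "exec (prog_seq [p, Pop 0, ?l, Pop 0, Pop 0, Pop 0, swap, drop_top])
      (st (enc (rep c) @ r)) (st (enc (rep (fold (\<lambda>x a. h x a c) (f c) (g c))) @ r))" for c r
  proof -
    have p': "exec p (st (enc (rep c) @ r)) (st (1 # enc (rep (f c)) @ enc (rep (g c, c)) @ r))"
      using p[of c r] by (simp add: rep_prod_def)
    have e: "enc (rep (fold (\<lambda>x a. h x a c) (f c) (g c), c)) @ r
       = 1 # enc (rep (fold (\<lambda>x a. h x a c) (f c) (g c))) @ enc (rep c) @ r"
      by (simp add: rep_prod_def)
    show ?thesis
      by (rule exec_prog_seq_Cons, rule p', rule exec_prog_seq_Cons, rule pop,
          rule exec_prog_seq_Cons, rule loop, unfold e, (rule exec_prog_seq_Cons, rule pop)+,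
          rule exec_prog_seq_Cons, rule exec_swap, rule exec_prog_seq_Cons, rule exec_drop_top,
          rule exec_prog_seq_Nil, rule refl)
  qed
  then show ?thesis
    by (rule cmpI) (use * ** in \<open>simp_all add: constants_move_dup_swap_drop constants_uncons\<close>)
qed

section \<open>Conversion between raw stacks of reals and coded lists\<close>

definition read_input :: prog where
  "read_input = prog_seq [transfer 0 1, Push 0 0, Push 0 0,
     Loop (TNot (IsEmpty 1)) (prog_seq [Copy 0 1, Push 0 0, Push 0 1, Pop 1])]"

lemma exec_read_input: "exec read_input (st xs) (st (enc (rep xs)))"
proof -
  let ?b = "prog_seq [Copy 0 1, Push 0 0, Push 0 1, Pop 1]"
  have loop: "exec (Loop (TNot (IsEmpty 1)) ?b) (mem (enc (rep ys)) zs [] [])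
      (mem (enc (rep (rev zs @ ys))) [] [] [])" for ys zs :: "real list"
  proof (induction zs arbitrary: ys)
    case (Cons z zs)
    have "exec ?b (mem (enc (rep ys)) (z # zs) [] []) (mem (enc (rep (z # ys))) zs [] [])"
      by (rule exec_loop_free) (simp_all add: rep_real_def)
    moreover have "test_val (TNot (IsEmpty 1)) (mem (enc (rep ys)) (z # zs) [] [])"
      by simp
    ultimately have "exec (Loop (TNot (IsEmpty 1)) ?b) (mem (enc (rep ys)) (z # zs) [] [])
        (mem (enc (rep (rev zs @ z # ys))) [] [] [])"
      using Cons[of "z # ys"] by (blast intro: exec_LoopT)
    then show ?case by simp
  qed (auto intro!: exec_LoopF)
  have "exec (transfer 0 1) (st xs) (mem [] (rev xs) [] [])"
    using exec_transfer[of 0 1 "st xs"] by (simp add: st_def)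
  moreover have "exec (Push 0 0) (mem [] (rev xs) [] []) (mem [0] (rev xs) [] [])"
    "exec (Push 0 0) (mem [0] (rev xs) [] []) (mem (enc (rep ([] :: real list))) (rev xs) [] [])"
    by (rule exec_loop_free; simp)+
  ultimately show ?thesis
    using loop[of "[]" "rev xs"] unfolding read_input_def st_def[of "enc _"] rev_rev_ident append_Nil2
    by (blast intro: exec_prog_seq_Cons exec_prog_seq_Nil)
qed

definition write_output :: prog where
  "write_output = prog_seq [
     Loop (TopLess 4 0) (prog_seq [Pop 0, Pop 0, Copy 1 0, Pop 0]), Pop 0, Pop 0, transfer 1 0]"

lemma exec_write_output: "exec write_output (st (enc (rep xs))) (st xs)" for xs :: "real list"
proof -
  let ?b = "prog_seq [Pop 0, Pop 0, Copy 1 0, Pop 0]"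
  have loop: "exec (Loop (TopLess 4 0) ?b) (mem (enc (rep xs)) ys [] [])
      (mem [0, 0] (rev xs @ ys) [] [])" for xs ys :: "real list"
  proof (induction xs arbitrary: ys)
    case Nil
    show ?case by (auto intro!: exec_LoopF)
  next
    case (Cons x xs)
    have "exec ?b (mem (enc (rep (x # xs))) ys [] []) (mem (enc (rep xs)) (x # ys) [] [])"
      by (rule exec_loop_free) (simp_all add: rep_real_def)
    moreover have "test_val (TopLess 4 0) (mem (enc (rep (x # xs))) ys [] [])"
      by simp
    ultimately have "exec (Loop (TopLess 4 0) ?b) (mem (enc (rep (x # xs))) ys [] [])
        (mem [0, 0] (rev xs @ x # ys) [] [])"
      using Cons[of "x # ys"] by (blast intro: exec_LoopT)
    then show ?case by simp
  qed
  have "exec (Pop 0) (mem [0, 0] (rev xs @ []) [] []) (mem [0] (rev xs @ []) [] [])"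
    "exec (Pop 0) (mem [0] (rev xs @ []) [] []) (mem [] (rev xs @ []) [] [])"
    by (rule exec_loop_free; simp)+
  moreover have "exec (transfer 1 0) (mem [] (rev xs @ []) [] []) (st xs)"
    using exec_transfer_mem(1)[of "[]" "rev xs" "[]" "[]"] by (simp add: st_def)
  ultimately show ?thesis
    unfolding write_output_def st_def[of "enc _"]
    by (blast intro: exec_prog_seq_Cons exec_prog_seq_Nil loop)
qed

lemma cmp_prog:
  assumes "cmp f"
  obtains p where "constants p \<subseteq> C" "\<And>xs. exec p (st xs) (st (encode_formula (f xs)))"
proof -
  obtain p where *: "constants p \<subseteq> C"
    and p: "\<And>x r. exec p (st (enc (rep x) @ r)) (st (enc (rep (f x)) @ r))"
    using assms unfolding cmp_def by blast
  show thesis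
  proof (rule that)
    show "exec (prog_seq [read_input, p, write_output]) (st xs) (st (encode_formula (f xs)))" for xs
    proof (intro exec_prog_seq_Cons)
      show "exec read_input (st xs) (st (enc (rep xs)))" by (rule exec_read_input)
      show "exec p (st (enc (rep xs))) (st (enc (rep (encode_formula (f xs)))))"
        using p[of xs "[]"] by (simp add: rep_qf_formula_def)
      show "exec write_output (st (enc (rep (encode_formula (f xs))))) (st (encode_formula (f xs)))"
        by (rule exec_write_output)
      show "exec (prog_seq []) (st (encode_formula (f xs))) (st (encode_formula (f xs)))"
        by (rule exec_prog_seq_Nil) (rule refl)
    qed
    show "constants (prog_seq [read_input, p, write_output]) \<subseteq> C"
      using * by (simp add: read_input_def write_output_def constants_move_dup_swap_drop)
  qed
qed

end

section \<open>Closure rules for arithmetic, lists and formulas\<close>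

context stack_machine
begin

lemma cmp_uminus_one: "cmp (\<lambda>c. - 1 :: real)" and cmp_zero: "cmp (\<lambda>c. 0 :: real)"
  and cmp_one: "cmp (\<lambda>c. 1 :: real)" and cmp_numeral: "cmp (\<lambda>c. numeral w :: real)"
  by (simp_all add: cmp_const)

lemma cmp_plus: "cmp f \<Longrightarrow> cmp g \<Longrightarrow> cmp (\<lambda>c. f c + g c :: real)"
  and cmp_minus: "cmp f \<Longrightarrow> cmp g \<Longrightarrow> cmp (\<lambda>c. f c - g c :: real)"
  and cmp_times: "cmp f \<Longrightarrow> cmp g \<Longrightarrow> cmp (\<lambda>c. f c * g c :: real)"
  and cmp_divide: "cmp f \<Longrightarrow> cmp g \<Longrightarrow> cmp (\<lambda>c. f c / g c :: real)"
  and cmp_less: "cmp f \<Longrightarrow> cmp g \<Longrightarrow> cmp (\<lambda>c. f c < (g c :: real))"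
  using cmp_compose[OF cmp_arith_prim[of Plus] cmp_pair, of f g]
    cmp_compose[OF cmp_arith_prim[of Minus] cmp_pair, of f g]
    cmp_compose[OF cmp_arith_prim[of Times] cmp_pair, of f g]
    cmp_compose[OF cmp_arith_prim[of Divide] cmp_pair, of f g]
    cmp_compose[OF cmp_less_prim cmp_pair, of f g] by simp_all

lemma cmp_True: "cmp (\<lambda>c. True)" and cmp_False: "cmp (\<lambda>c. False)"
proof -
  have "cmp (\<lambda>c. 0 < (1::real))" "cmp (\<lambda>c. 0 < (0::real))"
    by (rule cmp_less cmp_zero cmp_one)+
  then show "cmp (\<lambda>c. True)" "cmp (\<lambda>c. False)" by simp_all
qed

lemma cmp_conj: assumes "cmp f" "cmp g" shows "cmp (\<lambda>c. f c \<and> g c)"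
proof -
  have "(\<lambda>c. f c \<and> g c) = (\<lambda>c. if f c then g c else False)" by auto
  then show ?thesis by (simp only:) (intro cmp_if assms cmp_False)
qed

lemma cmp_not: assumes "cmp f" shows "cmp (\<lambda>c. \<not> f c)"
proof -
  have "(\<lambda>c. \<not> f c) = (\<lambda>c. if f c then False else True)" by auto
  then show ?thesis by (simp only:) (intro cmp_if assms cmp_False cmp_True)
qed

lemma cmp_disj: assumes "cmp f" "cmp g" shows "cmp (\<lambda>c. f c \<or> g c)"
proof -
  have "(\<lambda>c. f c \<or> g c) = (\<lambda>c. if f c then True else g c)" by auto
  then show ?thesis by (simp only:) (intro cmp_if assms cmp_True)
qed

lemma cmp_le: "cmp f \<Longrightarrow> cmp g \<Longrightarrow> cmp (\<lambda>c. f c \<le> (g c :: real))"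
  using cmp_not[OF cmp_less[of g f]] by (simp add: not_less)

lemma cmp_eq_real: "cmp f \<Longrightarrow> cmp g \<Longrightarrow> cmp (\<lambda>c. f c = (g c :: real))"
  using cmp_conj[OF cmp_le[of f g] cmp_le[of g f]] by (simp add: eq_iff)

lemma cmp_Nil: "cmp (\<lambda>c. [])"
proof -
  have "cmp (\<lambda>c. 0 :: real)" by (rule cmp_zero)
  then show ?thesis by (simp add: cmp_def rep_real_def)
qed

lemma cmp_Cons: "cmp f \<Longrightarrow> cmp g \<Longrightarrow> cmp (\<lambda>c. f c # g c)"
  using cmp_pair[of f g] by (simp add: cmp_def rep_prod_def)

lemmas cmp_basic = cmp_id cmp_fst cmp_snd cmp_pair cmp_uminus_one cmp_zero cmp_one cmp_numeral
  cmp_plus cmp_minus cmp_times cmp_divide cmp_less cmp_le cmp_eq_real cmp_True cmp_False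
  cmp_conj cmp_disj cmp_not cmp_if cmp_Nil cmp_Cons cmp_case_list cmp_fold

lemma cmp_rev: "cmp f \<Longrightarrow> cmp (\<lambda>c. rev (f c))"
proof -
  assume "cmp f"
  then have "cmp (\<lambda>c. fold (\<lambda>x a. x # a) (f c) [])" by (intro cmp_basic)
  then show ?thesis by (simp add: rev_conv_fold)
qed

lemma cmp_append:
  assumes "cmp f" "cmp g" shows "cmp (\<lambda>c. f c @ g c)"
proof -
  have "cmp (\<lambda>c. fold (\<lambda>x a. x # a) (rev (f c)) (g c))" by (intro cmp_basic cmp_rev assms)
  then show ?thesis by (simp add: fold_Cons_rev)
qed

lemma cmp_foldr:
  assumes "cmp f" "cmp g" "cmp (\<lambda>p. h (fst p) (fst (snd p)) (snd (snd p)))"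
  shows "cmp (\<lambda>c. foldr (\<lambda>x a. h x a c) (f c) (g c))"
  unfolding foldr_conv_fold by (intro cmp_fold cmp_rev assms)

lemma cmp_map:
  assumes "cmp f" "cmp (\<lambda>p. h (fst p) (snd p))"
  shows "cmp (\<lambda>c. map (\<lambda>x. h x c) (f c))"
proof -
  have "cmp (\<lambda>c. foldr (\<lambda>x a. h x c # a) (f c) [])"
    by (intro cmp_foldr cmp_basic assms
        cmp_compose[OF assms(2), of "\<lambda>p. (fst p, snd (snd p))", simplified])
  moreover have "foldr (\<lambda>x a. h x c # a) xs [] = map (\<lambda>x. h x c) xs" for xs c
    by (induction xs) auto
  ultimately show ?thesis by simp
qed

lemma cmp_filter:
  assumes "cmp f" "cmp (\<lambda>p. h (fst p) (snd p))"
  shows "cmp (\<lambda>c. filter (\<lambda>x. h x c) (f c))"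
proof -
  have "cmp (\<lambda>c. foldr (\<lambda>x a. if h x c then x # a else a) (f c) [])"
    by (intro cmp_foldr cmp_basic assms
        cmp_compose[OF assms(2), of "\<lambda>p. (fst p, snd (snd p))", simplified])
  moreover have "foldr (\<lambda>x a. if h x c then x # a else a) xs [] = filter (\<lambda>x. h x c) xs" for xs c
    by (induction xs) auto
  ultimately show ?thesis by simp
qed

lemma cmp_list_all:
  assumes "cmp f" "cmp (\<lambda>p. h (fst p) (snd p))"
  shows "cmp (\<lambda>c. list_all (\<lambda>x. h x c) (f c))"
proof -
  have "cmp (\<lambda>c. foldr (\<lambda>x a. h x c \<and> a) (f c) True)"
    by (intro cmp_foldr cmp_basic assms
        cmp_compose[OF assms(2), of "\<lambda>p. (fst p, snd (snd p))", simplified])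
  moreover have "foldr (\<lambda>x a. h x c \<and> a) xs True = list_all (\<lambda>x. h x c) xs" for xs c
    by (induction xs) auto
  ultimately show ?thesis by simp
qed

lemma cmp_list_ex:
  assumes "cmp f" "cmp (\<lambda>p. h (fst p) (snd p))"
  shows "cmp (\<lambda>c. list_ex (\<lambda>x. h x c) (f c))"
proof -
  have "cmp (\<lambda>c. foldr (\<lambda>x a. h x c \<or> a) (f c) False)"
    by (intro cmp_foldr cmp_basic assms
        cmp_compose[OF assms(2), of "\<lambda>p. (fst p, snd (snd p))", simplified])
  moreover have "foldr (\<lambda>x a. h x c \<or> a) xs False = list_ex (\<lambda>x. h x c) xs" for xs c
    by (induction xs) auto
  ultimately show ?thesis by simp
qed

lemma cmp_concat: "cmp f \<Longrightarrow> cmp (\<lambda>c. concat (f c))"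
proof -
  assume "cmp f"
  then have "cmp (\<lambda>c. foldr (\<lambda>x a. x @ a) (f c) [])" by (intro cmp_foldr cmp_append cmp_basic)
  then show ?thesis by (simp add: concat_conv_foldr)
qed

lemma cmp_sum_list: "cmp f \<Longrightarrow> cmp (\<lambda>c. sum_list (f c) :: real)"
proof -
  assume "cmp f"
  then have "cmp (\<lambda>c. foldr (\<lambda>x a. x + a) (f c) 0 :: real)" by (intro cmp_foldr cmp_basic)
  moreover have "foldr (\<lambda>x a. x + a) xs 0 = sum_list xs" for xs :: "real list"
    by (induction xs) auto
  ultimately show ?thesis by simp
qed

text \<open>A \<open>fold\<close> traverses one list only, so the accumulator holds the unread part
  of the second one; \<open>cmp_eq_list\<close> uses the same device.\<close>

lemma cmp_zip:
  fixes f :: "'a::repr \<Rightarrow> 'b::repr list" and g :: "'a \<Rightarrow> 'c::repr list"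
  assumes "cmp f" "cmp g" shows "cmp (\<lambda>c. zip (f c) (g c))"
proof -
  let ?h = "\<lambda>(x :: 'b) (s :: ('b \<times> 'c) list \<times> 'c list). case snd s of [] \<Rightarrow> s | y # ys \<Rightarrow> (fst s @ [(x, y)], ys)"
  have "cmp (\<lambda>c. fst (fold ?h (f c) ([], g c)))"
    by (intro cmp_basic cmp_append assms)
  moreover have "fst (fold ?h xs (zs, ys)) = zs @ zip xs ys" for xs ys zs
    by (induction xs arbitrary: zs ys) (auto split: list.split)
  ultimately show ?thesis by simp
qed

lemma cmp_eq_list:
  assumes "cmp f" "cmp g" shows "cmp (\<lambda>c. f c = (g c :: real list))"
proof -
  let ?h = "\<lambda>x s. case snd s of [] \<Rightarrow> (False, []) | y # ys \<Rightarrow> (fst s \<and> x = y, ys)"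
  let ?n = "\<lambda>s. case snd s of [] \<Rightarrow> fst s | y # ys \<Rightarrow> False"
  have "cmp (\<lambda>c. ?n (fold ?h (f c) (True, g c)))"
    by (intro cmp_basic assms)
  moreover have "?n s = (fst s \<and> snd s = [])" for s :: "bool \<times> real list"
    by (cases "snd s") auto
  moreover have "(fst (fold ?h xs (b, ys)) \<and> snd (fold ?h xs (b, ys)) = []) = (b \<and> xs = ys)" for xs b and ys :: "real list"
  proof (induction xs arbitrary: b ys)
    case Nil
    show ?case by (cases ys) simp_all
  next
    case (Cons x xs)
    show ?case by (cases ys) (simp_all add: Cons)
  qed
  ultimately show ?thesis by (simp only:) simp
qed

lemma cmp_product_lists:
  fixes f :: "'a::repr \<Rightarrow> 'b::repr list list"
  assumes f: "cmp f" shows "cmp (\<lambda>c. product_lists (f c))"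
proof -
  let ?h = "\<lambda>(xs :: 'b list) a. concat (map (\<lambda>x. map (\<lambda>y. x # y) a) xs)"
  have "cmp (\<lambda>c. foldr ?h (f c) [[]])"
    by (intro cmp_foldr cmp_concat cmp_map cmp_basic f)
  moreover have "foldr ?h xss [[]] = product_lists xss" for xss
    by (induction xss) auto
  ultimately show ?thesis by simp
qed

lemmas cmp_lists = cmp_basic cmp_rev cmp_append cmp_foldr cmp_map cmp_filter cmp_list_all cmp_list_ex
  cmp_concat cmp_sum_list cmp_zip cmp_eq_list cmp_product_lists

lemma cmp_as_code: "cmp f \<Longrightarrow> (\<And>c. rep (f c) = rep (g c)) \<Longrightarrow> cmp g"
  by (simp add: cmp_def)

lemma cmp_encode_poly: "cmp f \<Longrightarrow> cmp (\<lambda>c. encode_poly (f c))"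
  and cmp_encode_formula: "cmp g \<Longrightarrow> cmp (\<lambda>c. encode_formula (g c))"
  by (simp_all add: cmp_def rep_rpoly_def rep_qf_formula_def)

lemma cmp_PConst: "cmp f \<Longrightarrow> cmp (\<lambda>c. PConst (f c))"
  by (rule cmp_as_code[of "\<lambda>c. [0, f c]"]) (auto simp: rep_rpoly_def intro!: cmp_basic)

lemma cmp_PVar: "cmp (\<lambda>c. PVar i)"
  by (rule cmp_as_code[of "\<lambda>c. [1, real i]"]) (auto simp: rep_rpoly_def intro!: cmp_basic cmp_const)

lemma cmp_PAdd: "cmp f \<Longrightarrow> cmp g \<Longrightarrow> cmp (\<lambda>c. PAdd (f c) (g c))"
  by (rule cmp_as_code[of "\<lambda>c. 2 # encode_poly (f c) @ encode_poly (g c)"])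
     (auto simp: rep_rpoly_def intro!: cmp_basic cmp_append cmp_encode_poly)

lemma cmp_PMul: "cmp f \<Longrightarrow> cmp g \<Longrightarrow> cmp (\<lambda>c. PMul (f c) (g c))"
  by (rule cmp_as_code[of "\<lambda>c. 3 # encode_poly (f c) @ encode_poly (g c)"])
     (auto simp: rep_rpoly_def intro!: cmp_basic cmp_append cmp_encode_poly)

lemma cmp_EqZero: "cmp f \<Longrightarrow> cmp (\<lambda>c. EqZero (f c))"
  by (rule cmp_as_code[of "\<lambda>c. 0 # encode_poly (f c)"])
     (auto simp: rep_qf_formula_def intro!: cmp_basic cmp_encode_poly)

lemma cmp_GtZero: "cmp f \<Longrightarrow> cmp (\<lambda>c. GtZero (f c))"
  by (rule cmp_as_code[of "\<lambda>c. 1 # encode_poly (f c)"])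
     (auto simp: rep_qf_formula_def intro!: cmp_basic cmp_encode_poly)

lemma cmp_FNeg: "cmp f \<Longrightarrow> cmp (\<lambda>c. FNeg (f c))"
  by (rule cmp_as_code[of "\<lambda>c. 2 # encode_formula (f c)"])
     (auto simp: rep_qf_formula_def intro!: cmp_basic cmp_encode_formula)

lemma cmp_FConj: "cmp f \<Longrightarrow> cmp g \<Longrightarrow> cmp (\<lambda>c. FConj (f c) (g c))"
  by (rule cmp_as_code[of "\<lambda>c. 3 # encode_formula (f c) @ encode_formula (g c)"])
     (auto simp: rep_qf_formula_def intro!: cmp_basic cmp_append cmp_encode_formula)

lemma cmp_FDisj: "cmp f \<Longrightarrow> cmp g \<Longrightarrow> cmp (\<lambda>c. FDisj (f c) (g c))"
  by (rule cmp_as_code[of "\<lambda>c. 4 # encode_formula (f c) @ encode_formula (g c)"])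
     (auto simp: rep_qf_formula_def intro!: cmp_basic cmp_append cmp_encode_formula)

lemmas cmp_formulas = cmp_PConst cmp_PVar cmp_PAdd cmp_PMul cmp_EqZero cmp_GtZero cmp_FNeg
  cmp_FConj cmp_FDisj

end

section \<open>Continuous Petri nets\<close>

locale petri =
  fixes Act :: "'t set" and mid :: "'t \<Rightarrow> 'a" and inc :: "'t \<Rightarrow> 'a \<Rightarrow> real"
  assumes finite_Act: "finite Act"
    and inc_mid: "\<tau> \<in> Act \<Longrightarrow> inc \<tau> (mid \<tau>) < 0"
    and inc_nonneg: "\<tau> \<in> Act \<Longrightarrow> a \<noteq> mid \<tau> \<Longrightarrow> 0 \<le> inc \<tau> a"
begin

definition eff :: "('t \<Rightarrow> real) \<Rightarrow> 'a \<Rightarrow> real" where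
  "eff y a = (\<Sum>\<tau>\<in>Act. y \<tau> * inc \<tau> a)"

text \<open>\<open>y\<close> is the total amount fired of each action, with the order forgotten.
  Only \<open>mid \<tau>\<close> has to be tested after a step, since \<open>inc_nonneg\<close>
  prevents losses elsewhere.\<close>

inductive runs :: "('a \<Rightarrow> real) \<Rightarrow> ('t \<Rightarrow> real) \<Rightarrow> bool" where
  runs_none: "\<forall>a. 0 \<le> m a \<Longrightarrow> runs m (\<lambda>_. 0)"
| runs_step: "\<tau> \<in> Act \<Longrightarrow> 0 \<le> t \<Longrightarrow> \<forall>a. 0 \<le> m a \<Longrightarrow> 0 \<le> m (mid \<tau>) + t * inc \<tau> (mid \<tau>) \<Longrightarrow>
    runs (\<lambda>a. m a + t * inc \<tau> a) y \<Longrightarrow> runs m (\<lambda>s. y s + (if s = \<tau> then t else 0))"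

lemma eff_zero [simp]: "eff (\<lambda>_. 0) a = 0"
  by (simp add: eff_def)

lemma eff_add: "eff (\<lambda>s. y s + z s) a = eff y a + eff z a"
  by (simp add: eff_def distrib_right sum.distrib)

lemma eff_diff: "eff (\<lambda>s. y s - z s) a = eff y a - eff z a"
  by (simp add: eff_def left_diff_distrib sum_subtractf)

lemma eff_scale: "eff (\<lambda>s. c * y s) a = c * eff y a"
  by (simp add: eff_def sum_distrib_left mult.assoc)

lemma eff_sum: "eff (\<lambda>s. \<Sum>i\<in>I. y i s) a = (\<Sum>i\<in>I. eff (y i) a)"
  unfolding eff_def by (subst sum.swap) (simp add: sum_distrib_right)

lemma eff_single: "\<tau> \<in> Act \<Longrightarrow> eff (\<lambda>s. if s = \<tau> then t else 0) a = t * inc \<tau> a"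
proof -
  assume "\<tau> \<in> Act"
  moreover have "eff (\<lambda>s. if s = \<tau> then t else 0) a = (\<Sum>s\<in>Act. if s = \<tau> then t * inc s a else 0)"
    unfolding eff_def by (rule sum.cong) auto
  ultimately show ?thesis by (simp add: finite_Act)
qed

lemma runs_nonneg: "runs m y \<Longrightarrow> 0 \<le> m a"
  by (cases rule: runs.cases) auto

lemma runs_count_nonneg: "runs m y \<Longrightarrow> 0 \<le> y s"
  by (induction rule: runs.induct) auto

lemma runs_count_supp: "runs m y \<Longrightarrow> s \<notin> Act \<Longrightarrow> y s = 0"
  by (induction rule: runs.induct) auto

lemma runs_final_nonneg: "runs m y \<Longrightarrow> 0 \<le> m a + eff y a"
proof (induction rule: runs.induct)
  case (runs_step \<tau> t m y)
  then show ?case by (simp add: eff_add eff_single algebra_simps)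
qed simp

lemma runs_mono: "runs m y \<Longrightarrow> (\<And>a. m a \<le> n a) \<Longrightarrow> runs n y"
proof (induction arbitrary: n rule: runs.induct)
  case (runs_none m)
  then show ?case by (intro runs.runs_none) (meson order_trans)
next
  case (runs_step \<tau> t m y)
  then show ?case
    by (intro runs.runs_step) (auto intro: order_trans[OF spec[OF runs_step(3)]] order_trans[OF runs_step(4)])
qed

lemma runs_scale: "runs m y \<Longrightarrow> 0 \<le> c \<Longrightarrow> runs (\<lambda>a. c * m a) (\<lambda>s. c * y s)"
proof (induction rule: runs.induct)
  case (runs_none m)
  then show ?case by (simp add: runs.runs_none)
next
  case (runs_step \<tau> t m y)
  have "runs (\<lambda>a. c * m a) (\<lambda>s. c * y s + (if s = \<tau> then c * t else 0))"
  proof (rule runs.runs_step)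
    have "0 \<le> c * (m (mid \<tau>) + t * inc \<tau> (mid \<tau>))"
      using runs_step by simp
    then show "0 \<le> c * m (mid \<tau>) + c * t * inc \<tau> (mid \<tau>)"
      by (simp add: algebra_simps)
  qed (use runs_step in \<open>simp_all add: algebra_simps\<close>)
  moreover have "(\<lambda>s. c * (y s + (if s = \<tau> then t else 0))) = (\<lambda>s. c * y s + (if s = \<tau> then c * t else 0))"
    by (auto simp: algebra_simps)
  ultimately show ?case by simp
qed

lemma runs_append: "runs m y \<Longrightarrow> runs (\<lambda>a. m a + eff y a) z \<Longrightarrow> runs m (\<lambda>s. y s + z s)"
proof (induction arbitrary: z rule: runs.induct)
  case (runs_step \<tau> t m y)
  have "runs m (\<lambda>s. (y s + z s) + (if s = \<tau> then t else 0))"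
  proof (rule runs.runs_step)
    show "runs (\<lambda>a. m a + t * inc \<tau> a) (\<lambda>s. y s + z s)"
      by (rule runs_step.IH) (use runs_step in \<open>simp add: eff_add eff_single algebra_simps\<close>)
  qed (use runs_step in auto)
  then show ?case by (simp add: algebra_simps)
qed simp

text \<open>The two runs are executed one after the other: the first tolerates the extra mass
  \<open>n\<close>, the second the mass that the first leaves behind.\<close>

lemma runs_par: "runs m y \<Longrightarrow> runs n z \<Longrightarrow> runs (\<lambda>a. m a + n a) (\<lambda>s. y s + z s)"
  using runs_nonneg[of n z] runs_final_nonneg[of m y]
  by (intro runs_append) (auto elim!: runs_mono simp: algebra_simps)

lemma runs_sum:
  "finite I \<Longrightarrow> (\<And>i. i \<in> I \<Longrightarrow> runs (m i) (y i)) \<Longrightarrow> runs (\<lambda>a. \<Sum>i\<in>I. m i a) (\<lambda>s. \<Sum>i\<in>I. y i s)"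
  by (induction I rule: finite_induct) (simp_all add: runs_none runs_par)

lemma runs_single:
  "\<tau> \<in> Act \<Longrightarrow> 0 \<le> t \<Longrightarrow> \<forall>a. 0 \<le> m a \<Longrightarrow> 0 \<le> m (mid \<tau>) + t * inc \<tau> (mid \<tau>) \<Longrightarrow>
    runs m (\<lambda>s. if s = \<tau> then t else 0)"
  using runs_step[of \<tau> t m "\<lambda>_. 0"] inc_nonneg[of \<tau>]
  by (simp, metis (no_types, lifting) add_nonneg_nonneg mult_nonneg_nonneg runs_none)

text \<open>When every place covers the total demand made on it, the order of firing is irrelevant:
  a step uses up its own share of the demand at \<open>mid\<close> and can only add mass
  elsewhere.\<close>

lemma runs_round:
  assumes "finite F" "F \<subseteq> Act" "\<And>s. 0 \<le> y s" "\<And>a. (\<Sum>\<tau>\<in>{\<tau>\<in>F. mid \<tau> = a}. y \<tau> * - inc \<tau> a) \<le> m a"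
  shows "runs m (\<lambda>s. if s \<in> F then y s else 0)"
  using assms
proof (induction F arbitrary: m rule: finite_induct)
  case empty
  then show ?case using runs_none[of m] by simp
next
  case (insert \<tau> F)
  have nn: "0 \<le> (\<Sum>\<tau>\<in>{\<tau>\<in>G. mid \<tau> = a}. y \<tau> * - inc \<tau> a)" if "G \<subseteq> Act" for G a
    using that insert.prems(2) inc_mid by (intro sum_nonneg) (auto simp: mult_nonneg_nonpos less_imp_le)
  have *: "{s \<in> insert \<tau> F. mid s = a} = (if mid \<tau> = a then insert \<tau> {s \<in> F. mid s = a} else {s \<in> F. mid s = a})" for a
    by auto
  have "runs m (\<lambda>s. (if s \<in> F then y s else 0) + (if s = \<tau> then y \<tau> else 0))"
  proof (rule runs_step)
    show "\<tau> \<in> Act" "0 \<le> y \<tau>" using insert.prems by auto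
    show "\<forall>a. 0 \<le> m a" using nn[OF insert.prems(1)] insert.prems(3) order_trans by blast
    show "0 \<le> m (mid \<tau>) + y \<tau> * inc \<tau> (mid \<tau>)"
      using insert.prems(3)[of "mid \<tau>", unfolded *] nn[of F "mid \<tau>"] insert.prems(1) insert.hyps
      by simp
    show "runs (\<lambda>a. m a + y \<tau> * inc \<tau> a) (\<lambda>s. if s \<in> F then y s else 0)"
    proof (rule insert.IH)
      fix a
      show "(\<Sum>\<tau>\<in>{\<tau>\<in>F. mid \<tau> = a}. y \<tau> * - inc \<tau> a) \<le> m a + y \<tau> * inc \<tau> a"
        using insert.prems(3)[of a, unfolded *] insert.hyps insert.prems(1)
          mult_nonneg_nonneg[OF insert.prems(2)[of \<tau>] inc_nonneg[of \<tau> a]]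
        by (cases "mid \<tau> = a") auto
    qed (use insert.prems in auto)
  qed
  moreover have "(\<lambda>s. (if s \<in> F then y s else 0) + (if s = \<tau> then y \<tau> else 0)) =
      (\<lambda>s. if s \<in> insert \<tau> F then y s else 0)"
    using insert.hyps by auto
  ultimately show ?case by simp
qed

lemma finite_positive_lower_bound:
  "finite I \<Longrightarrow> (\<And>i. i \<in> I \<Longrightarrow> 0 < (f i :: real)) \<Longrightarrow> \<exists>\<delta>>0. \<forall>i\<in>I. \<delta> \<le> f i"
proof (induction I rule: finite_induct)
  case (insert i I)
  then obtain \<delta> where "\<delta> > 0" "\<forall>i\<in>I. \<delta> \<le> f i" by auto
  then show ?case using insert.prems[of i] by (intro exI[of _ "min \<delta> (f i)"]) auto
qed (auto intro: exI[of _ 1])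

text \<open>Firing \<open>z\<close> in sufficiently many equal rounds keeps all the places involved positive, because
  the configuration moves along the segment between two positive ones.\<close>

lemma runs_between_positive:
  assumes z: "\<And>s. 0 \<le> z s" "\<And>s. s \<notin> Act \<Longrightarrow> z s = 0"
    and m: "\<And>a. 0 \<le> m a" "\<And>a. 0 \<le> m a + eff z a"
    and pos: "\<And>\<tau>. \<tau> \<in> Act \<Longrightarrow> 0 < z \<tau> \<Longrightarrow> 0 < m (mid \<tau>) \<and> 0 < m (mid \<tau>) + eff z (mid \<tau>)"
  shows "runs m z"
proof -
  define A where "A = {\<tau>\<in>Act. 0 < z \<tau>}"
  have finA: "finite A" using finite_Act by (simp add: A_def)
  obtain \<delta> where \<delta>: "\<delta> > 0" "\<forall>\<tau>\<in>A. \<delta> \<le> min (m (mid \<tau>)) (m (mid \<tau>) + eff z (mid \<tau>))"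
    using finite_positive_lower_bound[OF finA, of "\<lambda>\<tau>. min (m (mid \<tau>)) (m (mid \<tau>) + eff z (mid \<tau>))"] pos
    by (auto simp: A_def)
  define B where "B = (\<Sum>\<tau>\<in>Act. z \<tau> * - inc \<tau> (mid \<tau>))"
  \<comment> \<open>\<open>B\<close> bounds what one pass through \<open>z\<close> takes from any
    place, and \<delta> bounds from below the mass at the places involved, so one round out of
    \<open>N\<close> is always affordable.\<close>
  obtain N :: nat where N: "B / \<delta> < real N" "0 < N"
    using reals_Archimedean2[of "max (B / \<delta>) 0"] by (auto simp: max_less_iff_conj)
  then have BN: "B / real N \<le> \<delta>" using \<delta>(1) by (simp add: field_simps)
  \<comment> \<open>\<open>j\<close> counts the rounds that are still to be fired; the induction
    builds the run from its end.\<close>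
  have "j \<le> N \<Longrightarrow> runs (\<lambda>a. m a + (1 - j / N) * eff z a) (\<lambda>s. j / N * z s)" for j :: nat
  proof (induction j)
    case 0
    then show ?case using runs_none[of "\<lambda>a. m a + eff z a"] m by simp
  next
    case (Suc j)
    define u where "u = 1 - Suc j / real N"
    have u: "0 \<le> u" "u \<le> 1" using Suc.prems N(2) by (auto simp: u_def field_simps)
    define m' where "m' = (\<lambda>a. m a + u * eff z a)"
    have mix: "m' a = (1 - u) * m a + u * (m a + eff z a)" for a
      by (simp add: m'_def algebra_simps)
    have m'0: "0 \<le> m' a" for a
      unfolding mix using u m(1)[of a] mult_nonneg_nonneg[OF u(1) m(2)[of a]]
      by (intro add_nonneg_nonneg) auto
    have m'\<delta>: "\<delta> \<le> m' (mid \<tau>)" if "\<tau> \<in> A" for \<tau>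
    proof -
      have "(1 - u) * \<delta> + u * \<delta> \<le> m' (mid \<tau>)"
        unfolding mix using u \<delta>(2) that by (intro add_mono mult_left_mono) auto
      then show ?thesis by (simp add: algebra_simps)
    qed
    have "runs m' (\<lambda>s. if s \<in> Act then 1 / N * z s else 0)"
    proof (rule runs_round[OF finite_Act])
      show "0 \<le> 1 / N * z s" for s using z by simp
      fix a
      let ?S = "{\<tau> \<in> Act. mid \<tau> = a}"
      show "(\<Sum>\<tau>\<in>?S. 1 / N * z \<tau> * - inc \<tau> a) \<le> m' a"
      proof (cases "\<exists>\<tau>\<in>A. mid \<tau> = a")
        case True
        have "(\<Sum>\<tau>\<in>?S. 1 / N * z \<tau> * - inc \<tau> a) = (\<Sum>\<tau>\<in>?S. z \<tau> * - inc \<tau> (mid \<tau>)) / N"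
          by (simp add: sum_divide_distrib)
        also have "\<dots> \<le> B / N"
          unfolding B_def using z inc_mid finite_Act
          by (intro divide_right_mono sum_mono2) (auto simp: mult_nonneg_nonpos less_imp_le)
        also have "\<dots> \<le> m' a" using BN m'\<delta> True by force
        finally show ?thesis .
      next
        case False
        then have "(\<Sum>\<tau>\<in>?S. 1 / N * z \<tau> * - inc \<tau> a) = 0"
          using z by (intro sum.neutral) (auto simp: A_def order.order_iff_strict)
        then show ?thesis using m'0 by simp
      qed
    qed auto
    moreover have "(\<lambda>s. if s \<in> Act then 1 / N * z s else 0) = (\<lambda>s. 1 / N * z s)"
      using z(2) by auto
    ultimately have "runs m' (\<lambda>s. 1 / N * z s)" by simp
    moreover have "m' a + eff (\<lambda>s. 1 / N * z s) a = m a + (1 - j / N) * eff z a" for a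
    proof -
      have "u + 1 / N = 1 - j / N" by (simp add: u_def add_divide_distrib)
      then have "(u + 1 / N) * eff z a = (1 - j / N) * eff z a" by simp
      then show ?thesis unfolding eff_scale distrib_right m'_def by simp
    qed
    moreover have "runs (\<lambda>a. m a + (1 - j / N) * eff z a) (\<lambda>s. j / N * z s)"
      using Suc by simp
    ultimately have "runs m' (\<lambda>s. 1 / N * z s + j / N * z s)"
      by (intro runs_append) (simp_all only:)
    moreover have "1 / N * z s + j / N * z s = Suc j / N * z s" for s
      by (simp add: add_divide_distrib distrib_right)
    ultimately show ?case by (simp only: m'_def u_def)
  qed
  from this[of N] N(2) show ?thesis by simp
qed

text \<open>Certifies that its places can be emptied: each action sends its output to places of
  later actions, and the last one has no output.\<close>

fun chain :: "'t list \<Rightarrow> bool" where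
  "chain [] = True"
| "chain (\<tau> # L) = ((\<forall>a. 0 < inc \<tau> a \<longrightarrow> a \<in> mid ` set L) \<and> chain L)"

text \<open>As the final configuration is zero, every place that ever holds mass is emptied by a
  later action. Going backwards through the run, an action is kept only if its place does not occur
  among those already kept. This retains all places and makes them distinct, which bounds the length
  of the chain.\<close>

lemma chain_of_runs:
  assumes "runs m y" "\<And>a. m a + eff y a = 0"
  shows "\<exists>L. chain L \<and> set L \<subseteq> {\<tau>\<in>Act. 0 < y \<tau>} \<and> distinct (map mid L) \<and>
    {a. 0 < m a} \<subseteq> mid ` set L \<and> mid ` {\<tau>\<in>Act. 0 < y \<tau>} \<subseteq> mid ` set L"
  using assms
proof (induction rule: runs.induct)
  case (runs_none m)
  then show ?case by (intro exI[of _ "[]"]) auto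
next
  case (runs_step \<tau> t m y)
  let ?m = "\<lambda>a. m a + t * inc \<tau> a" and ?y = "\<lambda>s. y s + (if s = \<tau> then t else 0)"
  have "?m a + eff y a = 0" for a
    using runs_step.prems[of a] runs_step.hyps(1) by (simp add: eff_add eff_single algebra_simps)
  then obtain L where L: "chain L" "set L \<subseteq> {\<tau>\<in>Act. 0 < y \<tau>}" "distinct (map mid L)"
    "{a. 0 < ?m a} \<subseteq> mid ` set L" "mid ` {\<tau>\<in>Act. 0 < y \<tau>} \<subseteq> mid ` set L"
    using runs_step.IH by auto
  show ?case
  proof (cases "t = 0")
    case True
    then show ?thesis using L by (intro exI[of _ L]) auto
  next
    case False
    then have t: "0 < t" using runs_step.hyps by simp
    have y: "0 \<le> y s" for s using runs_step.hyps(5) by (rule runs_count_nonneg)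
    have sub: "{a. 0 < m a} \<subseteq> insert (mid \<tau>) (mid ` set L)"
    proof safe
      fix a assume "0 < m a" "a \<notin> mid ` set L"
      then show "a = mid \<tau>"
        using L(4) inc_nonneg[OF runs_step.hyps(1), of a] t
        by (force intro: add_pos_nonneg mult_nonneg_nonneg)
    qed
    have ends: "a \<in> mid ` set L" if "0 < inc \<tau> a" for a
      using L(4) that t runs_step.hyps(3) by (auto intro!: subsetD[OF L(4)] add_nonneg_pos)
    have supp: "{s\<in>Act. 0 < ?y s} \<subseteq> insert \<tau> {s\<in>Act. 0 < y s}" by auto
    have \<tau>: "\<tau> \<in> {s\<in>Act. 0 < ?y s}" using runs_step.hyps(1) t y[of \<tau>] by simp
    have mono: "{s\<in>Act. 0 < y s} \<subseteq> {s\<in>Act. 0 < ?y s}" using t by auto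
    show ?thesis
    proof (cases "mid \<tau> \<in> mid ` set L")
      case True
      then show ?thesis using L sub supp mono by (intro exI[of _ L]) blast
    next
      case False
      then show ?thesis using L sub supp mono ends \<tau>
        by (intro exI[of _ "\<tau> # L"]) (simp, blast)
    qed
  qed
qed


text \<open>To empty the place of the first action, fire it once and then run the witnesses for its
  outputs, scaled and superposed. Whatever else these runs consume is put into the initial
  configuration \<open>c\<close>.\<close>

lemma chain_reverse:
  assumes "chain L" "set L \<subseteq> T" "T \<subseteq> Act" "b \<in> mid ` set L"
    and fin: "\<And>\<tau>. \<tau> \<in> Act \<Longrightarrow> finite {a. inc \<tau> a \<noteq> 0}"
  shows "\<exists>c g. 0 < c b \<and> runs c g \<and> (\<forall>s. 0 < g s \<longrightarrow> s \<in> T) \<and> (\<forall>a. c a + eff g a = 0)"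
  using assms(1,2,4)
proof (induction L arbitrary: b)
  case (Cons \<tau> L)
  show ?case
  proof (cases "b \<in> mid ` set L")
    case True
    then show ?thesis using Cons by auto
  next
    case False
    then have b: "b = mid \<tau>" and \<tau>: "\<tau> \<in> Act" "\<tau> \<in> T" using Cons.prems assms(3) by auto
    define E where "E = {a. 0 < inc \<tau> a}"
    have finE: "finite E" by (rule finite_subset[OF _ fin[OF \<tau>(1)]]) (auto simp: E_def)
    have "\<forall>a\<in>E. \<exists>c g. 0 < c a \<and> runs c g \<and> (\<forall>s. 0 < g s \<longrightarrow> s \<in> T) \<and> (\<forall>a. c a + eff g a = 0)"
      using Cons by (auto simp: E_def)
    then obtain c g where cg: "\<And>a. a \<in> E \<Longrightarrow> 0 < c a a" "\<And>a. a \<in> E \<Longrightarrow> runs (c a) (g a)"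
      "\<And>a s. a \<in> E \<Longrightarrow> 0 < g a s \<Longrightarrow> s \<in> T" "\<And>a a'. a \<in> E \<Longrightarrow> c a a' + eff (g a) a' = 0"
      by metis
    \<comment> \<open>Scaled by \<open>k a\<close>, the witness for \<open>a\<close> starts with
      exactly the mass \<open>inc \<tau> a\<close> that \<tau> delivers there.\<close>
    define k where "k a = inc \<tau> a / c a a" for a
    have k: "0 < k a" if "a \<in> E" for a using that cg(1)[OF that] by (simp add: k_def E_def)
    define c' where "c' = (\<lambda>a'. (\<Sum>a\<in>E. k a * c a a'))"
    define g' where "g' = (\<lambda>s. (\<Sum>a\<in>E. k a * g a s))"
    have r: "runs c' g'" unfolding c'_def g'_def
      by (intro runs_sum finE runs_scale cg) (use k in \<open>auto simp: less_imp_le\<close>)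
    have eff': "c' a' + eff g' a' = 0" for a'
      unfolding c'_def g'_def eff_sum eff_scale sum.distrib[symmetric] distrib_left[symmetric]
      by (intro sum.neutral) (simp add: cg)
    have c'E: "inc \<tau> a \<le> c' a" if "a \<in> E" for a
    proof -
      have "k a * c a a \<le> c' a" unfolding c'_def
        by (rule member_le_sum[OF that _ finE])
           (auto intro!: mult_nonneg_nonneg[OF less_imp_le[OF k] runs_nonneg[OF cg(2)]])
      moreover have "k a * c a a = inc \<tau> a" using cg(1)[OF that] by (simp add: k_def)
      ultimately show ?thesis by simp
    qed
    have c'0: "0 \<le> c' a" for a using r by (rule runs_nonneg)
    have c0: "0 \<le> c' a - inc \<tau> a" for a
      using c'E[of a] c'0[of a] by (cases "a \<in> E") (auto simp: E_def)
    have "runs (\<lambda>a. c' a - inc \<tau> a) (\<lambda>s. g' s + (if s = \<tau> then 1 else 0))"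
      by (rule runs_step) (use \<tau> c0 c'0 r in simp_all)
    moreover have "0 < c' b - inc \<tau> b"
      using inc_mid[OF \<tau>(1)] c'0[of b] by (simp add: b)
    moreover have "s \<in> T" if "0 < g' s + (if s = \<tau> then 1 else 0)" for s
    proof (cases "s = \<tau>")
      case False
      then have "0 < g' s" using that by simp
      have "\<exists>a\<in>E. 0 < k a * g a s"
      proof (rule ccontr)
        assume "\<not> ?thesis"
        then have "g' s \<le> 0" unfolding g'_def by (intro sum_nonpos) (auto simp: not_less)
        with \<open>0 < g' s\<close> show False by simp
      qed
      then obtain a where "a \<in> E" "0 < k a * g a s" by blast
      then show ?thesis using cg(3)[of a s] k[of a] by (simp add: zero_less_mult_iff)
    qed (use \<tau> in simp)
    moreover have "c' a - inc \<tau> a + eff (\<lambda>s. g' s + (if s = \<tau> then 1 else 0)) a = 0" for a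
      using eff'[of a] \<tau> by (simp add: eff_add eff_single)
    ultimately show ?thesis
      by (intro exI[of _ "\<lambda>a. c' a - inc \<tau> a"] exI[of _ "\<lambda>s. g' s + (if s = \<tau> then 1 else 0)"]) blast
  qed
qed simp

text \<open>The nonzero flow out of the unreachable places would have to balance on these places alone,
  which contradicts the decrease of the potential \<open>g\<close>.\<close>

lemma forward_reachable:
  fixes g :: "'a \<Rightarrow> real"
  assumes x: "\<And>s. 0 \<le> x s" and lam: "\<And>a. 0 \<le> lam a" "\<And>a. lam a + eff x a = 0"
    and "finite V" and gpos: "\<And>a. a \<in> V \<Longrightarrow> 0 < g a"
    and V: "\<And>\<tau> a. \<tau> \<in> Act \<Longrightarrow> inc \<tau> a \<noteq> 0 \<Longrightarrow> a \<in> V"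
    and decr: "\<And>\<tau>. \<tau> \<in> Act \<Longrightarrow> (\<Sum>a\<in>V. inc \<tau> a * g a) < 0"
    and \<tau>0: "\<tau>0 \<in> Act" "0 < x \<tau>0"
  shows "\<exists>f. runs lam f \<and> (\<forall>s. 0 < f s \<longrightarrow> s \<in> Act \<and> 0 < x s) \<and> 0 < lam (mid \<tau>0) + eff f (mid \<tau>0)"
proof (rule ccontr)
  define T where "T = {\<tau>\<in>Act. 0 < x \<tau>}"
  define R where "R = {a. \<exists>f. runs lam f \<and> (\<forall>s. 0 < f s \<longrightarrow> s \<in> T) \<and> 0 < lam a + eff f a}"
  assume "\<not> ?thesis"
  then have \<tau>0R: "mid \<tau>0 \<notin> R" by (auto simp: R_def T_def)
  have lamR: "lam a = 0" if "a \<notin> R" for a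
  proof (rule ccontr)
    assume "lam a \<noteq> 0"
    then have "0 < lam a" using lam(1)[of a] by simp
    then have "a \<in> R" unfolding R_def using runs_none[of lam] lam(1) by (auto intro!: exI[of _ "\<lambda>_. 0"])
    with that show False by simp
  qed
  have step: "b \<in> R" if \<tau>: "\<tau> \<in> T" "mid \<tau> \<in> R" "0 < inc \<tau> b" for \<tau> b
  proof -
    obtain f where f: "runs lam f" "\<forall>s. 0 < f s \<longrightarrow> s \<in> T" "0 < lam (mid \<tau>) + eff f (mid \<tau>)"
      using \<tau>(2) by (auto simp: R_def)
    have A: "\<tau> \<in> Act" using \<tau> by (simp add: T_def)
    \<comment> \<open>This amount empties \<open>mid \<tau>\<close>, which is harmless because every
      place of \<open>R\<close> has a witness run of its own.\<close>
    define t where "t = (lam (mid \<tau>) + eff f (mid \<tau>)) / (- inc \<tau> (mid \<tau>))"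
    have t: "0 < t" using f(3) inc_mid[OF A] by (simp add: t_def divide_pos_neg)
    have "runs (\<lambda>a. lam a + eff f a) (\<lambda>s. if s = \<tau> then t else 0)"
      using A t inc_mid[OF A] runs_final_nonneg[OF f(1)] by (intro runs_single) (auto simp: t_def)
    then have "runs lam (\<lambda>s. f s + (if s = \<tau> then t else 0))"
      by (intro runs_append f(1))
    moreover have "s \<in> T" if "0 < f s + (if s = \<tau> then t else 0)" for s
      using that f(2) \<tau>(1) by (auto split: if_splits)
    moreover have "0 < lam b + eff (\<lambda>s. f s + (if s = \<tau> then t else 0)) b"
      using runs_final_nonneg[OF f(1), of b] t \<tau>(3) A
      by (simp add: eff_add eff_single add.assoc[symmetric] add_nonneg_pos)
    ultimately show ?thesis unfolding R_def
      by (intro CollectI exI[of _ "\<lambda>s. f s + (if s = \<tau> then t else 0)"]) blast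
  qed
  define B where "B = {\<tau>\<in>T. mid \<tau> \<notin> R}"
  have B: "B \<subseteq> T" "T \<subseteq> Act" "B \<noteq> {}" "finite B"
    using \<tau>0R \<tau>0 finite_Act by (auto simp: B_def T_def)
  have zero: "(\<Sum>\<tau>\<in>B. x \<tau> * inc \<tau> a) = 0" if a: "a \<in> V - R" for a
  proof -
    have "x \<tau> * inc \<tau> a = 0" if "\<tau> \<in> Act - B" for \<tau>
    proof (cases "x \<tau> = 0")
      case False
      then have T: "\<tau> \<in> T" using that x[of \<tau>] by (simp add: T_def)
      then have "mid \<tau> \<in> R" using that by (auto simp: B_def)
      then show ?thesis using a step[OF T, of a] inc_nonneg[of \<tau> a] that by force
    qed simp
    then have "eff x a = (\<Sum>\<tau>\<in>B. x \<tau> * inc \<tau> a)"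
      unfolding eff_def using B by (intro sum.mono_neutral_right finite_Act) auto
    then show ?thesis using lam(2)[of a] lamR[of a] a by simp
  qed
  have neg: "(\<Sum>a\<in>V - R. inc \<tau> a * g a) < 0" if "\<tau> \<in> B" for \<tau>
  proof -
    have A: "\<tau> \<in> Act" "mid \<tau> \<notin> R" using that B by (auto simp: B_def)
    have "(\<Sum>a\<in>V - R. inc \<tau> a * g a) + (\<Sum>a\<in>V \<inter> R. inc \<tau> a * g a) = (\<Sum>a\<in>V. inc \<tau> a * g a)"
      using sum.Int_Diff[OF \<open>finite V\<close>, of "\<lambda>a. inc \<tau> a * g a" R] by simp
    moreover have "0 \<le> (\<Sum>a\<in>V \<inter> R. inc \<tau> a * g a)"
      using A gpos by (intro sum_nonneg mult_nonneg_nonneg inc_nonneg) (auto simp: less_imp_le)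
    ultimately show ?thesis using decr[OF A(1)] by linarith
  qed
  have "0 = (\<Sum>a\<in>V - R. (\<Sum>\<tau>\<in>B. x \<tau> * inc \<tau> a) * g a)"
    using zero by (intro sum.neutral[symmetric]) auto
  also have "\<dots> = (\<Sum>\<tau>\<in>B. x \<tau> * (\<Sum>a\<in>V - R. inc \<tau> a * g a))"
    by (simp add: sum_distrib_left sum_distrib_right mult.assoc) (rule sum.swap)
  also have "\<dots> < (\<Sum>\<tau>\<in>B. 0)"
    using B neg by (intro sum_strict_mono) (auto simp: T_def mult_pos_neg)
  finally show False by simp
qed

text \<open>The flow is written as \<epsilon> F + z + \<epsilon> H, where F makes all places of the
  support positive and H empties a configuration D that is positive on them; z then leads from one
  such configuration to another, as \<open>runs_between_positive\<close> demands.\<close>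

theorem runs_of_chain:
  fixes g :: "'a \<Rightarrow> real"
  assumes x: "\<And>s. 0 \<le> x s" "\<And>s. s \<notin> Act \<Longrightarrow> x s = 0"
    and lam: "\<And>a. 0 \<le> lam a" "\<And>a. lam a + eff x a = 0"
    and L: "chain L" "set L \<subseteq> {\<tau>\<in>Act. 0 < x \<tau>}" "mid ` {\<tau>\<in>Act. 0 < x \<tau>} \<subseteq> mid ` set L"
    and "finite V" and gpos: "\<And>a. a \<in> V \<Longrightarrow> 0 < g a"
    and V: "\<And>\<tau> a. \<tau> \<in> Act \<Longrightarrow> inc \<tau> a \<noteq> 0 \<Longrightarrow> a \<in> V"
    and decr: "\<And>\<tau>. \<tau> \<in> Act \<Longrightarrow> (\<Sum>a\<in>V. inc \<tau> a * g a) < 0"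
  shows "runs lam x"
proof (cases "{\<tau>\<in>Act. 0 < x \<tau>} = {}")
  case True
  then have "x = (\<lambda>_. 0)" using x by (force simp: order.order_iff_strict)
  then show ?thesis using runs_none lam(1) by simp
next
  case False
  define T where "T = {\<tau>\<in>Act. 0 < x \<tau>}"
  have finT: "finite T" using finite_Act by (simp add: T_def)
  define A where "A = mid ` T"
  have A: "finite A" "A \<noteq> {}" using finT False by (auto simp: A_def T_def)
  have "\<forall>a\<in>A. \<exists>f. runs lam f \<and> (\<forall>s. 0 < f s \<longrightarrow> s \<in> T) \<and> 0 < lam a + eff f a"
    using forward_reachable[OF x(1) lam \<open>finite V\<close> gpos V decr] by (auto simp: A_def T_def)
  then obtain f where f: "\<And>a. a \<in> A \<Longrightarrow> runs lam (f a)" "\<And>a s. a \<in> A \<Longrightarrow> 0 < f a s \<Longrightarrow> s \<in> T"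
    "\<And>a. a \<in> A \<Longrightarrow> 0 < lam a + eff (f a) a" by metis
  have fin: "finite {a. inc \<tau> a \<noteq> 0}" if "\<tau> \<in> Act" for \<tau>
    by (rule finite_subset[OF _ \<open>finite V\<close>]) (use V that in auto)
  have "\<forall>a\<in>A. \<exists>c h. 0 < c a \<and> runs c h \<and> (\<forall>s. 0 < h s \<longrightarrow> s \<in> T) \<and> (\<forall>b. c b + eff h b = 0)"
    using chain_reverse[OF L(1), of T] L fin by (auto simp: A_def T_def)
  then obtain c h where ch: "\<And>a. a \<in> A \<Longrightarrow> 0 < c a a" "\<And>a. a \<in> A \<Longrightarrow> runs (c a) (h a)"
    "\<And>a s. a \<in> A \<Longrightarrow> 0 < h a s \<Longrightarrow> s \<in> T" "\<And>a b. a \<in> A \<Longrightarrow> c a b + eff (h a) b = 0"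
    by metis
  \<comment> \<open>Averaging lets all forward runs share the single initial configuration
    \<open>lam\<close>. Each place becomes positive by its own run, and the other runs contribute
    nothing negative.\<close>
  define F where "F = (\<lambda>s. (\<Sum>a\<in>A. 1 / card A * f a s))"
  define H where "H = (\<lambda>s. (\<Sum>a\<in>A. h a s))"
  define D where "D = (\<lambda>b. (\<Sum>a\<in>A. c a b))"
  have "runs (\<lambda>b. \<Sum>a\<in>A. 1 / card A * lam b) F"
    unfolding F_def by (intro runs_sum runs_scale f A) auto
  then have rF: "runs lam F" using A by simp
  have rH: "runs D H" unfolding D_def H_def by (intro runs_sum ch A)
  have DH: "D b + eff H b = 0" for b
    by (simp add: D_def H_def eff_sum sum.distrib[symmetric] ch)
  have Dpos: "0 < D a" if "a \<in> A" for a
    unfolding D_def using ch(1)[OF that] runs_nonneg[OF ch(2)]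
    by (intro sum_pos2[OF A(1) that]) auto
  have Fpos: "0 < lam a + eff F a" if "a \<in> A" for a
  proof -
    have "lam a + eff F a = (\<Sum>b\<in>A. 1 / card A * (lam a + eff (f b) a))"
      using A by (simp only: F_def eff_sum eff_scale sum.distrib distrib_left) simp
    also have "\<dots> > 0"
      using f(3)[OF that] runs_final_nonneg[OF f(1)] A
      by (intro sum_pos2[OF A(1) that]) (auto simp: card_gt_0_iff)
    finally show ?thesis .
  qed
  have F0: "0 \<le> F s" and H0: "0 \<le> H s" for s
    by (rule runs_count_nonneg[OF rF], rule runs_count_nonneg[OF rH])
  have FT: "F s = 0" if "s \<notin> T" for s
    unfolding F_def using f(2)[of _ s] runs_count_nonneg[OF f(1), of _ s] that
    by (intro sum.neutral) (force simp: order.order_iff_strict)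
  have HT: "H s = 0" if "s \<notin> T" for s
    unfolding H_def using ch(3)[of _ s] runs_count_nonneg[OF ch(2), of _ s] that
    by (intro sum.neutral) (force simp: order.order_iff_strict)
  \<comment> \<open>Small enough for \<epsilon> (F + H) to stay below x on the support; the summand
    1 keeps the denominator positive.\<close>
  obtain \<epsilon>0 where \<epsilon>0: "0 < \<epsilon>0" "\<forall>s\<in>T. \<epsilon>0 \<le> x s / (F s + H s + 1)"
    using finite_positive_lower_bound[OF finT, of "\<lambda>s. x s / (F s + H s + 1)"] F0 H0
    by (auto simp: T_def add_nonneg_pos)
  define \<epsilon> where "\<epsilon> = min \<epsilon>0 (1 / 2)"
  have \<epsilon>: "0 < \<epsilon>" "\<epsilon> < 1" "\<epsilon> \<le> \<epsilon>0" using \<epsilon>0 by (auto simp: \<epsilon>_def)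
  define z where "z = (\<lambda>s. x s - \<epsilon> * F s - \<epsilon> * H s)"
  have z0: "0 \<le> z s" for s
  proof (cases "s \<in> T")
    case True
    have p: "0 < F s + H s + 1" using F0[of s] H0[of s] by linarith
    have "\<epsilon> * (F s + H s + 1) \<le> \<epsilon>0 * (F s + H s + 1)" using \<epsilon> p by (intro mult_right_mono) auto
    also have "\<dots> \<le> x s" using bspec[OF \<epsilon>0(2) True] pos_le_divide_eq[OF p] by blast
    finally show ?thesis using \<epsilon> by (simp add: z_def algebra_simps)
  qed (use x FT HT in \<open>simp add: z_def\<close>)
  have e: "eff z a = eff x a - \<epsilon> * eff F a - \<epsilon> * eff H a" for a
    unfolding z_def by (simp add: eff_diff eff_scale)
  let ?m = "\<lambda>a. lam a + \<epsilon> * eff F a"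
  have final: "?m a + eff z a = \<epsilon> * D a" for a
  proof -
    have "eff H a = - D a" using DH[of a] by simp
    then show ?thesis using lam(2)[of a] by (simp add: e)
  qed
  have mix: "?m a = (1 - \<epsilon>) * lam a + \<epsilon> * (lam a + eff F a)" for a
    by (simp add: algebra_simps)
  have "runs ?m z"
  proof (rule runs_between_positive[OF z0])
    show "z s = 0" if "s \<notin> Act" for s
      using that x(2) FT HT by (simp add: z_def T_def)
    show "0 \<le> ?m a" for a
      unfolding mix using lam(1)[of a] \<epsilon> runs_final_nonneg[OF rF, of a] by simp
    show "0 \<le> ?m a + eff z a" for a
      unfolding final using \<epsilon> runs_nonneg[OF rH] by simp
    fix \<tau> assume "\<tau> \<in> Act" "0 < z \<tau>"
    moreover have "z \<tau> \<le> x \<tau>" using F0[of \<tau>] H0[of \<tau>] \<epsilon> by (simp add: z_def algebra_simps add_nonneg_nonneg)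
    ultimately have "mid \<tau> \<in> A" by (auto simp: A_def T_def)
    then show "0 < ?m (mid \<tau>) \<and> 0 < ?m (mid \<tau>) + eff z (mid \<tau>)"
      unfolding final unfolding mix using \<epsilon> lam(1) Fpos Dpos by (auto intro!: add_nonneg_pos)
  qed
  moreover have "runs (\<lambda>a. ?m a + eff z a) (\<lambda>s. \<epsilon> * H s)"
    unfolding final using rH \<epsilon> by (intro runs_scale) auto
  ultimately have "runs ?m (\<lambda>s. z s + \<epsilon> * H s)"
    by (rule runs_append)
  moreover have "runs lam (\<lambda>s. \<epsilon> * F s)"
    by (rule runs_mono[OF runs_scale[OF rF]]) (use \<epsilon> lam(1) in \<open>simp_all add: mult_left_le_one_le\<close>)
  ultimately have "runs lam (\<lambda>s. \<epsilon> * F s + (z s + \<epsilon> * H s))"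
    by (intro runs_append[of lam "\<lambda>s. \<epsilon> * F s"]) (simp_all add: eff_scale)
  then show ?thesis by (simp add: z_def)
qed

end

section \<open>Axis-convex families over a grid\<close>

text \<open>Models positions that are connected by a direction of \<Lambda>, with the coordinates in
  \<open>U\<close> projected away; \<open>Lambda_axis\<close> and \<open>axis_Lambda\<close>
  establish the link.\<close>

fun axis :: "real list \<Rightarrow> real list \<Rightarrow> bool" where
  "axis [] [] = True"
| "axis (x # p) (y # q) = (x = y \<and> axis p q \<or> p = q)"
| "axis _ _ = False"

definition mix :: "real \<Rightarrow> real list \<Rightarrow> real list \<Rightarrow> real list" where
  "mix t p q = map (\<lambda>e. t * fst e + (1 - t) * snd e) (zip p q)"

lemma mix_simps [simp]:
  "mix t [] q = []" "mix t (x # p) (y # q) = (t * x + (1 - t) * y) # mix t p q"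
  by (simp_all add: mix_def)

lemma mix_same: "mix t p p = p"
  by (induction p) (auto simp: algebra_simps)

lemma length_mix [simp]: "length p = length q \<Longrightarrow> length (mix t p q) = length q"
  by (simp add: mix_def)

lemma axis_refl [simp]: "axis p p"
  by (induction p) auto

lemma axis_length: "axis p q \<Longrightarrow> length p = length q"
  by (induction p q rule: axis.induct) auto

lemma axis_sym: "axis p q \<Longrightarrow> axis q p"
  by (induction p q rule: axis.induct) auto

lemma mix_one: "length p = length q \<Longrightarrow> mix 1 p q = p"
  and mix_zero: "length p = length q \<Longrightarrow> mix 0 p q = q"
  by (induction p q rule: list_induct2) auto

lemma mix_swap: "length p = length q \<Longrightarrow> mix t p q = mix (1 - t) q p"
  by (induction p q rule: list_induct2) auto

lemma axis_mix: "axis p q \<Longrightarrow> axis p (mix t p q)" "axis p q \<Longrightarrow> axis (mix t p q) q"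
  by (induction p q rule: axis.induct) (auto simp: mix_same algebra_simps)

lemma sum_list_mix: "length p = length q \<Longrightarrow>
    sum_list (mix t p q) = t * sum_list p + (1 - t) * sum_list q"
  by (induction p q rule: list_induct2) (auto simp: algebra_simps)

text \<open>On an axis line the sum of the coordinates is an affine parameter. It orders the line
  and measures ratios without naming the coordinate that varies.\<close>

lemma axis_sum_eq: "axis p q \<Longrightarrow> sum_list p = sum_list q \<Longrightarrow> p = q"
  by (induction p q rule: axis.induct) auto

lemma interpolation_weights:
  fixes l h v :: real
  assumes "l \<noteq> h"
  shows "(h - v) / (h - l) * l + (1 - (h - v) / (h - l)) * h = v"
proof -
  define t where "t = (h - v) / (h - l)"
  have "t * (h - l) = h - v" using assms by (simp add: t_def)
  then have "t * l + (1 - t) * h = v" by (simp add: algebra_simps)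
  then show ?thesis by (simp add: t_def)
qed

text \<open>If \<open>q\<close> left the line through \<open>p\<close> and \<open>r\<close>, it
  would differ from one of them in two coordinates.\<close>

lemma axis_between:
  "axis p r \<Longrightarrow> axis p q \<Longrightarrow> axis q r \<Longrightarrow> sum_list p \<noteq> sum_list r \<Longrightarrow> \<exists>t. q = mix t p r"
proof (induction p r arbitrary: q rule: axis.induct)
  case (2 x p y r)
  obtain z s where q: "q = z # s" using 2(3) by (cases q) auto
  show ?case
  proof (cases "x = y")
    case True
    with 2(5) have "p \<noteq> r" by auto
    then have z: "z = x" "axis p s" "axis s r" "axis p r" using 2(2,3,4) True q by auto
    then obtain t where "s = mix t p r" using 2(1)[of s] 2(5) True by auto
    then show ?thesis using True z q by (intro exI[of _ t]) (simp add: algebra_simps)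
  next
    case False
    then have pr: "p = r" using 2(2) by simp
    show ?thesis
    proof (cases "z = x")
      case True
      then have "s = r" using 2(4) q False by auto
      then show ?thesis using True pr q by (intro exI[of _ 1]) (simp add: mix_same)
    next
      case False
      then have "s = p" using 2(3) q by auto
      then show ?thesis using pr q interpolation_weights[OF \<open>x \<noteq> y\<close>, of z]
        by (intro exI[of _ "(y - z) / (y - x)"]) (simp add: mix_same)
    qed
  qed
qed auto

text \<open>Barycentric weight of the endpoint \<open>g\<close> for \<open>w\<close> in the interval
  from \<open>l\<close> to \<open>h\<close>. A degenerate interval carries its whole weight in its
  only point.\<close>

definition hatp :: "real \<Rightarrow> real \<Rightarrow> real \<Rightarrow> real \<Rightarrow> real" where
  "hatp l h w g = (if l = h then (if g = l then 1 else 0)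
     else if g = l then (h - w) / (h - l) else if g = h then (w - l) / (h - l) else 0)"

lemma hatp_nonneg: "l \<le> w \<Longrightarrow> w \<le> h \<Longrightarrow> 0 \<le> hatp l h w g"
  by (auto simp: hatp_def)

text \<open>The multi-affine interpolation weights on the corners of a box. They are polynomial in
  \<open>w\<close>, and so is the vector to be tested for membership in a cone.\<close>

definition lam :: "(real \<times> real) list \<Rightarrow> real list \<Rightarrow> real list \<Rightarrow> real" where
  "lam B w a = foldr (\<lambda>e r. hatp (fst (fst e)) (snd (fst e)) (fst (snd e)) (snd (snd e)) * r)
     (zip B (zip w a)) 1"

lemma lam_simps [simp]:
  "lam [] ws a = 1" "lam (b # B) (w # ws) (g # a) = hatp (fst b) (snd b) w g * lam B ws a"
  by (simp_all add: lam_def)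

definition in_box :: "(real \<times> real) list \<Rightarrow> real list \<Rightarrow> bool" where
  "in_box B w = list_all (\<lambda>e. fst (fst e) \<le> snd e \<and> snd e \<le> snd (fst e)) (zip B w)"

lemma in_box_simps [simp]:
  "in_box [] ws" "in_box (b # B) (w # ws) \<longleftrightarrow> fst b \<le> w \<and> w \<le> snd b \<and> in_box B ws"
  by (simp_all add: in_box_def)

lemma lam_nonneg: "length B = length w \<Longrightarrow> length w = length a \<Longrightarrow> in_box B w \<Longrightarrow> 0 \<le> lam B w a"
  by (induction B w a rule: list_induct3) (auto intro!: mult_nonneg_nonneg hatp_nonneg)

text \<open>\<open>K p\<close> plays the role of the fibre over the position \<open>p\<close>; the
  case \<open>p = q\<close> says that fibres are convex.\<close>

definition axis_convex :: "nat \<Rightarrow> (real list \<Rightarrow> 'v::real_vector set) \<Rightarrow> bool" where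
  "axis_convex k K \<longleftrightarrow> (\<forall>p q u v t. length p = k \<longrightarrow> axis p q \<longrightarrow> u \<in> K p \<longrightarrow> v \<in> K q \<longrightarrow>
     0 \<le> t \<longrightarrow> t \<le> 1 \<longrightarrow> t *\<^sub>R u + (1 - t) *\<^sub>R v \<in> K (mix t p q))"

lemma axis_convexD: "axis_convex k K \<Longrightarrow> length p = k \<Longrightarrow> axis p q \<Longrightarrow> u \<in> K p \<Longrightarrow> v \<in> K q \<Longrightarrow>
     0 \<le> t \<Longrightarrow> t \<le> 1 \<Longrightarrow> t *\<^sub>R u + (1 - t) *\<^sub>R v \<in> K (mix t p q)"
  by (simp add: axis_convex_def)

lemma axis_convex_Cons: "axis_convex (Suc k) K \<Longrightarrow> axis_convex k (\<lambda>p. K (g # p))"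
  unfolding axis_convex_def
proof (intro allI impI)
  fix p q u v t
  assume *: "\<forall>p q u v t. length p = Suc k \<longrightarrow> axis p q \<longrightarrow> u \<in> K p \<longrightarrow> v \<in> K q \<longrightarrow>
     0 \<le> t \<longrightarrow> t \<le> 1 \<longrightarrow> t *\<^sub>R u + (1 - t) *\<^sub>R v \<in> K (mix t p q)"
    and "length p = k" "axis p q" "u \<in> K (g # p)" "v \<in> K (g # q)" "0 \<le> t" "t \<le> (1::real)"
  then have "t *\<^sub>R u + (1 - t) *\<^sub>R v \<in> K (mix t (g # p) (g # q))" by (intro *[rule_format]) auto
  then show "t *\<^sub>R u + (1 - t) *\<^sub>R v \<in> K (g # mix t p q)" by (simp add: algebra_simps)
qed

lemma length_product_lists: "a \<in> set (product_lists Xs) \<Longrightarrow> length a = length Xs"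
  by (rule in_set_product_lists_length)

lemma set_product_lists_Cons:
  "set (product_lists (X # Xs)) = (\<lambda>(g, a). g # a) ` (set X \<times> set (product_lists Xs))"
  by auto

lemma sum_product_lists_Cons:
  "(\<Sum>a\<in>set (product_lists (X # Xs)). f a) = (\<Sum>g\<in>set X. \<Sum>a\<in>set (product_lists Xs). f (g # a))"
  unfolding set_product_lists_Cons
  by (subst sum.reindex) (auto simp: inj_on_def sum.cartesian_product case_prod_beta)

lemma sum_hatp:
  fixes f :: "real \<Rightarrow> 'v::real_vector"
  assumes "l \<in> set X" "h \<in> set X"
  shows "(\<Sum>g\<in>set X. hatp l h w g *\<^sub>R f g) =
    (if l = h then f l else ((h - w) / (h - l)) *\<^sub>R f l + ((w - l) / (h - l)) *\<^sub>R f h)"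
proof (cases "l = h")
  case True
  then have "(\<Sum>g\<in>set X. hatp l h w g *\<^sub>R f g) = (\<Sum>g\<in>set X. if g = l then f g else 0)"
    by (intro sum.cong) (auto simp: hatp_def)
  then show ?thesis using True assms by simp
next
  case False
  have "(\<Sum>g\<in>set X. hatp l h w g *\<^sub>R f g) = (\<Sum>g\<in>{l, h}. hatp l h w g *\<^sub>R f g)"
    using assms by (intro sum.mono_neutral_right) (auto simp: hatp_def)
  then show ?thesis using False by (simp add: hatp_def)
qed

text \<open>Interpolating in the remaining coordinates first yields one value on each slice, and the
  first axis then joins two slices. Corners of weight zero must be avoided throughout, as nothing is
  known about \<open>Y\<close> there.\<close>

lemma interpolate_box:
  assumes "axis_convex (length Xs) K" "length w = length Xs"
    "list_all2 (\<lambda>b X. fst b \<in> set X \<and> snd b \<in> set X) B Xs" "in_box B w"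
    "\<And>a. a \<in> set (product_lists Xs) \<Longrightarrow> 0 < lam B w a \<Longrightarrow> Y a \<in> K a"
  shows "(\<Sum>a\<in>set (product_lists Xs). lam B w a *\<^sub>R Y a) \<in> K w"
  using assms
proof (induction Xs arbitrary: K w B Y)
  case Nil
  then show ?case by simp
next
  case (Cons X Xs)
  obtain l h B' where B: "B = (l, h) # B'" using Cons.prems(3) by (auto simp: list_all2_Cons2)
  obtain v ws where w: "w = v # ws" using Cons.prems(2) by (cases w) auto
  have lh: "l \<in> set X" "h \<in> set X" "l \<le> v" "v \<le> h" using Cons.prems(3,4) by (auto simp: B w)
  define S where "S g = (\<Sum>a\<in>set (product_lists Xs). lam B' ws a *\<^sub>R Y (g # a))" for g
  have S: "S g \<in> K (g # ws)" if g: "g \<in> set X" "0 < hatp l h v g" for g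
    unfolding S_def
  proof (rule Cons.IH)
    show "axis_convex (length Xs) (\<lambda>a. K (g # a))"
      using Cons.prems(1) by (intro axis_convex_Cons) simp
    show "Y (g # a) \<in> K (g # a)" if "a \<in> set (product_lists Xs)" "0 < lam B' ws a" for a
      using Cons.prems(5)[of "g # a"] that g by (auto simp: B w)
  qed (use Cons.prems in \<open>auto simp: B w\<close>)
  have "(\<Sum>a\<in>set (product_lists (X # Xs)). lam B w a *\<^sub>R Y a) = (\<Sum>g\<in>set X. hatp l h v g *\<^sub>R S g)"
    unfolding sum_product_lists_Cons S_def by (simp add: B w scaleR_sum_right)
  also have "\<dots> = (if l = h then S l else ((h - v) / (h - l)) *\<^sub>R S l + ((v - l) / (h - l)) *\<^sub>R S h)"
    using lh by (intro sum_hatp)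
  also have "\<dots> \<in> K w"
  \<comment> \<open>At an endpoint of the interval one slice carries all the weight, and on the
    other slice no value is available.\<close>
  proof (cases "l = v \<or> h = v")
    case True
    then have "S v \<in> K (v # ws)" using lh by (intro S) (auto simp: hatp_def)
    then show ?thesis using True lh by (auto simp: w)
  next
    case False
    then have lt: "l < v" "v < h" using lh by auto
    define t where "t = (h - v) / (h - l)"
    have t: "0 \<le> t" "t \<le> 1" "1 - t = (v - l) / (h - l)"
      using lt by (simp_all add: t_def field_simps)
    have tv: "t * l + (1 - t) * h = v"
      using lt interpolation_weights[of l h v] by (simp add: t_def)
    have "t *\<^sub>R S l + (1 - t) *\<^sub>R S h \<in> K (mix t (l # ws) (h # ws))"
      using lt lh Cons.prems(2) t(1,2)
      by (intro axis_convexD[OF Cons.prems(1)] S) (auto simp: hatp_def w)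
    then show ?thesis using t tv lt by (simp add: w mix_same flip: t_def)
  qed
  finally show ?case .
qed

section \<open>Values collected along a run\<close>

context petri
begin

text \<open>Backward induction along the run: values in the fibres for the mass after a step are
  turned into values for the mass before it. \<open>valid\<close> says that an action is a sound
  inference from the fibres at its outputs to the fibre at its place.\<close>

lemma payoff_of_runs:
  fixes K :: "'a \<Rightarrow> 'v::real_vector set" and pay :: "'t \<Rightarrow> 'v"
  assumes "finite V" and V: "\<And>\<tau> a. \<tau> \<in> Act \<Longrightarrow> inc \<tau> a \<noteq> 0 \<Longrightarrow> a \<in> V"
    and convK: "\<And>a u v s. a \<in> V \<Longrightarrow> u \<in> K a \<Longrightarrow> v \<in> K a \<Longrightarrow> 0 \<le> s \<Longrightarrow> s \<le> 1 \<Longrightarrow> s *\<^sub>R u + (1 - s) *\<^sub>R v \<in> K a"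
    and valid: "\<And>\<tau> Y. \<tau> \<in> Act \<Longrightarrow> (\<And>a. 0 < inc \<tau> a \<Longrightarrow> Y a \<in> K a) \<Longrightarrow>
      (1 / - inc \<tau> (mid \<tau>)) *\<^sub>R ((\<Sum>a\<in>V - {mid \<tau>}. inc \<tau> a *\<^sub>R Y a) + pay \<tau>) \<in> K (mid \<tau>)"
    and "runs m y" "\<And>a. a \<in> V \<Longrightarrow> m a + eff y a = 0"
  shows "\<exists>Y. (\<forall>a\<in>V. 0 < m a \<longrightarrow> Y a \<in> K a) \<and> (\<Sum>\<tau>\<in>Act. y \<tau> *\<^sub>R pay \<tau>) = (\<Sum>a\<in>V. m a *\<^sub>R Y a)"
  using assms(5,6)
proof (induction rule: runs.induct)
  case (runs_none m)
  then show ?case by auto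
next
  case (runs_step \<tau> t m y)
  define m' where "m' a = m a + t * inc \<tau> a" for a
  have "m' a + eff y a = 0" if "a \<in> V" for a
    using runs_step.prems[OF that] runs_step.hyps(1) by (simp add: m'_def eff_add eff_single algebra_simps)
  then obtain Y where Y: "\<And>a. a \<in> V \<Longrightarrow> 0 < m' a \<Longrightarrow> Y a \<in> K a"
    "(\<Sum>\<tau>\<in>Act. y \<tau> *\<^sub>R pay \<tau>) = (\<Sum>a\<in>V. m' a *\<^sub>R Y a)"
    using runs_step.IH unfolding m'_def by blast
  have "(\<Sum>s\<in>Act. (y s + (if s = \<tau> then t else 0)) *\<^sub>R pay s) =
      (\<Sum>s\<in>Act. y s *\<^sub>R pay s) + (\<Sum>s\<in>Act. if s = \<tau> then t *\<^sub>R pay s else 0)"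
    by (auto simp: scaleR_left_distrib sum.distrib[symmetric] intro: sum.cong)
  then have total: "(\<Sum>s\<in>Act. (y s + (if s = \<tau> then t else 0)) *\<^sub>R pay s) =
      (\<Sum>a\<in>V. m' a *\<^sub>R Y a) + t *\<^sub>R pay \<tau>"
    using Y(2) runs_step.hyps(1) finite_Act by simp
  show ?case
  proof (cases "t = 0")
    case True
    then have "m' = m" by (simp add: m'_def fun_eq_iff)
    then show ?thesis using Y total True by auto
  next
    case False
    then have t: "0 < t" using runs_step.hyps by simp
    let ?q = "mid \<tau>"
    define d where "d = - inc \<tau> ?q"
    have d: "0 < d" using inc_mid runs_step.hyps by (simp add: d_def)
    have q: "?q \<in> V" using V[OF runs_step.hyps(1), of ?q] d by (simp add: d_def)
    have m'0: "0 \<le> m' a" for a using runs_nonneg[OF runs_step.hyps(5)] by (simp add: m'_def)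
    have mq: "m ?q = m' ?q + t * d" by (simp add: m'_def d_def)
    have td: "0 < t * d" using t d by simp
    define e where "e = (1 / d) *\<^sub>R ((\<Sum>a\<in>V - {?q}. inc \<tau> a *\<^sub>R Y a) + pay \<tau>)"
    have e: "e \<in> K ?q" unfolding e_def d_def
    proof (rule valid[OF runs_step.hyps(1)])
      fix a assume a: "0 < inc \<tau> a"
      then have "0 < m' a" using runs_step.hyps(3) t by (simp add: m'_def add_nonneg_pos)
      then show "Y a \<in> K a" using Y(1) V[OF runs_step.hyps(1), of a] a by simp
    qed
    \<comment> \<open>The share of the mass at \<open>?q\<close> that the step leaves there; the
      rest has value \<open>e\<close>. If nothing is left, \<open>Y ?q\<close> need not lie in the
      fibre and must not enter the average.\<close>
    define s where "s = m' ?q / m ?q"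
    have mq0: "0 < m ?q" using mq td m'0[of ?q] by simp
    have s: "0 \<le> s" "s \<le> 1" "m ?q * s = m' ?q" "m ?q * (1 - s) = t * d"
      using mq0 m'0[of ?q] mq td by (simp_all add: s_def field_simps)
    define Z where "Z = Y(?q := (if m' ?q = 0 then e else s *\<^sub>R Y ?q + (1 - s) *\<^sub>R e))"
    have Zq: "m ?q *\<^sub>R Z ?q = m' ?q *\<^sub>R Y ?q + (t * d) *\<^sub>R e"
    proof (cases "m' ?q = 0")
      case False
      then show ?thesis using s by (simp add: Z_def scaleR_right_distrib)
    qed (use mq in \<open>simp add: Z_def\<close>)
    have "Z a \<in> K a" if "a \<in> V" "0 < m a" for a
    proof (cases "a = ?q")
      case True
      then show ?thesis using e Y(1)[OF q] m'0[of ?q] s convK[OF q _ e]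
        by (auto simp: Z_def order.order_iff_strict)
    next
      case False
      then have "m a \<le> m' a" using inc_nonneg[OF runs_step.hyps(1) False] t by (simp add: m'_def)
      then show ?thesis using Y(1)[of a] that False by (simp add: Z_def)
    qed
    moreover have "(\<Sum>a\<in>V. m a *\<^sub>R Z a) = (\<Sum>a\<in>V. m' a *\<^sub>R Y a) + t *\<^sub>R pay \<tau>"
    proof -
      have "(\<Sum>a\<in>V. m a *\<^sub>R Z a) = m ?q *\<^sub>R Z ?q + (\<Sum>a\<in>V - {?q}. m a *\<^sub>R Z a)"
        using q \<open>finite V\<close> by (rule sum.remove[rotated])
      also have "(\<Sum>a\<in>V - {?q}. m a *\<^sub>R Z a) = (\<Sum>a\<in>V - {?q}. m' a *\<^sub>R Y a - t *\<^sub>R inc \<tau> a *\<^sub>R Y a)"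
        by (intro sum.cong) (auto simp: Z_def m'_def scaleR_left_distrib)
      also have "\<dots> = (\<Sum>a\<in>V - {?q}. m' a *\<^sub>R Y a) - t *\<^sub>R (\<Sum>a\<in>V - {?q}. inc \<tau> a *\<^sub>R Y a)"
        by (simp add: sum_subtractf scaleR_sum_right)
      also have "m ?q *\<^sub>R Z ?q = m' ?q *\<^sub>R Y ?q + t *\<^sub>R (\<Sum>a\<in>V - {?q}. inc \<tau> a *\<^sub>R Y a) + t *\<^sub>R pay \<tau>"
        unfolding Zq e_def using d by (simp add: scaleR_right_distrib)
      also have "(\<Sum>a\<in>V. m' a *\<^sub>R Y a) = m' ?q *\<^sub>R Y ?q + (\<Sum>a\<in>V - {?q}. m' a *\<^sub>R Y a)"
        using q \<open>finite V\<close> by (rule sum.remove[rotated])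
      ultimately show ?thesis by (simp add: algebra_simps)
    qed
    ultimately show ?thesis using total by (intro exI[of _ Z]) simp
  qed
qed

end

section \<open>Splitting measures on a grid\<close>

definition ind :: "'a \<Rightarrow> 'a \<Rightarrow> real" where
  "ind q a = (if a = q then 1 else 0)"

text \<open>Splitting is studied apart from the net: closure under sums and scaling spreads a
  two-point splitting over measures, and \<open>splits_runs\<close> translates the result into
  firing.\<close>

inductive splits :: "real list list \<Rightarrow> (real list \<Rightarrow> real) \<Rightarrow> (real list \<Rightarrow> real) \<Rightarrow> bool"
  for Xs where
  refl: "\<forall>a. 0 \<le> m a \<Longrightarrow> splits Xs m m"
| atom: "p \<in> set (product_lists Xs) \<Longrightarrow> mix t p r \<in> set (product_lists Xs) \<Longrightarrow> r \<in> set (product_lists Xs) \<Longrightarrow>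
    axis p r \<Longrightarrow> 0 \<le> t \<Longrightarrow> t \<le> 1 \<Longrightarrow> splits Xs (ind (mix t p r)) (\<lambda>a. t * ind p a + (1 - t) * ind r a)"
| trans: "splits Xs m n \<Longrightarrow> splits Xs n l \<Longrightarrow> splits Xs m l"
| par: "splits Xs m n \<Longrightarrow> splits Xs m' n' \<Longrightarrow> splits Xs (\<lambda>a. m a + m' a) (\<lambda>a. n a + n' a)"
| scale: "splits Xs m n \<Longrightarrow> 0 \<le> c \<Longrightarrow> splits Xs (\<lambda>a. c * m a) (\<lambda>a. c * n a)"

lemma splits_sum:
  "finite I \<Longrightarrow> (\<And>i. i \<in> I \<Longrightarrow> splits Xs (m i) (n i)) \<Longrightarrow>
    splits Xs (\<lambda>a. \<Sum>i\<in>I. m i a) (\<lambda>a. \<Sum>i\<in>I. n i a)"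
  by (induction I rule: finite_induct) (auto intro: splits.refl splits.par)

text \<open>The product of a measure for the first coordinate and one for the others.\<close>

definition tensor :: "(real \<Rightarrow> real) \<Rightarrow> (real list \<Rightarrow> real) \<Rightarrow> real list \<Rightarrow> real" where
  "tensor f m a = (case a of [] \<Rightarrow> 0 | g # b \<Rightarrow> f g * m b)"

lemma tensor_simps [simp]: "tensor f m [] = 0" "tensor f m (g # b) = f g * m b"
  by (simp_all add: tensor_def)

lemma tensor_add_right: "tensor f (\<lambda>a. m a + n a) = (\<lambda>a. tensor f m a + tensor f n a)"
  and tensor_scale_right: "tensor f (\<lambda>a. c * m a) = (\<lambda>a. c * tensor f m a)"
  and tensor_add_left: "tensor (\<lambda>g. f g + h g) m = (\<lambda>a. tensor f m a + tensor h m a)"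
  and tensor_scale_left: "tensor (\<lambda>g. c * f g) m = (\<lambda>a. c * tensor f m a)"
  by (auto simp: fun_eq_iff tensor_def algebra_simps split: list.split)

lemma tensor_nonneg: "(\<And>g. 0 \<le> f g) \<Longrightarrow> (\<And>a. 0 \<le> m a) \<Longrightarrow> 0 \<le> tensor f m a"
  by (auto simp: tensor_def split: list.split)

lemma tensor_ind_right:
  assumes "\<And>g. g \<notin> set X \<Longrightarrow> f g = 0"
  shows "tensor f (ind q) = (\<lambda>a. \<Sum>g\<in>set X. f g * ind (g # q) a)"
proof
  show "tensor f (ind q) a = (\<Sum>g\<in>set X. f g * ind (g # q) a)" for a
  proof (cases a)
    case (Cons h b)
    have "(\<Sum>g\<in>set X. f g * ind (g # q) a) = (\<Sum>g\<in>set X. if g = h then f g * ind q b else 0)"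
      by (intro sum.cong) (auto simp: Cons ind_def)
    then show ?thesis using assms[of h] by (auto simp: Cons)
  qed (simp add: ind_def)
qed

lemma tensor_ind_left:
  assumes "\<And>b. b \<notin> V \<Longrightarrow> m b = 0" "finite V"
  shows "tensor (ind c) m = (\<lambda>a. \<Sum>b\<in>V. m b * ind (c # b) a)"
proof
  show "tensor (ind c) m a = (\<Sum>b\<in>V. m b * ind (c # b) a)" for a
  proof (cases a)
    case (Cons h b)
    have "(\<Sum>b\<in>V. m b * ind (c # b) a) = (\<Sum>b'\<in>V. if b' = b then m b * ind c h else 0)"
      by (intro sum.cong) (auto simp: Cons ind_def)
    then show ?thesis using assms by (auto simp: Cons)
  qed (simp add: ind_def)
qed

lemma splits_tensor:
  assumes "splits Xs m n" and f: "\<And>g. 0 \<le> f g" "\<And>g. g \<notin> set X \<Longrightarrow> f g = 0"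
  shows "splits (X # Xs) (tensor f m) (tensor f n)"
  using assms(1)
proof (induction rule: splits.induct)
  case (atom p t r)
  have "splits (X # Xs) (\<lambda>a. \<Sum>g\<in>set X. f g * ind (g # mix t p r) a)
      (\<lambda>a. \<Sum>g\<in>set X. f g * (t * ind (g # p) a + (1 - t) * ind (g # r) a))"
  proof (intro splits_sum splits.scale f)
    fix g assume g: "g \<in> set X"
    have "mix t (g # p) (g # r) = g # mix t p r" by (simp add: algebra_simps)
    then show "splits (X # Xs) (ind (g # mix t p r)) (\<lambda>a. t * ind (g # p) a + (1 - t) * ind (g # r) a)"
      using splits.atom[of "g # p" "X # Xs" t "g # r"] atom g by auto
  qed simp
  moreover have "tensor f (ind q) = (\<lambda>a. \<Sum>g\<in>set X. f g * ind (g # q) a)" for q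
    by (rule tensor_ind_right) (rule f(2))
  ultimately show ?case
    unfolding tensor_add_right tensor_scale_right
    by (simp add: algebra_simps sum.distrib sum_distrib_left sum_subtractf)
qed (auto simp: tensor_add_right tensor_scale_right intro: splits.intros tensor_nonneg f)

section \<open>Hat measures on a one-dimensional grid\<close>

definition lo :: "real list \<Rightarrow> real \<Rightarrow> real" where "lo X w = Max {g \<in> set X. g \<le> w}"
definition hi :: "real list \<Rightarrow> real \<Rightarrow> real" where "hi X w = Min {g \<in> set X. w \<le> g}"

definition spans :: "real list \<Rightarrow> real \<Rightarrow> bool" where
  "spans X w \<longleftrightarrow> (\<exists>g\<in>set X. g \<le> w) \<and> (\<exists>g\<in>set X. w \<le> g)"

text \<open>The measure on the grid neighbours of \<open>w\<close> whose barycentre is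
  \<open>w\<close> (\<open>sum_hat\<close>); at a grid point it is a point mass
  (\<open>hat_grid\<close>).\<close>

definition hat :: "real list \<Rightarrow> real \<Rightarrow> real \<Rightarrow> real" where
  "hat X w = hatp (lo X w) (hi X w) w"

lemma lo_hi:
  assumes "spans X w"
  shows "lo X w \<in> set X" "hi X w \<in> set X" "lo X w \<le> w" "w \<le> hi X w"
    "g \<in> set X \<Longrightarrow> g \<le> w \<Longrightarrow> g \<le> lo X w" "g \<in> set X \<Longrightarrow> w \<le> g \<Longrightarrow> hi X w \<le> g"
proof -
  have "lo X w \<in> {g \<in> set X. g \<le> w}" "hi X w \<in> {g \<in> set X. w \<le> g}"
    unfolding lo_def hi_def using assms by (intro Max_in Min_in; auto simp: spans_def)+
  then show "lo X w \<in> set X" "hi X w \<in> set X" "lo X w \<le> w" "w \<le> hi X w" by auto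
qed (auto simp: lo_def hi_def)

lemma spans_between: "spans X x \<Longrightarrow> spans X y \<Longrightarrow> x \<le> z \<Longrightarrow> z \<le> y \<Longrightarrow> spans X z"
  unfolding spans_def using order_trans by blast

lemma hat_grid: "c \<in> set X \<Longrightarrow> hat X c = ind c"
proof -
  assume c: "c \<in> set X"
  then have s: "spans X c" by (auto simp: spans_def)
  have "lo X c = c" "hi X c = c" using lo_hi[OF s] c by (auto intro: order.antisym)
  then show ?thesis by (auto simp: hat_def hatp_def ind_def)
qed

lemma hat_nonneg: "spans X w \<Longrightarrow> 0 \<le> hat X w g"
  using lo_hi[of X w] by (simp add: hat_def hatp_nonneg)

lemma hat_outside: "spans X w \<Longrightarrow> g \<notin> set X \<Longrightarrow> hat X w g = 0"
  using lo_hi(1,2)[of X w] by (auto simp: hat_def hatp_def)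

lemma sum_hat:
  assumes "spans X w"
  shows "(\<Sum>g\<in>set X. hat X w g) = 1" "(\<Sum>g\<in>set X. hat X w g * g) = w"
proof -
  note l = lo_hi[OF assms]
  have 1: "(\<Sum>g\<in>set X. hat X w g * f g) = (if lo X w = hi X w then f (lo X w) else
      (hi X w - w) / (hi X w - lo X w) * f (lo X w) + (w - lo X w) / (hi X w - lo X w) * f (hi X w))" for f
    using sum_hatp[OF l(1,2), of w f] by (simp add: hat_def)
  have 2: "(w - lo X w) / (hi X w - lo X w) = 1 - (hi X w - w) / (hi X w - lo X w)" if "lo X w \<noteq> hi X w"
    using that by (simp add: field_simps)
  show "(\<Sum>g\<in>set X. hat X w g) = 1"
    using 1[of "\<lambda>_. 1"] 2 by (simp split: if_splits)
  show "(\<Sum>g\<in>set X. hat X w g * g) = w"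
    unfolding 1 using 2 interpolation_weights[of "lo X w" "hi X w" w] l(3,4) by (simp split: if_splits)
qed

text \<open>Inside a cell the neighbours do not change, and at its ends both sides are point masses.
  Hence the hat measure is affine in \<open>w\<close> on each closed cell.\<close>

lemma hat_cell:
  assumes z: "spans X z" and w: "lo X z \<le> w" "w \<le> hi X z"
  shows "hat X w = hatp (lo X z) (hi X z) w"
proof -
  note l = lo_hi[OF z]
  consider "w = lo X z" | "w = hi X z" | "lo X z < w" "w < hi X z" using w by linarith
  then show ?thesis
  proof cases
    case 3
    then have s: "spans X w" using l by (auto simp: spans_def intro: less_imp_le)
    note m = lo_hi[OF s]
    have "lo X w = lo X z"
    proof (rule order.antisym)
      show "lo X z \<le> lo X w" using 3 l by (intro m(5)) auto
      show "lo X w \<le> lo X z"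
      proof (rule l(5)[OF m(1)], rule ccontr)
        assume "\<not> lo X w \<le> z"
        then have "hi X z \<le> lo X w" using l(6)[OF m(1)] by simp
        then show False using m(3) 3 by simp
      qed
    qed
    moreover have "hi X w = hi X z"
    proof (rule order.antisym)
      show "hi X w \<le> hi X z" using 3 l by (intro m(6)) auto
      show "hi X z \<le> hi X w"
      proof (rule l(6)[OF m(2)], rule ccontr)
        assume "\<not> z \<le> hi X w"
        then have "hi X w \<le> lo X z" using l(5)[OF m(2)] by simp
        then show False using m(4) 3 by simp
      qed
    qed
    ultimately show ?thesis by (simp add: hat_def)
  qed (use l hat_grid[of w X] in \<open>auto simp: hatp_def ind_def fun_eq_iff\<close>)
qed

lemma hatp_affine:
  "hatp l h (s * u + (1 - s) * v) g = s * hatp l h u g + (1 - s) * hatp l h v g"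
  by (auto simp: hatp_def add_divide_distrib diff_divide_distrib algebra_simps)

text \<open>Write \<open>\<nu>\<close> as a mixture of two-point measures on \<open>a < c < b\<close> with barycentre \<open>c\<close>; the pair
  \<open>(a, b)\<close> has weight \<open>\<nu> a * \<nu> b * (b - a) / D\<close>.\<close>

lemma splits_barycentre:
  assumes M: "\<And>b. 0 \<le> M b" "\<And>b. b \<notin> set (product_lists Xs) \<Longrightarrow> M b = 0"
    and c: "c \<in> set X" and \<nu>: "\<And>g. 0 \<le> \<nu> g" "\<And>g. g \<notin> set X \<Longrightarrow> \<nu> g = 0"
    and sums: "(\<Sum>g\<in>set X. \<nu> g) = 1" "(\<Sum>g\<in>set X. \<nu> g * g) = c"
  shows "splits (X # Xs) (tensor (ind c) M) (tensor \<nu> M)"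
proof -
  let ?V = "set (product_lists Xs)"
  define A where "A = {g \<in> set X. g < c}"
  define B where "B = {g \<in> set X. c < g}"
  have fin: "finite A" "finite B" by (auto simp: A_def B_def)
  have part: "(\<Sum>g\<in>set X. f g) = f c + (\<Sum>a\<in>A. f a) + (\<Sum>b\<in>B. f b)" for f :: "real \<Rightarrow> real"
  proof -
    have "set X = insert c (A \<union> B)" using c by (auto simp: A_def B_def)
    moreover have "sum f (insert c (A \<union> B)) = f c + sum f (A \<union> B)"
      using fin by (intro sum.insert) (auto simp: A_def B_def)
    moreover have "sum f (A \<union> B) = sum f A + sum f B"
      using fin by (intro sum.union_disjoint) (auto simp: A_def B_def)
    ultimately show ?thesis by simp
  qed
  define D where "D = (\<Sum>b\<in>B. \<nu> b * (b - c))"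
  \<comment> \<open>The moments about \<open>c\<close> from the left and from the right balance;
    their common value \<open>D\<close> normalises the weights of the pairs.\<close>
  have "(\<Sum>g\<in>set X. \<nu> g * (g - c)) = 0"
    using sums by (simp add: algebra_simps sum_subtractf flip: sum_distrib_left)
  then have DA: "(\<Sum>a\<in>A. \<nu> a * (c - a)) = D"
    unfolding part D_def by (simp add: algebra_simps sum_subtractf)
  have D0: "0 \<le> D" unfolding D_def by (intro sum_nonneg) (auto simp: \<nu> B_def)
  have atom: "splits (X # Xs) (tensor (ind c) M) (\<lambda>x. t * tensor (ind a) M x + (1 - t) * tensor (ind b) M x)"
    if "a \<in> set X" "b \<in> set X" "0 \<le> t" "t \<le> 1" "t * a + (1 - t) * b = c" for a b t
  proof -
    have "splits (X # Xs) (\<lambda>x. \<Sum>q\<in>?V. M q * ind (c # q) x)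
       (\<lambda>x. \<Sum>q\<in>?V. M q * (t * ind (a # q) x + (1 - t) * ind (b # q) x))"
    proof (intro splits_sum splits.scale M)
      fix q assume q: "q \<in> ?V"
      have "mix t (a # q) (b # q) = c # q" using that by (simp add: mix_same)
      then show "splits (X # Xs) (ind (c # q)) (\<lambda>x. t * ind (a # q) x + (1 - t) * ind (b # q) x)"
        using splits.atom[of "a # q" "X # Xs" t "b # q"] that q c by auto
    qed simp
    moreover have "tensor (ind g) M = (\<lambda>x. \<Sum>q\<in>?V. M q * ind (g # q) x)" for g
      by (rule tensor_ind_left) (simp_all add: M(2))
    ultimately show ?thesis
      by (simp add: algebra_simps sum.distrib sum_distrib_left sum_subtractf)
  qed
  show ?thesis
  proof (cases "D = 0")
    case True
    have "\<nu> b = 0" if "b \<in> B" for b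
      using True that sum_nonneg_eq_0_iff[OF fin(2), of "\<lambda>b. \<nu> b * (b - c)"] \<nu>
      by (auto simp: D_def B_def)
    moreover have "\<nu> a = 0" if "a \<in> A" for a
      using True DA that sum_nonneg_eq_0_iff[OF fin(1), of "\<lambda>a. \<nu> a * (c - a)"] \<nu>
      by (auto simp: A_def)
    moreover from calculation have "\<nu> c = 1" using sums(1) part[of \<nu>] by simp
    ultimately have "\<nu> g = ind c g" for g
      using \<nu>(2)[of g] by (cases "g \<in> set X"; cases g c rule: linorder_cases) (auto simp: A_def B_def ind_def)
    then have "\<nu> = ind c" by auto
    then show ?thesis using M by (auto intro!: splits.refl tensor_nonneg simp: ind_def)
  next
    case False
    then have D: "0 < D" using D0 by simp
    define \<kappa> where "\<kappa> a b = \<nu> a * \<nu> b * (b - a) / D" for a b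
    \<comment> \<open>Lever rule: the share of \<open>a\<close> when mass at \<open>c\<close> is
      split between \<open>a\<close> and \<open>b\<close>.\<close>
    define th where "th a b = (b - c) / (b - a)" for a b :: real
    have th: "0 \<le> th a b" "th a b \<le> 1" "th a b * a + (1 - th a b) * b = c"
      and \<kappa>th: "\<kappa> a b * th a b = \<nu> a * (\<nu> b * (b - c) / D)" "\<kappa> a b * (1 - th a b) = \<nu> b * (\<nu> a * (c - a) / D)"
      and \<kappa>0: "0 \<le> \<kappa> a b"
      if "a \<in> A" "b \<in> B" for a b
    proof -
      have ab: "a < c" "c < b" using that by (auto simp: A_def B_def)
      show "0 \<le> th a b" "th a b \<le> 1" using ab by (auto simp: th_def)
      show "th a b * a + (1 - th a b) * b = c" using ab interpolation_weights[of a b c] by (simp add: th_def)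
      have "1 - th a b = (c - a) / (b - a)" using ab by (simp add: th_def field_simps)
      then show "\<kappa> a b * th a b = \<nu> a * (\<nu> b * (b - c) / D)" "\<kappa> a b * (1 - th a b) = \<nu> b * (\<nu> a * (c - a) / D)"
        using ab by (simp_all add: th_def \<kappa>_def)
      show "0 \<le> \<kappa> a b" using ab D \<nu> by (auto simp: \<kappa>_def intro!: divide_nonneg_pos mult_nonneg_nonneg)
    qed
    let ?T = "\<lambda>g. tensor (ind g) M"
    have sumB: "(\<Sum>b\<in>B. \<nu> b * (b - c) / D) = 1" and sumA: "(\<Sum>a\<in>A. \<nu> a * (c - a) / D) = 1"
      using D DA by (simp_all add: D_def flip: sum_divide_distrib)
    have "splits (X # Xs) (\<lambda>x. \<nu> c * ?T c x + (\<Sum>(a, b)\<in>A \<times> B. \<kappa> a b * ?T c x))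
       (\<lambda>x. \<nu> c * ?T c x + (\<Sum>(a, b)\<in>A \<times> B. \<kappa> a b * (th a b * ?T a x + (1 - th a b) * ?T b x)))"
    proof (rule splits.par)
      show "splits (X # Xs) (\<lambda>x. \<nu> c * ?T c x) (\<lambda>x. \<nu> c * ?T c x)"
        using \<nu> M by (intro splits.refl) (auto intro!: mult_nonneg_nonneg tensor_nonneg simp: ind_def)
      have "splits (X # Xs) (\<lambda>x. \<Sum>p\<in>A \<times> B. \<kappa> (fst p) (snd p) * ?T c x)
        (\<lambda>x. \<Sum>p\<in>A \<times> B. \<kappa> (fst p) (snd p) * (th (fst p) (snd p) * ?T (fst p) x + (1 - th (fst p) (snd p)) * ?T (snd p) x))"
        using fin th \<kappa>0 by (intro splits_sum splits.scale atom) (auto simp: A_def B_def)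
      then show "splits (X # Xs) (\<lambda>x. \<Sum>(a, b)\<in>A \<times> B. \<kappa> a b * ?T c x)
       (\<lambda>x. \<Sum>(a, b)\<in>A \<times> B. \<kappa> a b * (th a b * ?T a x + (1 - th a b) * ?T b x))"
        by (simp add: case_prod_beta)
    qed
    moreover have "\<nu> c * ?T c x + (\<Sum>(a, b)\<in>A \<times> B. \<kappa> a b * ?T c x) = ?T c x" for x
    proof -
      have "(\<Sum>(a, b)\<in>A \<times> B. \<kappa> a b) = (\<Sum>(a, b)\<in>A \<times> B. \<nu> a * (\<nu> b * (b - c) / D) + \<nu> b * (\<nu> a * (c - a) / D))"
        using \<kappa>th by (intro sum.cong) (auto simp: algebra_simps)
      also have "\<dots> = (\<Sum>a\<in>A. \<nu> a * (\<Sum>b\<in>B. \<nu> b * (b - c) / D)) + (\<Sum>a\<in>A. \<Sum>b\<in>B. \<nu> b * (\<nu> a * (c - a) / D))"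
        by (simp add: sum.cartesian_product[symmetric] sum.distrib sum_distrib_left)
      also have "(\<Sum>a\<in>A. \<Sum>b\<in>B. \<nu> b * (\<nu> a * (c - a) / D)) = (\<Sum>b\<in>B. \<nu> b * (\<Sum>a\<in>A. \<nu> a * (c - a) / D))"
        by (subst sum.swap) (simp add: sum_distrib_left)
      finally have "(\<Sum>(a, b)\<in>A \<times> B. \<kappa> a b) = 1 - \<nu> c"
        using sums(1) part[of \<nu>] by (simp add: sumA sumB)
      then have "(\<Sum>(a, b)\<in>A \<times> B. \<kappa> a b * ?T c x) = (1 - \<nu> c) * ?T c x"
        by (simp add: case_prod_beta flip: sum_distrib_right)
      then show ?thesis by (simp add: algebra_simps)
    qed
    moreover have "\<nu> c * ?T c x + (\<Sum>(a, b)\<in>A \<times> B. \<kappa> a b * (th a b * ?T a x + (1 - th a b) * ?T b x)) = tensor \<nu> M x" for x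
    proof -
      have "(\<Sum>(a, b)\<in>A \<times> B. \<kappa> a b * (th a b * ?T a x + (1 - th a b) * ?T b x)) =
          (\<Sum>(a, b)\<in>A \<times> B. \<nu> a * (\<nu> b * (b - c) / D) * ?T a x + \<nu> b * (\<nu> a * (c - a) / D) * ?T b x)"
        using \<kappa>th by (intro sum.cong) (auto simp: distrib_left mult.assoc[symmetric])
      also have "\<dots> = (\<Sum>a\<in>A. \<nu> a * ?T a x * (\<Sum>b\<in>B. \<nu> b * (b - c) / D)) +
          (\<Sum>a\<in>A. \<Sum>b\<in>B. \<nu> b * ?T b x * (\<nu> a * (c - a) / D))"
        by (simp add: sum.cartesian_product[symmetric] sum.distrib sum_distrib_left mult_ac)
      also have "(\<Sum>a\<in>A. \<Sum>b\<in>B. \<nu> b * ?T b x * (\<nu> a * (c - a) / D)) = (\<Sum>b\<in>B. \<nu> b * ?T b x * (\<Sum>a\<in>A. \<nu> a * (c - a) / D))"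
        by (subst sum.swap) (simp add: sum_distrib_left)
      finally have "\<nu> c * ?T c x + (\<Sum>(a, b)\<in>A \<times> B. \<kappa> a b * (th a b * ?T a x + (1 - th a b) * ?T b x)) =
          (\<Sum>g\<in>set X. \<nu> g * ?T g x)"
        by (simp add: part sumA sumB)
      also have "\<dots> = tensor \<nu> M x"
      proof (cases x)
        case (Cons h b)
        have "(\<Sum>g\<in>set X. \<nu> g * ?T g x) = (\<Sum>g\<in>set X. if g = h then \<nu> g * M b else 0)"
          by (intro sum.cong) (auto simp: Cons ind_def)
        then show ?thesis using \<nu>(2)[of h] by (auto simp: Cons)
      qed simp
      finally show ?thesis .
    qed
    ultimately show ?thesis by simp
  qed
qed

text \<open>Within its grid cell, cut down to the interval from \<open>x\<close> to
  \<open>y\<close>, the hat measure of the combination is the corresponding mixture of the hat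
  measures at the two ends \<open>c\<close> and \<open>d\<close>. Each end is a grid point, where
  \<open>splits_barycentre\<close> applies, or it is \<open>x\<close> or \<open>y\<close>, where
  nothing has to be split.\<close>

lemma splits_hat_le:
  assumes M: "\<And>b. 0 \<le> M b" "\<And>b. b \<notin> set (product_lists Xs) \<Longrightarrow> M b = 0"
    and xy: "spans X x" "spans X y" "x \<le> y" and t: "0 \<le> t" "t \<le> 1"
  shows "splits (X # Xs) (tensor (hat X (t * x + (1 - t) * y)) M)
    (\<lambda>a. t * tensor (hat X x) M a + (1 - t) * tensor (hat X y) M a)"
proof -
  define z where "z = t * x + (1 - t) * y"
  have z: "x \<le> z" "z \<le> y"
  proof -
    have "(1 - t) * x \<le> (1 - t) * y" "t * x \<le> t * y" using xy t by (auto intro: mult_left_mono)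
    then show "x \<le> z" "z \<le> y" by (auto simp: z_def algebra_simps)
  qed
  have sz: "spans X z" using spans_between xy z by blast
  note l = lo_hi[OF sz]
  have hat0: "0 \<le> hat X w g" if "spans X w" for w g using hat_nonneg that by simp
  have grid_or_end: "splits (X # Xs) (tensor (hat X c) M)
      (\<lambda>a. \<gamma> * tensor (hat X x) M a + (1 - \<gamma>) * tensor (hat X y) M a)"
    if c: "c \<in> set X \<or> c = x \<or> c = y" "0 \<le> \<gamma>" "\<gamma> \<le> 1" "c = \<gamma> * x + (1 - \<gamma>) * y" for c \<gamma>
  proof -
    have eq: "(\<lambda>a. \<gamma> * tensor (hat X x) M a + (1 - \<gamma>) * tensor (hat X y) M a) =
        tensor (\<lambda>g. \<gamma> * hat X x g + (1 - \<gamma>) * hat X y g) M"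
      by (simp add: tensor_add_left tensor_scale_left)
    show ?thesis
    proof (cases "c \<in> set X")
      case True
      have "(\<Sum>g\<in>set X. (\<gamma> * hat X x g + (1 - \<gamma>) * hat X y g) * f g) =
          \<gamma> * (\<Sum>g\<in>set X. hat X x g * f g) + (1 - \<gamma>) * (\<Sum>g\<in>set X. hat X y g * f g)" for f
        by (simp add: distrib_right sum.distrib sum_distrib_left mult.assoc)
      from this[of "\<lambda>_. 1"] this[of "\<lambda>g. g"] have "(\<Sum>g\<in>set X. \<gamma> * hat X x g + (1 - \<gamma>) * hat X y g) = 1"
        "(\<Sum>g\<in>set X. (\<gamma> * hat X x g + (1 - \<gamma>) * hat X y g) * g) = c"
        using sum_hat[OF xy(1)] sum_hat[OF xy(2)] c(4) by simp_all
      then show ?thesis unfolding eq hat_grid[OF True]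
        using c True xy by (intro splits_barycentre[OF M]) (auto simp: hat_nonneg hat_outside)
    next
      case False
      then have "c = x \<or> c = y" using c by simp
      moreover have "\<gamma> * (x - y) = c - y" using c(4) by (simp add: algebra_simps)
      ultimately have "x = y \<or> c = x \<and> \<gamma> = 1 \<or> c = y \<and> \<gamma> = 0" by auto
      then have "tensor (hat X c) M = (\<lambda>a. \<gamma> * tensor (hat X x) M a + (1 - \<gamma>) * tensor (hat X y) M a)"
        using c(4) by (auto simp: algebra_simps)
      moreover have "spans X c" using \<open>c = x \<or> c = y\<close> xy by auto
      ultimately show ?thesis
        using M by (metis (no_types, lifting) hat0 splits.refl tensor_nonneg)
    qed
  qed
  have weight: "\<exists>\<gamma>. 0 \<le> \<gamma> \<and> \<gamma> \<le> 1 \<and> c = \<gamma> * u + (1 - \<gamma>) * v" if "u \<le> c" "c \<le> v" for u v c :: real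
  proof (cases "u = v")
    case False
    then show ?thesis using that interpolation_weights[of u v c]
      by (intro exI[of _ "(v - c) / (v - u)"]) (auto simp: divide_le_eq)
  qed (use that in \<open>auto intro: exI[of _ 1]\<close>)
  define c where "c = max x (lo X z)"
  define d where "d = min y (hi X z)"
  have cd: "c \<le> z" "z \<le> d" "x \<le> c" "c \<le> y" "x \<le> d" "d \<le> y" "c \<in> set X \<or> c = x \<or> c = y" "d \<in> set X \<or> d = x \<or> d = y"
    "lo X z \<le> c" "c \<le> hi X z" "lo X z \<le> d" "d \<le> hi X z"
    using l z by (auto simp: c_def d_def max_def min_def)
  obtain s where s: "0 \<le> s" "s \<le> 1" "z = s * c + (1 - s) * d" using weight cd(1,2) by blast
  obtain \<gamma> where \<gamma>: "0 \<le> \<gamma>" "\<gamma> \<le> 1" "c = \<gamma> * x + (1 - \<gamma>) * y" using weight cd(3,4) by blast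
  obtain \<delta> where \<delta>: "0 \<le> \<delta>" "\<delta> \<le> 1" "d = \<delta> * x + (1 - \<delta>) * y" using weight cd(5,6) by blast
  have "hatp (lo X z) (hi X z) z g = s * hatp (lo X z) (hi X z) c g + (1 - s) * hatp (lo X z) (hi X z) d g" for g
    by (metis hatp_affine s(3))
  then have "hat X z = (\<lambda>g. s * hat X c g + (1 - s) * hat X d g)"
    using hat_cell[OF sz cd(9,10)] hat_cell[OF sz cd(11,12)] by (auto simp: hat_def[of X z])
  then have "tensor (hat X z) M = (\<lambda>a. s * tensor (hat X c) M a + (1 - s) * tensor (hat X d) M a)"
    by (simp add: tensor_add_left tensor_scale_left)
  moreover have "splits (X # Xs) (\<lambda>a. s * tensor (hat X c) M a + (1 - s) * tensor (hat X d) M a)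
      (\<lambda>a. s * (\<gamma> * tensor (hat X x) M a + (1 - \<gamma>) * tensor (hat X y) M a) +
        (1 - s) * (\<delta> * tensor (hat X x) M a + (1 - \<delta>) * tensor (hat X y) M a))"
    using s cd \<gamma> \<delta> by (intro splits.par splits.scale grid_or_end) auto
  moreover have "s * (\<gamma> * tensor (hat X x) M a + (1 - \<gamma>) * tensor (hat X y) M a) +
        (1 - s) * (\<delta> * tensor (hat X x) M a + (1 - \<delta>) * tensor (hat X y) M a) =
      t * tensor (hat X x) M a + (1 - t) * tensor (hat X y) M a" for a
  proof (cases "x = y")
    case False
    \<comment> \<open>The total weight of \<open>x\<close> after both splittings; comparing
      barycentres gives \<theta> = t.\<close>
    define \<theta> where "\<theta> = s * \<gamma> + (1 - s) * \<delta>"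
    have "\<theta> * x + (1 - \<theta>) * y = z" unfolding s(3) \<gamma>(3) \<delta>(3) by (simp add: \<theta>_def algebra_simps)
    then have "(\<theta> - t) * (x - y) = 0" unfolding z_def by (simp add: algebra_simps)
    then have "\<theta> = t" using False by simp
    have "s * (\<gamma> * T + (1 - \<gamma>) * W) + (1 - s) * (\<delta> * T + (1 - \<delta>) * W) = \<theta> * T + (1 - \<theta>) * W" for T W
      by (simp add: \<theta>_def algebra_simps)
    then show ?thesis unfolding \<open>\<theta> = t\<close> .
  qed (simp add: algebra_simps)
  ultimately show ?thesis by (simp add: z_def)
qed

lemma splits_hat:
  assumes "\<And>b. 0 \<le> M b" "\<And>b. b \<notin> set (product_lists Xs) \<Longrightarrow> M b = 0"
    "spans X x" "spans X y" "0 \<le> t" "t \<le> 1"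
  shows "splits (X # Xs) (tensor (hat X (t * x + (1 - t) * y)) M)
    (\<lambda>a. t * tensor (hat X x) M a + (1 - t) * tensor (hat X y) M a)"
proof (cases "x \<le> y")
  case True
  then show ?thesis using assms by (intro splits_hat_le) auto
next
  case False
  have "splits (X # Xs) (tensor (hat X ((1 - t) * y + (1 - (1 - t)) * x)) M)
    (\<lambda>a. (1 - t) * tensor (hat X y) M a + (1 - (1 - t)) * tensor (hat X x) M a)"
    using assms False by (intro splits_hat_le) auto
  then show ?thesis by (simp add: add.commute)
qed

text \<open>The measure that stands for a position which may lie off the grid.\<close>

fun hats :: "real list list \<Rightarrow> real list \<Rightarrow> real list \<Rightarrow> real" where
  "hats (X # Xs) (w # ws) = tensor (hat X w) (hats Xs ws)"
| "hats _ _ = ind []"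

lemma hats_nonneg: "list_all2 spans Xs w \<Longrightarrow> 0 \<le> hats Xs w a"
proof (induction arbitrary: a rule: list_all2_induct)
  case (Cons X Xs w ws)
  then show ?case by (auto intro!: tensor_nonneg hat_nonneg)
qed (simp add: ind_def)

lemma hats_outside: "list_all2 spans Xs w \<Longrightarrow> a \<notin> set (product_lists Xs) \<Longrightarrow> hats Xs w a = 0"
proof (induction arbitrary: a rule: list_all2_induct)
  case (Cons X Xs w ws)
  show ?case
  proof (cases a)
    case (Cons g b)
    then have "g \<notin> set X \<or> b \<notin> set (product_lists Xs)" using Cons.prems by auto
    then show ?thesis using Cons.hyps Cons.IH Cons by (auto simp: hat_outside)
  qed simp
qed (simp add: ind_def)

lemma hats_grid: "list_all2 (\<lambda>w X. w \<in> set X) w Xs \<Longrightarrow> hats Xs w = ind w"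
proof (induction rule: list_all2_induct)
  case (Cons w ws X Xs)
  show ?case
  proof
    show "hats (X # Xs) (w # ws) a = ind (w # ws) a" for a
      using Cons by (cases a) (auto simp: hat_grid ind_def)
  qed
qed simp

text \<open>The coordinate that varies is handled by \<open>splits_hat\<close>, and the coordinates
  before it are added by \<open>splits_tensor\<close>. This confines the net to the grid spanned by
  the input.\<close>

theorem splits_hats:
  assumes "axis v w" "list_all2 spans Xs v" "list_all2 spans Xs w" "0 \<le> t" "t \<le> 1"
  shows "splits Xs (hats Xs (mix t v w)) (\<lambda>a. t * hats Xs v a + (1 - t) * hats Xs w a)"
  using assms(1,2,3)
proof (induction v w arbitrary: Xs rule: axis.induct)
  case 1
  then show ?case by (auto intro!: splits.refl simp: ind_def algebra_simps)
next
  case (2 x v y w)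
  obtain X Ys where Xs: "Xs = X # Ys" using 2(3) by (cases Xs) auto
  note h = hats_nonneg hats_outside
  show ?case
  proof (cases "x = y \<and> axis v w")
    case True
    have "splits (X # Ys) (tensor (hat X x) (hats Ys (mix t v w)))
        (tensor (hat X x) (\<lambda>a. t * hats Ys v a + (1 - t) * hats Ys w a))"
      using 2 True by (intro splits_tensor) (auto simp: Xs hat_nonneg hat_outside)
    moreover have "t * x + (1 - t) * x = x" by (simp add: algebra_simps)
    ultimately show ?thesis
      using True by (simp add: Xs tensor_add_right tensor_scale_right)
  next
    case False
    then have "v = w" using 2 by auto
    then show ?thesis
      using 2 assms(4,5) splits_hat[OF h[of Ys v], where X = X and x = x and y = y and t = t] by (simp add: Xs mix_same)
  qed
qed auto

lemma hats_lam:
  assumes "list_all2 spans Xs w" "a \<in> set (product_lists Xs)"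
  shows "hats Xs w a = lam (map (\<lambda>e. (lo (fst e) (snd e), hi (fst e) (snd e))) (zip Xs w)) w a"
  using assms
proof (induction arbitrary: a rule: list_all2_induct)
  case (Cons X Xs w ws)
  then show ?case by (auto simp: hat_def)
qed (simp add: ind_def)

section \<open>The net of a finite set of points\<close>

text \<open>An action is a tuple of a place, weighted target places, the mass that leaves the place, and
  a vector paid out. \<open>stop\<close> actions have no targets and pay out the \<open>U\<close>-part of an input point.\<close>

type_synonym action = "real list \<times> (real list \<times> real) list \<times> real \<times> real list"

abbreviation "amid (\<tau> :: action) \<equiv> fst \<tau>"
abbreviation "aends (\<tau> :: action) \<equiv> fst (snd \<tau>)"
abbreviation "aout (\<tau> :: action) \<equiv> fst (snd (snd \<tau>))"
abbreviation "apay (\<tau> :: action) \<equiv> snd (snd (snd \<tau>))"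

definition ainc :: "action \<Rightarrow> real list \<Rightarrow> real" where
  "ainc \<tau> a = sum_list (map (\<lambda>e. if fst e = a then snd e else 0) (aends \<tau>)) - (if amid \<tau> = a then aout \<tau> else 0)"

text \<open>The Hamming distance, real-valued because the programs compute with reals; it turns
  \<open>axis\<close> into a comparison (\<open>axis_ndiff\<close>).\<close>

definition ndiff :: "real list \<Rightarrow> real list \<Rightarrow> real" where
  "ndiff p q = sum_list (map (\<lambda>e. if fst e = snd e then 0 else 1) (zip p q))"

lemma ndiff_nonneg: "0 \<le> ndiff p q"
  unfolding ndiff_def by (intro sum_list_nonneg) auto

lemma ndiff_zero: "length p = length q \<Longrightarrow> ndiff p q \<le> 0 \<longleftrightarrow> p = q"
proof (induction p q rule: list_induct2)
  case (Cons x p y q)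
  then show ?case using ndiff_nonneg[of p q] by (auto simp: ndiff_def)
qed (simp add: ndiff_def)

lemma axis_ndiff: "length p = length q \<Longrightarrow> axis p q \<longleftrightarrow> ndiff p q \<le> 1"
proof (induction p q rule: list_induct2)
  case (Cons x p y q)
  have "ndiff (x # p) (y # q) = (if x = y then 0 else 1) + ndiff p q"
    by (simp add: ndiff_def)
  then show ?case using Cons ndiff_zero[of p q] axis_refl by auto
qed (simp add: ndiff_def)

text \<open>The lever rule on an axis line, cleared of denominators; lengths are differences of
  coordinate sums. The payout \<open>zs\<close> stands for the zero vector.\<close>

definition split :: "real list \<Rightarrow> real list \<Rightarrow> real list \<Rightarrow> real list \<Rightarrow> action" where
  "split zs p q r = (q, [(p, sum_list r - sum_list q), (r, sum_list q - sum_list p)], sum_list r - sum_list p, zs)"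

definition splittable :: "real list \<Rightarrow> real list \<Rightarrow> real list \<Rightarrow> bool" where
  "splittable p q r \<longleftrightarrow> sum_list p < sum_list q \<and> sum_list q < sum_list r \<and>
     ndiff p q \<le> 1 \<and> ndiff q r \<le> 1 \<and> ndiff p r \<le> 1"

definition acts :: "real list list \<Rightarrow> real list \<Rightarrow> (real list \<times> real list) list \<Rightarrow> action list" where
  "acts grid zs pts = map (\<lambda>p. (fst p, [], 1, snd p)) pts @
     concat (map (\<lambda>p. concat (map (\<lambda>q. map (\<lambda>r. split zs p q r) (filter (\<lambda>r. splittable p q r) grid)) grid)) grid)"

locale net =
  fixes Xs :: "real list list" and pts :: "(real list \<times> real list) list" and zs :: "real list"
    and vec :: "real list \<Rightarrow> 'v::real_vector"
  assumes pts_grid: "p \<in> set pts \<Longrightarrow> fst p \<in> set (product_lists Xs)"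
    and vec_zs: "vec zs = 0"
begin

abbreviation "V \<equiv> set (product_lists Xs)"
abbreviation "Act \<equiv> set (acts (product_lists Xs) zs pts)"

lemma Act_cases:
  assumes "\<tau> \<in> Act"
  obtains (stop) p where "p \<in> set pts" "\<tau> = (fst p, [], 1, snd p)"
  | (split) p q r where "p \<in> V" "q \<in> V" "r \<in> V" "splittable p q r" "\<tau> = split zs p q r"
  using assms by (auto simp: acts_def)

lemma splittable_axis:
  assumes "p \<in> V" "q \<in> V" "r \<in> V"
  shows "splittable p q r \<longleftrightarrow> sum_list p < sum_list q \<and> sum_list q < sum_list r \<and> axis p q \<and> axis q r \<and> axis p r"
  using assms by (auto simp: splittable_def axis_ndiff length_product_lists)

lemma splittable_mix:
  assumes "p \<in> V" "q \<in> V" "r \<in> V" "splittable p q r"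
  shows "q = mix ((sum_list r - sum_list q) / (sum_list r - sum_list p)) p r"
proof -
  have *: "axis p q" "axis q r" "axis p r" "sum_list p < sum_list q" "sum_list q < sum_list r"
    using assms splittable_axis by auto
  then obtain t where t: "q = mix t p r" using axis_between[of p r q] by auto
  then have "sum_list q = t * sum_list p + (1 - t) * sum_list r"
    using axis_length[OF *(3)] by (simp add: sum_list_mix)
  then have "t * (sum_list r - sum_list p) = sum_list r - sum_list q" by (simp add: algebra_simps)
  then have "t = (sum_list r - sum_list q) / (sum_list r - sum_list p)" using * by (simp add: eq_divide_eq)
  with t show ?thesis by (simp only:)
qed

lemma ainc_stop: "ainc (a, [], 1, u) b = - ind a b"
  by (simp add: ainc_def ind_def)

lemma ainc_split: "ainc (split zs p q r) a =
    (sum_list r - sum_list q) * ind p a + (sum_list q - sum_list p) * ind r a - (sum_list r - sum_list p) * ind q a"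
  by (auto simp: ainc_def ind_def split_def)

sublocale petri Act fst ainc
proof
  fix \<tau> a assume \<tau>: "\<tau> \<in> Act"
  then show "ainc \<tau> (amid \<tau>) < 0"
    by (cases rule: Act_cases) (auto simp: ainc_stop ainc_split splittable_def, auto simp: split_def ind_def)
  assume ne: "a \<noteq> amid \<tau>"
  from \<tau> show "0 \<le> ainc \<tau> a"
  proof (cases rule: Act_cases)
    case (stop p)
    then show ?thesis using ne by (auto simp: ainc_stop ind_def)
  next
    case (split p q r)
    then have "a \<noteq> q" using ne by (simp add: split_def)
    then show ?thesis using split by (auto simp: ainc_split splittable_def ind_def)
  qed
qed simp

lemma ainc_V: "\<tau> \<in> Act \<Longrightarrow> ainc \<tau> a \<noteq> 0 \<Longrightarrow> a \<in> V"
  by (erule Act_cases) (auto simp: ainc_stop ainc_split ind_def pts_grid split: if_splits)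

lemma amid_V: "\<tau> \<in> Act \<Longrightarrow> amid \<tau> \<in> V"
  by (erule Act_cases) (auto simp: split_def pts_grid)

lemma ends_eq: "\<tau> \<in> Act \<Longrightarrow> {a. 0 < ainc \<tau> a} = fst ` set (aends \<tau>)"
proof (erule Act_cases)
  fix p q r assume "splittable p q r" and \<tau>: "\<tau> = split zs p q r"
  then have "{a. 0 < ainc \<tau> a} = {p, r}"
    by (auto simp: ainc_split ind_def splittable_def split: if_splits)
  then show ?thesis by (simp add: \<tau> split_def)
qed (auto simp: ainc_stop ind_def)

lemma sum_ind: "q \<in> V \<Longrightarrow> (\<Sum>a\<in>V. ind q a *\<^sub>R f a) = (f q :: 'b::real_vector)"
proof -
  assume "q \<in> V"
  moreover have "(\<Sum>a\<in>V. ind q a *\<^sub>R f a) = (\<Sum>a\<in>V. if a = q then f a else 0)"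
    by (intro sum.cong) (auto simp: ind_def)
  ultimately show ?thesis by simp
qed

lemma sum_ainc_split:
  fixes f :: "real list \<Rightarrow> 'b::real_vector"
  assumes "p \<in> V" "q \<in> V" "r \<in> V"
  shows "(\<Sum>a\<in>V. ainc (split zs p q r) a *\<^sub>R f a) =
    (sum_list r - sum_list q) *\<^sub>R f p + (sum_list q - sum_list p) *\<^sub>R f r - (sum_list r - sum_list p) *\<^sub>R f q"
  unfolding ainc_split
  by (simp add: scaleR_left_distrib scaleR_left_diff_distrib sum.distrib sum_subtractf sum_ind assms
      flip: scaleR_scaleR scaleR_sum_right)

lemma potential_exists:
  "\<exists>g :: real list \<Rightarrow> real. (\<forall>a\<in>V. 0 < g a) \<and> (\<forall>\<tau>\<in>Act. (\<Sum>a\<in>V. ainc \<tau> a * g a) < 0)"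
proof -
  define M where "M = Max (insert 0 ((\<lambda>a. (sum_list a)\<^sup>2) ` V)) + 1"
  define g where "g a = M - (sum_list a)\<^sup>2" for a :: "real list"
  have g: "0 < g a" if "a \<in> V" for a
  proof -
    have "(sum_list a)\<^sup>2 \<le> Max (insert 0 ((\<lambda>a. (sum_list a)\<^sup>2) ` V))"
      using that by (intro Max_ge) auto
    then show ?thesis by (simp add: g_def M_def)
  qed
  have "(\<Sum>a\<in>V. ainc \<tau> a * g a) < 0" if "\<tau> \<in> Act" for \<tau>
    using that
  proof (cases rule: Act_cases)
    case (stop p)
    then show ?thesis using g[OF pts_grid[OF stop(1)]] sum_ind[OF pts_grid[OF stop(1)], of g]
      by (simp add: ainc_stop sum_negf)
  next
    case (split p q r)
    define x y z where "x = sum_list p" and "y = sum_list q" and "z = sum_list r"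
    have "x < y" "y < z" using split by (auto simp: splittable_def x_def y_def z_def)
    then have pos: "0 < (z - y) * (y - x) * (z - x)" by simp
    have "(\<Sum>a\<in>V. ainc \<tau> a * g a) = (z - y) * g p + (y - x) * g r - (z - x) * g q"
      using sum_ainc_split[OF split(1,2,3), of g] by (simp add: split x_def y_def z_def)
    \<comment> \<open>(z - y) x^2 + (y - x) z^2 - (z - x) y^2 equals (z - y) (y - x) (z - x), which
      expresses the strict convexity of the square; the constant \<open>M\<close> cancels.\<close>
    also have "\<dots> = - ((z - y) * (y - x) * (z - x))"
      by (simp add: g_def x_def[symmetric] y_def[symmetric] z_def[symmetric] power2_eq_square algebra_simps)
    finally show ?thesis using pos by simp
  qed
  with g show ?thesis by blast
qed

section \<open>Transport with payoffs\<close>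

definition payoff :: "(action \<Rightarrow> real) \<Rightarrow> 'v" where
  "payoff y = (\<Sum>\<tau>\<in>Act. y \<tau> *\<^sub>R vec (apay \<tau>))"

lemma payoff_zero [simp]: "payoff (\<lambda>_. 0) = 0"
  by (simp add: payoff_def)

lemma payoff_add: "payoff (\<lambda>s. y s + z s) = payoff y + payoff z"
  by (simp add: payoff_def scaleR_left_distrib sum.distrib)

lemma payoff_scale: "payoff (\<lambda>s. c * y s) = c *\<^sub>R payoff y"
  by (simp add: payoff_def scaleR_sum_right)

lemma payoff_single: "\<tau> \<in> Act \<Longrightarrow> payoff (\<lambda>s. if s = \<tau> then t else 0) = t *\<^sub>R vec (apay \<tau>)"
proof -
  assume "\<tau> \<in> Act"
  moreover have "payoff (\<lambda>s. if s = \<tau> then t else 0) = (\<Sum>s\<in>Act. if s = \<tau> then t *\<^sub>R vec (apay s) else 0)"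
    unfolding payoff_def by (intro sum.cong) auto
  ultimately show ?thesis by simp
qed

definition gives :: "(real list \<Rightarrow> real) \<Rightarrow> 'v \<Rightarrow> bool" where
  "gives m u \<longleftrightarrow> (\<exists>y. runs m y \<and> (\<forall>a. m a + eff y a = 0) \<and> payoff y = u)"

lemma gives_mix:
  assumes "gives m u" "gives n v" "0 \<le> t" "t \<le> 1"
  shows "gives (\<lambda>a. t * m a + (1 - t) * n a) (t *\<^sub>R u + (1 - t) *\<^sub>R v)"
proof -
  obtain y z where y: "runs m y" "\<And>a. m a + eff y a = 0" "payoff y = u"
    and z: "runs n z" "\<And>a. n a + eff z a = 0" "payoff z = v"
    using assms(1,2) by (auto simp: gives_def)
  have "runs (\<lambda>a. t * m a + (1 - t) * n a) (\<lambda>s. t * y s + (1 - t) * z s)"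
    using assms y z by (intro runs_par runs_scale) auto
  moreover have "t * m a + (1 - t) * n a + eff (\<lambda>s. t * y s + (1 - t) * z s) a = 0" for a
  proof -
    have "t * (m a + eff y a) + (1 - t) * (n a + eff z a) = 0" by (simp add: y z)
    then show ?thesis unfolding eff_add eff_scale by (simp add: algebra_simps)
  qed
  ultimately show ?thesis
    unfolding gives_def using y z by (intro exI conjI allI) (auto simp: payoff_add payoff_scale)
qed

text \<open>A proper two-point splitting is one firing of a \<open>split\<close> action, in the
  amount that takes mass 1 from \<open>mix t p r\<close>, with \<open>p\<close> and \<open>r\<close>
  ordered by their sums. Degenerate splittings need no firing.\<close>

lemma splits_runs:
  "splits Xs m n \<Longrightarrow> \<exists>y. runs m y \<and> (\<forall>a. n a = m a + eff y a) \<and> payoff y = 0"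
proof (induction rule: splits.induct)
  case (refl m)
  then show ?case by (intro exI[of _ "\<lambda>_. 0"]) (simp add: runs_none)
next
  case (atom p t r)
  have main: "\<exists>y. runs (ind (mix t p r)) y \<and> (\<forall>a. t * ind p a + (1 - t) * ind r a = ind (mix t p r) a + eff y a) \<and> payoff y = 0"
    if *: "p \<in> V" "mix t p r \<in> V" "r \<in> V" "axis p r" "0 < t" "t < 1" "sum_list p < sum_list r" for p r t
  proof -
    define q where "q = mix t p r"
    have len: "length p = length r" using axis_length[OF *(4)] .
    have sq: "sum_list q = t * sum_list p + (1 - t) * sum_list r"
      unfolding q_def by (rule sum_list_mix[OF len])
    define d where "d = sum_list r - sum_list p"
    have d: "0 < d" using * by (simp add: d_def)
    have rq: "sum_list r - sum_list q = t * d" "sum_list q - sum_list p = (1 - t) * d"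
      by (simp_all add: sq d_def algebra_simps)
    have ord: "sum_list p < sum_list q" "sum_list q < sum_list r"
      using rq * d by (smt (verit) mult_pos_pos)+
    then have s: "splittable p q r"
      using * axis_mix[OF *(4), of t] by (auto simp: splittable_axis q_def)
    have \<tau>: "split zs p q r \<in> Act" using s * by (auto simp: acts_def q_def)
    have inc: "ainc (split zs p q r) a = d * (t * ind p a + (1 - t) * ind r a - ind q a)" for a
      by (simp only: ainc_split rq d_def[symmetric]) (simp add: algebra_simps)
    have pr: "p \<noteq> q" "r \<noteq> q" using ord by auto
    have "runs (ind q) (\<lambda>s. if s = split zs p q r then 1 / d else 0)"
      using d pr by (intro runs_single \<tau>) (auto simp: ind_def inc, auto simp: split_def)
    then show ?thesis
      using d \<tau> vec_zs
      by (intro exI[of _ "\<lambda>s. if s = split zs p q r then 1 / d else 0"])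
         (simp add: q_def[symmetric] eff_single inc payoff_single, simp add: split_def)
  qed
  have len: "length p = length r" using axis_length[OF atom(4)] .
  consider "t = 0" | "t = 1" | "p = r" | "0 < t" "t < 1" "sum_list p < sum_list r"
    | "0 < t" "t < 1" "sum_list r < sum_list p"
    by (cases "t = 0"; cases "t = 1"; cases "sum_list p" "sum_list r" rule: linorder_cases)
       (use atom axis_sum_eq[OF atom(4)] that in auto)
  then show ?case
  proof cases
    case 1
    then show ?thesis by (intro exI[of _ "\<lambda>_. 0"]) (auto simp: mix_zero len runs_none ind_def)
  next
    case 2
    then show ?thesis by (intro exI[of _ "\<lambda>_. 0"]) (auto simp: mix_one len runs_none ind_def)
  next
    case 3
    then show ?thesis by (intro exI[of _ "\<lambda>_. 0"]) (auto simp: mix_same runs_none ind_def)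
  next
    case 4
    then show ?thesis using main[of p t r] atom by simp
  next
    case 5
    then show ?thesis using main[of r "1 - t" p] atom axis_sym[OF atom(4)] mix_swap[OF len, of t]
      by (simp add: add.commute)
  qed
next
  case (trans m n l)
  then obtain y z where y: "runs m y" "\<And>a. n a = m a + eff y a" "payoff y = 0"
    and z: "runs n z" "\<And>a. l a = n a + eff z a" "payoff z = 0" by blast
  have "n = (\<lambda>a. m a + eff y a)" using y(2) by auto
  then have "runs m (\<lambda>s. y s + z s)" using y z by (intro runs_append) auto
  then show ?case
    using y z by (intro exI[of _ "\<lambda>s. y s + z s"]) (auto simp: eff_add payoff_add)
next
  case (par m n m' n')
  then obtain y z where y: "runs m y" "\<And>a. n a = m a + eff y a" "payoff y = 0"
    and z: "runs m' z" "\<And>a. n' a = m' a + eff z a" "payoff z = 0" by auto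
  then show ?case
    by (intro exI[of _ "\<lambda>s. y s + z s"]) (auto simp: eff_add payoff_add intro: runs_par)
next
  case (scale m n c)
  then obtain y where y: "runs m y" "\<And>a. n a = m a + eff y a" "payoff y = 0" by auto
  then show ?case using scale(2)
    by (intro exI[of _ "\<lambda>s. c * y s"]) (auto simp: eff_scale payoff_scale distrib_left intro: runs_scale)
qed

lemma gives_splits: "splits Xs m n \<Longrightarrow> gives n u \<Longrightarrow> gives m u"
proof -
  assume "splits Xs m n" "gives n u"
  then obtain y z where y: "runs m y" "\<And>a. n a = m a + eff y a" "payoff y = 0"
    and z: "runs n z" "\<And>a. n a + eff z a = 0" "payoff z = u"
    using splits_runs unfolding gives_def by metis
  have "n = (\<lambda>a. m a + eff y a)" using y(2) by auto
  then have "runs m (\<lambda>s. y s + z s)" using y z by (intro runs_append) auto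
  then show ?thesis unfolding gives_def
    using y z by (intro exI[of _ "\<lambda>s. y s + z s"]) (auto simp: eff_add payoff_add add.assoc)
qed

text \<open>An invariant for the hull: it holds at the input points (\<open>reached_point\<close>)
  and survives convex combinations along axes (\<open>reached_mix\<close>).\<close>

definition reached :: "real list \<Rightarrow> 'v \<Rightarrow> bool" where
  "reached w u \<longleftrightarrow> list_all2 spans Xs w \<and> gives (hats Xs w) u"

lemma reached_point: "p \<in> set pts \<Longrightarrow> reached (fst p) (vec (snd p))"
proof -
  assume p: "p \<in> set pts"
  have g: "list_all2 (\<lambda>w X. w \<in> set X) (fst p) Xs"
    using pts_grid[OF p] by (simp add: product_lists_set)
  let ?\<tau> = "(fst p, [], 1, snd p)"
  have \<tau>: "?\<tau> \<in> Act" using p by (auto simp: acts_def)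
  have "runs (ind (fst p)) (\<lambda>s. if s = ?\<tau> then 1 else 0)"
    by (rule runs_single[OF \<tau>]) (auto simp: ind_def ainc_stop)
  then have "gives (hats Xs (fst p)) (vec (snd p))"
    unfolding gives_def hats_grid[OF g] using \<tau>
    by (intro exI[of _ "\<lambda>s. if s = ?\<tau> then 1 else 0"]) (simp add: eff_single payoff_single ainc_stop)
  moreover have "list_all2 spans Xs (fst p)"
    using g by (auto simp: list_all2_conv_all_nth spans_def)
  ultimately show ?thesis by (simp add: reached_def)
qed

lemma reached_mix:
  assumes "axis v w" "reached v x" "reached w y" "0 \<le> t" "t \<le> 1"
  shows "reached (mix t v w) (t *\<^sub>R x + (1 - t) *\<^sub>R y)"
proof -
  have "spans X (t * a + (1 - t) * b)" if "spans X a" "spans X b" for X a b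
  proof -
    have "min a b \<le> t * a + (1 - t) * b" "t * a + (1 - t) * b \<le> max a b"
      using assms(4,5) convex_bound_le[of a "max a b" b t "1 - t"]
        convex_bound_le[of "- a" "- min a b" "- b" t "1 - t"] by auto
    moreover have "spans X (min a b)" "spans X (max a b)" using that by (auto simp: min_def max_def)
    ultimately show ?thesis using spans_between by blast
  qed
  then have "list_all2 spans Xs (mix t v w)"
    using assms axis_length[OF assms(1)] by (auto simp: reached_def list_all2_conv_all_nth mix_def)
  then show ?thesis
    using assms gives_splits[OF splits_hats] gives_mix by (auto simp: reached_def)
qed

text \<open>Replaces a run by data without order: a box around the position, a flow \<open>z\<close>
  that conserves mass, and a chain inside the support of \<open>z\<close> whose places are all the
  places of the support.\<close>

definition certificate :: "real list \<Rightarrow> 'v \<Rightarrow> (real \<times> real) list \<Rightarrow> action list \<Rightarrow> (action \<Rightarrow> real) \<Rightarrow> bool" where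
  "certificate w u B L z \<longleftrightarrow> list_all2 (\<lambda>b X. fst b \<in> set X \<and> snd b \<in> set X) B Xs \<and> in_box B w \<and>
     chain L \<and> set L \<subseteq> Act \<and> (\<forall>\<tau>. 0 \<le> z \<tau>) \<and> (\<forall>\<tau>. 0 < z \<tau> \<longrightarrow> \<tau> \<in> Act \<and> amid \<tau> \<in> amid ` set L) \<and>
     (\<forall>\<tau>\<in>set L. 0 < z \<tau>) \<and> (\<forall>a\<in>V. lam B w a + eff z a = 0) \<and> payoff z = u"

lemma certificateD:
  assumes "certificate w u B L z"
  shows "list_all2 (\<lambda>b X. fst b \<in> set X \<and> snd b \<in> set X) B Xs" "in_box B w" "chain L" "set L \<subseteq> Act"
    "0 \<le> z \<tau>" "0 < z \<tau> \<Longrightarrow> \<tau> \<in> Act" "0 < z \<tau> \<Longrightarrow> amid \<tau> \<in> amid ` set L"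
    "\<tau> \<in> set L \<Longrightarrow> 0 < z \<tau>" "a \<in> V \<Longrightarrow> lam B w a + eff z a = 0" "payoff z = u"
proof -
  have c: "\<forall>\<tau>. 0 \<le> z \<tau>" "\<forall>\<tau>. 0 < z \<tau> \<longrightarrow> \<tau> \<in> Act \<and> amid \<tau> \<in> amid ` set L"
    "\<forall>\<tau>\<in>set L. 0 < z \<tau>" "\<forall>a\<in>V. lam B w a + eff z a = 0"
    "list_all2 (\<lambda>b X. fst b \<in> set X \<and> snd b \<in> set X) B Xs" "in_box B w" "chain L" "set L \<subseteq> Act"
    "payoff z = u"
    using assms unfolding certificate_def by - (elim conjE, assumption)+
  show "0 \<le> z \<tau>" by (rule spec[OF c(1)])
  show "\<tau> \<in> Act" "amid \<tau> \<in> amid ` set L" if "0 < z \<tau>"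
    by (rule conjunct1[OF mp[OF spec[OF c(2)] that]], rule conjunct2[OF mp[OF spec[OF c(2)] that]])
  show "0 < z \<tau>" if "\<tau> \<in> set L" by (rule bspec[OF c(3) that])
  show "lam B w a + eff z a = 0" if "a \<in> V" by (rule bspec[OF c(4) that])
  show "list_all2 (\<lambda>b X. fst b \<in> set X \<and> snd b \<in> set X) B Xs" "in_box B w" "chain L" "set L \<subseteq> Act"
    "payoff z = u" by (rule c)+
qed

text \<open>The box is formed by the grid neighbours of \<open>w\<close>, the flow counts the
  actions of a run, and \<open>chain_of_runs\<close> extracts the chain.\<close>

lemma certificate_exists:
  assumes "reached w u"
  obtains B L z where "certificate w u B L z" "distinct (map amid L)"
proof -
  have w: "list_all2 spans Xs w" using assms by (simp add: reached_def)
  obtain y where y: "runs (hats Xs w) y" "\<And>a. hats Xs w a + eff y a = 0" "payoff y = u"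
    using assms by (auto simp: reached_def gives_def)
  obtain L where L: "chain L" "set L \<subseteq> {\<tau>\<in>Act. 0 < y \<tau>}" "distinct (map amid L)"
    "amid ` {\<tau>\<in>Act. 0 < y \<tau>} \<subseteq> amid ` set L"
    using chain_of_runs[OF y(1,2)] by blast
  define B where "B = map (\<lambda>e. (lo (fst e) (snd e), hi (fst e) (snd e))) (zip Xs w)"
  have lw: "length w = length Xs" using w by (simp add: list_all2_lengthD)
  have 1: "list_all2 (\<lambda>b X. fst b \<in> set X \<and> snd b \<in> set X) B Xs" "in_box B w"
    using w lo_hi by (auto simp: B_def list_all2_conv_all_nth in_box_def list_all_length)
  have 2: "lam B w a + eff y a = 0" if "a \<in> V" for a
    using hats_lam[OF w that] y(2)[of a] by (simp add: B_def)
  have 3: "\<tau> \<in> Act" if "0 < y \<tau>" for \<tau>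
    using runs_count_supp[OF y(1), of \<tau>] that by (cases "\<tau> \<in> Act") auto
  have 4: "amid \<tau> \<in> amid ` set L" if "0 < y \<tau>" for \<tau>
    using L(4) 3[OF that] that by blast
  have 5: "set L \<subseteq> Act" "\<And>\<tau>. \<tau> \<in> set L \<Longrightarrow> 0 < y \<tau>" using L(2) by auto
  have "certificate w u B L y"
    unfolding certificate_def
    by (intro conjI allI impI ballI 1 L(1) 5(1) runs_count_nonneg[OF y(1)] y(3)) (erule 3 4 5(2) 2)+
  then show thesis using that L(3) by blast
qed

text \<open>The potential and the chain turn the flow into a run, each action is a sound inference
  for an axis-convex family, and interpolation in the box leads from its corners to
  \<open>w\<close>.\<close>

lemma certificate_sound:
  assumes c: "certificate w u B L z" and w: "length w = length Xs"
    and K: "axis_convex (length Xs) K" "\<And>p. p \<in> set pts \<Longrightarrow> vec (snd p) \<in> K (fst p)"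
  shows "u \<in> K w"
proof -
  note D = certificateD[OF c]
  \<comment> \<open>The run needs conservation at all lists. Off the grid no action has an effect
    while \<open>lam\<close> can be nonzero, for instance at lists of another length, so it is cut
    off there.\<close>
  define m where "m a = (if a \<in> V then lam B w a else 0)" for a
  have B: "length B = length w"
    using list_all2_lengthD[OF D(1)] w by simp
  have m0: "0 \<le> m a" for a
    using D(2) B w lam_nonneg[of B w a] by (auto simp: m_def length_product_lists)
  have meff: "m a + eff z a = 0" for a
  proof (cases "a \<in> V")
    case True
    then show ?thesis using D(9) by (simp add: m_def)
  next
    case False
    then have "eff z a = 0" unfolding eff_def using ainc_V by (intro sum.neutral) auto
    then show ?thesis using False by (simp add: m_def)
  qed
  obtain g :: "real list \<Rightarrow> real" where g: "\<And>a. a \<in> V \<Longrightarrow> 0 < g a"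
    "\<And>\<tau>. \<tau> \<in> Act \<Longrightarrow> (\<Sum>a\<in>V. ainc \<tau> a * g a) < 0"
    using potential_exists by blast
  have "runs m z"
  proof (rule runs_of_chain[OF _ _ m0 meff _ _ _ finite_set g(1) ainc_V g(2)])
    show "0 \<le> z s" for s by (rule D(5))
    show "z s = 0" if "s \<notin> Act" for s
      using D(5)[of s] D(6)[of s] that by linarith
    show "chain L" by (rule D(3))
    show "set L \<subseteq> {\<tau>\<in>Act. 0 < z \<tau>}" using D(4,8) by blast
    show "amid ` {\<tau>\<in>Act. 0 < z \<tau>} \<subseteq> amid ` set L" using D(7) by blast
  qed
  moreover have "\<exists>Y. (\<forall>a\<in>V. 0 < m a \<longrightarrow> Y a \<in> K a) \<and>
      (\<Sum>\<tau>\<in>Act. z \<tau> *\<^sub>R vec (apay \<tau>)) = (\<Sum>a\<in>V. m a *\<^sub>R Y a)"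
  proof (rule payoff_of_runs[OF finite_set ainc_V _ _ \<open>runs m z\<close> meff])
    show "s *\<^sub>R x + (1 - s) *\<^sub>R y \<in> K a" if "a \<in> V" "x \<in> K a" "y \<in> K a" "0 \<le> s" "s \<le> 1" for a x y s
      using axis_convexD[OF K(1), of a a x y s] that by (simp add: mix_same length_product_lists)
    fix \<tau> and Y :: "real list \<Rightarrow> 'v"
    assume \<tau>: "\<tau> \<in> Act" and Y: "\<And>a. 0 < ainc \<tau> a \<Longrightarrow> Y a \<in> K a"
    have rem: "(\<Sum>a\<in>V - {amid \<tau>}. ainc \<tau> a *\<^sub>R Y a) = (\<Sum>a\<in>V. ainc \<tau> a *\<^sub>R Y a) - ainc \<tau> (amid \<tau>) *\<^sub>R Y (amid \<tau>)"
      using amid_V[OF \<tau>] by (simp add: sum_diff1)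
    from \<tau> show "(1 / - ainc \<tau> (amid \<tau>)) *\<^sub>R ((\<Sum>a\<in>V - {amid \<tau>}. ainc \<tau> a *\<^sub>R Y a) + vec (apay \<tau>)) \<in> K (amid \<tau>)"
    proof (cases rule: Act_cases)
      case (stop p)
      have "(\<Sum>a\<in>V - {amid \<tau>}. ainc \<tau> a *\<^sub>R Y a) = 0"
        by (intro sum.neutral) (auto simp: stop ainc_stop ind_def)
      then show ?thesis using K(2)[OF stop(1)] by (simp add: stop ainc_stop ind_def)
    next
      case (split p q r)
      define x y v where "x = sum_list p" and "y = sum_list q" and "v = sum_list r"
      have ord: "x < y" "y < v" using split by (auto simp: splittable_def x_def y_def v_def)
      then have ne: "p \<noteq> q" "q \<noteq> r" "p \<noteq> r" by (auto simp: x_def y_def v_def)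
      have mid: "amid \<tau> = q" "apay \<tau> = zs" by (simp_all add: split split_def)
      have aq: "ainc \<tau> q = - (v - x)" using ne by (simp add: split ainc_split ind_def x_def v_def)
      have sum: "(\<Sum>a\<in>V - {q}. ainc \<tau> a *\<^sub>R Y a) = (v - y) *\<^sub>R Y p + (y - x) *\<^sub>R Y r"
        using rem sum_ainc_split[OF split(1,2,3), of Y] ne
        unfolding mid aq by (simp add: split x_def[symmetric] y_def[symmetric] v_def[symmetric] scaleR_left_diff_distrib)
      have Ypr: "Y p \<in> K p" "Y r \<in> K r"
        using ord ne by (auto intro!: Y simp: split ainc_split ind_def x_def y_def v_def)
      define t where "t = (v - y) / (v - x)"
      have t: "0 \<le> t" "t \<le> 1" "1 - t = (y - x) / (v - x)" using ord by (auto simp: t_def field_simps)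
      have "t *\<^sub>R Y p + (1 - t) *\<^sub>R Y r \<in> K (mix t p r)"
        using split Ypr t splittable_axis
        by (intro axis_convexD[OF K(1)]) (auto simp: length_product_lists)
      moreover have "mix t p r = q"
        using splittable_mix[OF split(1-4)] by (simp add: t_def x_def y_def v_def)
      moreover have "(1 / (v - x)) *\<^sub>R ((v - y) *\<^sub>R Y p + (y - x) *\<^sub>R Y r) = t *\<^sub>R Y p + (1 - t) *\<^sub>R Y r"
        unfolding t(3) by (simp add: t_def scaleR_right_distrib)
      ultimately show ?thesis unfolding mid sum aq by (simp add: vec_zs)
    qed
  qed
  then obtain Y where Y: "\<And>a. a \<in> V \<Longrightarrow> 0 < m a \<Longrightarrow> Y a \<in> K a" "payoff z = (\<Sum>a\<in>V. m a *\<^sub>R Y a)"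
    by (auto simp: payoff_def)
  have "(\<Sum>a\<in>V. lam B w a *\<^sub>R Y a) \<in> K w"
    using Y by (intro interpolate_box K w D(1,2)) (auto simp: m_def)
  moreover have "payoff z = (\<Sum>a\<in>V. lam B w a *\<^sub>R Y a)"
    unfolding Y(2) by (intro sum.cong) (auto simp: m_def)
  ultimately show ?thesis using D(10) by simp
qed

end

section \<open>Cones described by linear inequalities\<close>

definition dot :: "real list \<Rightarrow> real list \<Rightarrow> real" where
  "dot r y = sum_list (map (\<lambda>e. fst e * snd e) (zip r y))"

lemma dot_simps [simp]: "dot [] y = 0" "dot (a # r) (b # ys) = a * b + dot r ys"
  by (simp_all add: dot_def)

lemma dot_conv_sum: "length r = length y \<Longrightarrow> dot r y = (\<Sum>i<length y. r ! i * y ! i)"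
  by (simp add: dot_def sum_list_sum_nth atLeast0LessThan)

text \<open>A row \<open>(s, r)\<close> stands for the inequality \<open>0 < dot r y\<close> or \<open>0 \<le> dot r y\<close>, depending on \<open>s\<close>.\<close>

definition sat :: "(bool \<times> real list) list \<Rightarrow> real list \<Rightarrow> bool" where
  "sat R y \<longleftrightarrow> (\<forall>r\<in>set R. if fst r then 0 < dot (snd r) y else 0 \<le> dot (snd r) y)"

text \<open>Fourier--Motzkin elimination of \<open>z\<close> from \<open>sat R (y - z * c)\<close> and \<open>0 \<le> z\<close> (or \<open>0 < z\<close>).\<close>

definition add_ray :: "bool \<Rightarrow> real list \<Rightarrow> (bool \<times> real list) list \<Rightarrow> (bool \<times> real list) list" where
  "add_ray s c R = filter (\<lambda>r. dot (snd r) c = 0) R @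
     map (\<lambda>r. (s \<or> fst r, snd r)) (filter (\<lambda>r. 0 < dot (snd r) c) R) @
     concat (map (\<lambda>r. map (\<lambda>r'. (fst r \<or> fst r',
         map (\<lambda>e. dot (snd r') c * fst e - dot (snd r) c * snd e) (zip (snd r) (snd r'))))
       (filter (\<lambda>r'. 0 < dot (snd r') c) R)) (filter (\<lambda>r. dot (snd r) c < 0) R))"

definition rows_length :: "nat \<Rightarrow> (bool \<times> real list) list \<Rightarrow> bool" where
  "rows_length n R \<longleftrightarrow> (\<forall>r\<in>set R. length (snd r) = n)"

lemma rows_length_add_ray: "rows_length n R \<Longrightarrow> rows_length n (add_ray s c R)"
  by (auto simp: rows_length_def add_ray_def) (metis min.idem snd_conv)

lemma dot_combine: "length r = length y \<Longrightarrow> length r' = length y \<Longrightarrow>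
    dot (map (\<lambda>e. a * fst e - b * snd e) (zip r r')) y = a * dot r y - b * dot r' y"
proof (induction r y arbitrary: r' rule: list_induct2)
  case (Cons x r v y)
  then show ?case by (cases r') (auto simp: algebra_simps)
qed simp

lemma dot_shift: "length r = length y \<Longrightarrow> length c = length y \<Longrightarrow>
    dot r (map (\<lambda>e. fst e - z * snd e) (zip y c)) = dot r y - z * dot r c"
proof (induction r y arbitrary: c rule: list_induct2)
  case (Cons x r v y)
  then show ?case by (cases c) (auto simp: algebra_simps)
qed simp

definition less_if :: "bool \<Rightarrow> real \<Rightarrow> real \<Rightarrow> bool" where
  "less_if s a b \<longleftrightarrow> (if s then a < b else a \<le> b)"

text \<open>The largest lower and the smallest upper bound decide. If they differ, their midpoint is
  strictly between all bounds; if they coincide, no bound that attains the common value is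
  strict.\<close>

lemma between_bounds:
  fixes Lo Up :: "(bool \<times> real) set"
  assumes "finite Lo" "finite Up" "Lo \<noteq> {}"
  shows "(\<exists>z. (\<forall>l\<in>Lo. less_if (fst l) (snd l) z) \<and> (\<forall>u\<in>Up. less_if (fst u) z (snd u))) \<longleftrightarrow>
    (\<forall>l\<in>Lo. \<forall>u\<in>Up. less_if (fst l \<or> fst u) (snd l) (snd u))"
proof
  assume R: "\<forall>l\<in>Lo. \<forall>u\<in>Up. less_if (fst l \<or> fst u) (snd l) (snd u)"
  define a where "a = Max (snd ` Lo)"
  have a: "a \<in> snd ` Lo" "\<And>l. l \<in> Lo \<Longrightarrow> snd l \<le> a" using assms by (auto simp: a_def)
  show "\<exists>z. (\<forall>l\<in>Lo. less_if (fst l) (snd l) z) \<and> (\<forall>u\<in>Up. less_if (fst u) z (snd u))"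
  proof (cases "Up = {}")
    case True
    then show ?thesis using a(2) by (intro exI[of _ "a + 1"]) (force simp: less_if_def)
  next
    case False
    define b where "b = Min (snd ` Up)"
    have b: "b \<in> snd ` Up" "\<And>u. u \<in> Up \<Longrightarrow> b \<le> snd u" using assms False by (auto simp: b_def)
    obtain l u where lu: "l \<in> Lo" "snd l = a" "u \<in> Up" "snd u = b" using a b by auto
    have ab: "a \<le> b" using R lu by (force simp: less_if_def split: if_splits)
    have "less_if (fst l') (snd l') ((a + b) / 2)" if "l' \<in> Lo" for l'
      using a(2)[OF that] ab R[rule_format, OF that lu(3)] lu by (auto simp: less_if_def split: if_splits)
    moreover have "less_if (fst u') ((a + b) / 2) (snd u')" if "u' \<in> Up" for u'
      using b(2)[OF that] ab R[rule_format, OF lu(1) that] lu by (auto simp: less_if_def split: if_splits)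
    ultimately show ?thesis by blast
  qed
qed (force simp: less_if_def split: if_splits)

lemma sat_add_ray:
  assumes R: "rows_length (length y) R" and c: "length c = length y"
  shows "sat (add_ray s c R) y \<longleftrightarrow>
    (\<exists>z. less_if s 0 z \<and> sat R (map (\<lambda>e. fst e - z * snd e) (zip y c)))"
proof -
  define v where "v r = dot (snd r) y" for r :: "bool \<times> real list"
  define d where "d r = dot (snd r) c" for r :: "bool \<times> real list"
  \<comment> \<open>The sign condition on \<open>z\<close> is itself a lower bound, so
    \<open>Lo\<close> is not empty; paired with the upper bounds it produces the second group of
    rows in \<open>add_ray\<close>.\<close>
  define Lo where "Lo = insert (s, 0) ((\<lambda>r. (fst r, v r / d r)) ` {r \<in> set R. d r < 0})"
  define Up where "Up = (\<lambda>r. (fst r, v r / d r)) ` {r \<in> set R. 0 < d r}"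
  define Z where "Z \<longleftrightarrow> (\<forall>r\<in>set R. d r = 0 \<longrightarrow> less_if (fst r) 0 (v r))"
  have one: "less_if f 0 (a - z * b) \<longleftrightarrow>
      (if b = 0 then less_if f 0 a else if b < 0 then less_if f (a / b) z else less_if f z (a / b))"
    for f a b z by (auto simp: less_if_def field_simps)
  have "sat R (map (\<lambda>e. fst e - z * snd e) (zip y c)) \<longleftrightarrow> (\<forall>r\<in>set R. less_if (fst r) 0 (v r - z * d r))" for z
    using R c unfolding sat_def rows_length_def less_if_def v_def d_def
    by (intro ball_cong) (auto simp: dot_shift)
  moreover have "(\<forall>r\<in>set R. if d r = 0 then P r else if d r < 0 then Q r else T r) \<longleftrightarrow>
      (\<forall>r\<in>set R. d r = 0 \<longrightarrow> P r) \<and> (\<forall>r\<in>{r \<in> set R. d r < 0}. Q r) \<and> (\<forall>r\<in>{r \<in> set R. 0 < d r}. T r)" for P Q T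
  proof -
    have "(if d r = 0 then P r else if d r < 0 then Q r else T r) \<longleftrightarrow>
        (d r = 0 \<longrightarrow> P r) \<and> (d r < 0 \<longrightarrow> Q r) \<and> (0 < d r \<longrightarrow> T r)" for r
      by (cases "d r" "0 :: real" rule: linorder_cases) auto
    then show ?thesis by (simp only: mem_Collect_eq) blast
  qed
  ultimately have "less_if s 0 z \<and> sat R (map (\<lambda>e. fst e - z * snd e) (zip y c)) \<longleftrightarrow>
      Z \<and> (\<forall>l\<in>Lo. less_if (fst l) (snd l) z) \<and> (\<forall>u\<in>Up. less_if (fst u) z (snd u))" for z
    unfolding one Z_def Lo_def Up_def by (simp only: ball_simps fst_conv snd_conv) blast
  then have rhs: "(\<exists>z. less_if s 0 z \<and> sat R (map (\<lambda>e. fst e - z * snd e) (zip y c))) \<longleftrightarrow>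
      Z \<and> (\<exists>z. (\<forall>l\<in>Lo. less_if (fst l) (snd l) z) \<and> (\<forall>u\<in>Up. less_if (fst u) z (snd u)))"
    by simp
  have pair: "less_if f 0 (d' * a - b * a') \<longleftrightarrow> less_if f (a / b) (a' / d')"
    if "b < 0" "0 < d'" for a b a' d' :: real and f :: bool
  proof -
    have "a / b \<le> a' / d' \<longleftrightarrow> a' * b \<le> a * d'" "a / b < a' / d' \<longleftrightarrow> a' * b < a * d'"
      using that by (auto simp: field_simps)
    then show ?thesis by (auto simp: less_if_def algebra_simps)
  qed
  have comb: "dot (map (\<lambda>e. d r' * fst e - d r * snd e) (zip (snd r) (snd r'))) y = d r' * v r - d r * v r'"
    if "r \<in> set R" "r' \<in> set R" for r r'
    using that R by (simp add: rows_length_def v_def dot_combine)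
  have pos: "less_if f 0 a \<longleftrightarrow> less_if f 0 (a / b)" if "0 < b" for f a b
    using that by (auto simp: less_if_def zero_less_divide_iff zero_le_divide_iff)
  have concat: "(\<forall>r\<in>\<Union> (set ` (f ` X)). P r) \<longleftrightarrow> (\<forall>x\<in>X. \<forall>r\<in>set (f x). P r)"
    for f :: "'b \<Rightarrow> 'c list" and X P by auto
  have "sat (add_ray s c R) y \<longleftrightarrow> (\<forall>r\<in>{r \<in> set R. d r = 0}. less_if (fst r) 0 (v r)) \<and>
     (\<forall>r\<in>{r \<in> set R. 0 < d r}. less_if (s \<or> fst r) 0 (v r)) \<and>
     (\<forall>r\<in>{r \<in> set R. d r < 0}. \<forall>r'\<in>{r \<in> set R. 0 < d r}. less_if (fst r \<or> fst r') 0
       (dot (map (\<lambda>e. d r' * fst e - d r * snd e) (zip (snd r) (snd r'))) y))"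
    unfolding sat_def less_if_def[symmetric] add_ray_def set_append ball_Un set_concat set_map set_filter v_def d_def
    by (simp only: concat set_map set_filter ball_simps fst_conv snd_conv)
  also have "\<dots> \<longleftrightarrow> Z \<and> (\<forall>r\<in>{r \<in> set R. 0 < d r}. less_if (s \<or> fst r) 0 (v r)) \<and>
     (\<forall>r\<in>{r \<in> set R. d r < 0}. \<forall>r'\<in>{r \<in> set R. 0 < d r}. less_if (fst r \<or> fst r') 0 (d r' * v r - d r * v r'))"
    using comb by (auto simp: Z_def)
  also have "\<dots> \<longleftrightarrow> Z \<and> (\<forall>l\<in>Lo. \<forall>u\<in>Up. less_if (fst l \<or> fst u) (snd l) (snd u))"
  proof -
    have 1: "(\<forall>r\<in>{r \<in> set R. 0 < d r}. less_if (s \<or> fst r) 0 (v r)) \<longleftrightarrow>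
        (\<forall>r\<in>{r \<in> set R. 0 < d r}. less_if (s \<or> fst r) 0 (v r / d r))"
      by (intro ball_cong HOL.refl pos) simp
    have 2: "(\<forall>r\<in>{r \<in> set R. d r < 0}. \<forall>r'\<in>{r \<in> set R. 0 < d r}. less_if (fst r \<or> fst r') 0 (d r' * v r - d r * v r')) \<longleftrightarrow>
        (\<forall>r\<in>{r \<in> set R. d r < 0}. \<forall>r'\<in>{r \<in> set R. 0 < d r}. less_if (fst r \<or> fst r') (v r / d r) (v r' / d r'))"
      by (intro ball_cong HOL.refl pair) simp_all
    show ?thesis unfolding 1 2 Lo_def Up_def by (simp only: ball_simps fst_conv snd_conv)
  qed
  also have "\<dots> \<longleftrightarrow> Z \<and> (\<exists>z. (\<forall>l\<in>Lo. less_if (fst l) (snd l) z) \<and> (\<forall>u\<in>Up. less_if (fst u) z (snd u)))"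
    by (subst between_bounds) (auto simp: Lo_def Up_def)
  finally show ?thesis using rhs by simp
qed

definition add_rays :: "bool \<Rightarrow> ('t \<Rightarrow> real list) \<Rightarrow> 't list \<Rightarrow> (bool \<times> real list) list \<Rightarrow> (bool \<times> real list) list" where
  "add_rays s gen ts R = fold (\<lambda>t. add_ray s (gen t)) ts R"

lemma rows_length_add_rays: "rows_length n R \<Longrightarrow> rows_length n (add_rays s gen ts R)"
  unfolding add_rays_def by (induction ts arbitrary: R) (auto intro: rows_length_add_ray)

definition shift :: "('t \<Rightarrow> real list) \<Rightarrow> ('t \<Rightarrow> real) \<Rightarrow> 't set \<Rightarrow> real list \<Rightarrow> real list" where
  "shift gen z T y = map (\<lambda>i. y ! i - (\<Sum>t\<in>T. z t * gen t ! i)) [0..<length y]"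

lemma length_shift [simp]: "length (shift gen z T y) = length y"
  by (simp add: shift_def)

text \<open>The sum runs over a set although \<open>ts\<close> may repeat a generator, so the
  coefficients of repetitions have to be merged and shared. The last ray is eliminated outermost,
  hence the induction from the end.\<close>

lemma sat_add_rays:
  assumes R: "rows_length (length y) R" and gen: "\<And>t. t \<in> set ts \<Longrightarrow> length (gen t) = length y"
  shows "sat (add_rays s gen ts R) y \<longleftrightarrow>
    (\<exists>z. (\<forall>t. 0 \<le> z t) \<and> (\<forall>t. 0 < z t \<longrightarrow> t \<in> set ts) \<and> (s \<longrightarrow> (\<forall>t\<in>set ts. 0 < z t)) \<and>
       sat R (shift gen z (set ts) y))"
  using assms
proof (induction ts arbitrary: y rule: rev_induct)
  case Nil
  have "map ((!) y) [0..<length y] = y" by (rule map_nth)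
  then show ?case by (auto simp: add_rays_def shift_def intro: exI[of _ "\<lambda>_. 0"])
next
  case (snoc t ts)
  let ?y = "\<lambda>z. map (\<lambda>e. fst e - z * snd e) (zip y (gen t))"
  have ly: "length (?y z) = length y" for z using snoc.prems by simp
  have "sat (add_rays s gen (ts @ [t]) R) y \<longleftrightarrow> (\<exists>z. less_if s 0 z \<and> sat (add_rays s gen ts R) (?y z))"
    using snoc.prems sat_add_ray[OF rows_length_add_rays, of y R "gen t" s s gen ts]
    by (simp add: add_rays_def)
  also have "\<dots> \<longleftrightarrow> (\<exists>z. less_if s 0 z \<and> (\<exists>x. (\<forall>t. 0 \<le> x t) \<and> (\<forall>t. 0 < x t \<longrightarrow> t \<in> set ts) \<and>
      (s \<longrightarrow> (\<forall>t\<in>set ts. 0 < x t)) \<and> sat R (shift gen x (set ts) (?y z))))"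
    using snoc.prems by (subst snoc.IH) (auto simp: ly)
  also have "\<dots> \<longleftrightarrow> (\<exists>z. (\<forall>t. 0 \<le> z t) \<and> (\<forall>u. 0 < z u \<longrightarrow> u \<in> set (ts @ [t])) \<and>
      (s \<longrightarrow> (\<forall>u\<in>set (ts @ [t]). 0 < z u)) \<and> sat R (shift gen z (set (ts @ [t])) y))" (is "?l \<longleftrightarrow> ?r")
  proof -
    have sh: "shift gen x (set ts) (?y a) = shift gen (x(t := x t + a)) (set (ts @ [t])) y"
      if "\<And>u. 0 < x u \<Longrightarrow> u \<in> set ts" "\<And>u. 0 \<le> x u" for x a
    proof (rule nth_equalityI)
      fix i assume i: "i < length (shift gen x (set ts) (?y a))"
      have x0: "x t = 0" if "t \<notin> set ts" using that \<open>\<And>u. 0 < x u \<Longrightarrow> u \<in> set ts\<close>[of t] \<open>\<And>u. 0 \<le> x u\<close>[of t]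
        by (auto simp: order.order_iff_strict)
      have "(\<Sum>u\<in>set (ts @ [t]). (x(t := x t + a)) u * gen u ! i) =
          (\<Sum>u\<in>set (ts @ [t]). x u * gen u ! i + (if u = t then a * gen u ! i else 0))"
        by (intro sum.cong) (auto simp: algebra_simps)
      also have "\<dots> = (\<Sum>u\<in>insert t (set ts). x u * gen u ! i) + a * gen t ! i"
        by (simp add: sum.distrib)
      also have "(\<Sum>u\<in>insert t (set ts). x u * gen u ! i) = (\<Sum>u\<in>set ts. x u * gen u ! i)"
        using x0 by (cases "t \<in> set ts") (auto simp: insert_absorb)
      finally show "shift gen x (set ts) (?y a) ! i = shift gen (x(t := x t + a)) (set (ts @ [t])) y ! i"
        using i snoc.prems by (simp add: shift_def)
    qed (use snoc.prems in simp)
    show ?thesis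
    proof
      assume ?l
      then obtain a x where ax: "less_if s 0 a" "\<And>u. 0 \<le> x u" "\<And>u. 0 < x u \<Longrightarrow> u \<in> set ts"
        "s \<longrightarrow> (\<forall>u\<in>set ts. 0 < x u)" "sat R (shift gen x (set ts) (?y a))" by blast
      have "0 \<le> a" using ax(1) by (auto simp: less_if_def split: if_splits)
      then show ?r using ax sh[OF ax(3,2), where a = a]
        by (intro exI[of _ "x(t := x t + a)"]) (auto simp: less_if_def add_nonneg_pos split: if_splits)
    next
      assume ?r
      then obtain z where z: "\<And>u. 0 \<le> z u" "\<And>u. 0 < z u \<Longrightarrow> u \<in> set (ts @ [t])"
        "s \<longrightarrow> (\<forall>u\<in>set (ts @ [t]). 0 < z u)" "sat R (shift gen z (set (ts @ [t])) y)" by blast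
      \<comment> \<open>If \<open>t\<close> occurs again in \<open>ts\<close>, half of its
        coefficient is left for the earlier occurrence, which keeps both positive in the strict
        case.\<close>
      define a where "a = (if t \<in> set ts then z t / 2 else z t)"
      define x where "x = z(t := z t - a)"
      have za: "x(t := x t + a) = z" by (auto simp: x_def)
      have x: "0 < x u \<Longrightarrow> u \<in> set ts" "0 \<le> x u" for u
        using z(1,2)[of u] by (auto simp: x_def a_def split: if_splits)
      have "less_if s 0 a" using z(1)[of t] z(3) by (auto simp: a_def less_if_def)
      moreover have "s \<longrightarrow> (\<forall>u\<in>set ts. 0 < x u)" using z(3) by (auto simp: x_def a_def)
      ultimately show ?l using z(4) sh[OF x, where a = a] x za by (intro exI[of _ a] conjI exI[of _ x]) auto
    qed
  qed
  finally show ?case .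
qed

text \<open>The first component of \<open>units xs\<close> lists the standard unit vectors of dimension \<open>length xs\<close>,
  the second one is the zero vector.\<close>

definition units :: "'b list \<Rightarrow> real list list \<times> real list" where
  "units xs = foldr (\<lambda>_ s. ((1 # snd s) # map (\<lambda>r. 0 # r) (fst s), 0 # snd s)) xs ([], [])"

text \<open>The cone consisting of 0 only, to which the generators are added. The dimension is given
  by a list because the calculus recurses on lists.\<close>

definition zero_rows :: "'b list \<Rightarrow> (bool \<times> real list) list" where
  "zero_rows xs = map (\<lambda>r. (False, r)) (fst (units xs)) @
     map (\<lambda>r. (False, map (\<lambda>v. 0 - v) r)) (fst (units xs))"

lemma units_Cons:
  "units (x # xs) = ((1 # snd (units xs)) # map (\<lambda>r. 0 # r) (fst (units xs)), 0 # snd (units xs))"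
  by (simp add: units_def)

lemma snd_units: "snd (units xs) = replicate (length xs) 0"
  by (induction xs) (simp_all add: units_def)

lemma length_units: "r \<in> set (fst (units xs)) \<Longrightarrow> length r = length xs"
  by (induction xs arbitrary: r) (auto simp: units_Cons snd_units, simp add: units_def)

lemma dot_zero: "dot (replicate n 0) y = 0"
proof (induction n arbitrary: y)
  case (Suc n)
  then show ?case by (cases y) (simp_all add: dot_def)
qed simp

lemma units_dot_zero:
  "length xs = length y \<Longrightarrow> (\<forall>r\<in>set (fst (units xs)). dot r y = 0) \<longleftrightarrow> (\<forall>v\<in>set y. v = 0)"
proof (induction xs y rule: list_induct2)
  case Nil
  show ?case by (simp add: units_def)
next
  case (Cons x xs v y)
  then show ?case by (simp add: units_Cons snd_units dot_zero)
qed

lemma rows_length_zero_rows: "rows_length (length xs) (zero_rows xs)"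
  using length_units[of _ xs] by (auto simp: rows_length_def zero_rows_def)

lemma dot_uminus: "dot (map (\<lambda>v. 0 - v) r) y = - dot r y"
proof (induction r arbitrary: y)
  case (Cons a r)
  then show ?case by (cases y) (auto simp: dot_def)
qed simp

lemma sat_zero_rows: "length y = length xs \<Longrightarrow> sat (zero_rows xs) y \<longleftrightarrow> (\<forall>v\<in>set y. v = 0)"
proof -
  assume l: "length y = length xs"
  have "sat (zero_rows xs) y \<longleftrightarrow> (\<forall>r\<in>set (fst (units xs)). 0 \<le> dot r y) \<and> (\<forall>r\<in>set (fst (units xs)). dot r y \<le> 0)"
    by (simp add: sat_def zero_rows_def dot_uminus[simplified] ball_Un)
  also have "\<dots> \<longleftrightarrow> (\<forall>r\<in>set (fst (units xs)). dot r y = 0)"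
    by (auto intro: order.antisym)
  finally have "sat (zero_rows xs) y \<longleftrightarrow> (\<forall>r\<in>set (fst (units xs)). dot r y = 0)" .
  then show ?thesis using units_dot_zero[of xs y] l by simp
qed

text \<open>To force positive coefficients on \<open>L\<close>, its rays are added once more with
  strict sign; as \<open>L\<close> lies inside \<open>A\<close>, the two coefficients of a ray add
  up to one.\<close>

lemma sat_cone:
  assumes gen: "\<And>t. t \<in> set A \<Longrightarrow> length (gen t) = length xs" and L: "set L \<subseteq> set A"
    and y: "length y = length xs"
  shows "sat (add_rays True gen L (add_rays False gen A (zero_rows xs))) y \<longleftrightarrow>
    (\<exists>z. (\<forall>t. 0 \<le> z t) \<and> (\<forall>t. 0 < z t \<longrightarrow> t \<in> set A) \<and> (\<forall>t\<in>set L. 0 < z t) \<and>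
      (\<forall>i<length xs. y ! i = (\<Sum>t\<in>set A. z t * gen t ! i)))" (is "?l \<longleftrightarrow> ?r")
proof -
  have colL: "length (gen t) = length y" if "t \<in> set L" for t using that L gen y by auto
  have R: "rows_length (length y) (zero_rows xs)" using rows_length_zero_rows[of xs] y by simp
  have zero: "sat (zero_rows xs) (shift gen x (set A) v) \<longleftrightarrow>
      (\<forall>i<length xs. v ! i = (\<Sum>t\<in>set A. x t * gen t ! i))" if "length v = length xs" for x v
    using that by (simp add: sat_zero_rows) (auto simp: shift_def)
  have "?l \<longleftrightarrow> (\<exists>z. (\<forall>t. 0 \<le> z t) \<and> (\<forall>t. 0 < z t \<longrightarrow> t \<in> set L) \<and> (\<forall>t\<in>set L. 0 < z t) \<and>
     (\<exists>x. (\<forall>t. 0 \<le> x t) \<and> (\<forall>t. 0 < x t \<longrightarrow> t \<in> set A) \<and>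
       (\<forall>i<length xs. shift gen z (set L) y ! i = (\<Sum>t\<in>set A. x t * gen t ! i))))"
  proof -
    have "sat (add_rays False gen A (zero_rows xs)) v \<longleftrightarrow> (\<exists>x. (\<forall>t. 0 \<le> x t) \<and> (\<forall>t. 0 < x t \<longrightarrow> t \<in> set A) \<and>
       (\<forall>i<length xs. v ! i = (\<Sum>t\<in>set A. x t * gen t ! i)))" if v: "length v = length xs" for v
      using sat_add_rays[of v "zero_rows xs" A gen False] gen R y v by (simp add: zero)
    then show ?thesis
      using sat_add_rays[OF rows_length_add_rays[OF R, of False gen A], of L gen True] colL y by simp
  qed
  also have "\<dots> \<longleftrightarrow> ?r"
  proof -
    have extend: "(\<Sum>t\<in>set L. z t * gen t ! i) = (\<Sum>t\<in>set A. z t * gen t ! i)"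
      if "\<And>t. 0 < z t \<Longrightarrow> t \<in> set L" "\<And>t. 0 \<le> z t" for z :: "'a \<Rightarrow> real" and i
      using L that by (intro sum.mono_neutral_left) (auto simp: order.order_iff_strict)
    show ?thesis
    proof
      assume "\<exists>z. (\<forall>t. 0 \<le> z t) \<and> (\<forall>t. 0 < z t \<longrightarrow> t \<in> set L) \<and> (\<forall>t\<in>set L. 0 < z t) \<and>
       (\<exists>x. (\<forall>t. 0 \<le> x t) \<and> (\<forall>t. 0 < x t \<longrightarrow> t \<in> set A) \<and>
         (\<forall>i<length xs. shift gen z (set L) y ! i = (\<Sum>t\<in>set A. x t * gen t ! i)))"
      then obtain z x where z: "\<And>t. 0 \<le> z t" "\<And>t. 0 < z t \<Longrightarrow> t \<in> set L" "\<And>t. t \<in> set L \<Longrightarrow> 0 < z t"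
        and x: "\<And>t. 0 \<le> x t" "\<And>t. 0 < x t \<Longrightarrow> t \<in> set A"
        and e: "\<And>i. i < length xs \<Longrightarrow> shift gen z (set L) y ! i = (\<Sum>t\<in>set A. x t * gen t ! i)" by blast
      have "y ! i = (\<Sum>t\<in>set A. (z t + x t) * gen t ! i)" if "i < length xs" for i
        using e[OF that] that y extend[OF z(2,1), where i = i] by (simp add: shift_def distrib_right sum.distrib)
      moreover have "t \<in> set A" if "0 < z t + x t" for t
        using that z(1)[of t] z(2)[of t] x(1)[of t] x(2)[of t] L by (cases "0 < z t"; cases "0 < x t") auto
      ultimately show ?r using z x by (intro exI[of _ "\<lambda>t. z t + x t"]) (auto intro: add_pos_nonneg)
    next
      assume ?r
      then obtain w where w: "\<And>t. 0 \<le> w t" "\<And>t. 0 < w t \<Longrightarrow> t \<in> set A" "\<And>t. t \<in> set L \<Longrightarrow> 0 < w t"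
        "\<And>i. i < length xs \<Longrightarrow> y ! i = (\<Sum>t\<in>set A. w t * gen t ! i)" by blast
      \<comment> \<open>Half of each coefficient on \<open>L\<close> becomes the strict one, the
        other half remains for the weak part.\<close>
      define z where "z t = (if t \<in> set L then w t / 2 else 0)" for t
      have z: "0 < z t \<Longrightarrow> t \<in> set L" "0 \<le> z t" for t using w(1)[of t] by (auto simp: z_def split: if_splits)
      have "shift gen z (set L) y ! i = (\<Sum>t\<in>set A. (w t - z t) * gen t ! i)" if "i < length xs" for i
        using w(4)[OF that] that y extend[OF z, where i = i] by (simp add: shift_def left_diff_distrib sum_subtractf)
      moreover have "0 \<le> w t - z t" "0 < w t - z t \<Longrightarrow> t \<in> set A" "t \<in> set L \<Longrightarrow> 0 < z t" for t
        using w(1,2,3)[of t] by (auto simp: z_def split: if_splits)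
      ultimately show "\<exists>z. (\<forall>t. 0 \<le> z t) \<and> (\<forall>t. 0 < z t \<longrightarrow> t \<in> set L) \<and> (\<forall>t\<in>set L. 0 < z t) \<and>
       (\<exists>x. (\<forall>t. 0 \<le> x t) \<and> (\<forall>t. 0 < x t \<longrightarrow> t \<in> set A) \<and>
         (\<forall>i<length xs. shift gen z (set L) y ! i = (\<Sum>t\<in>set A. x t * gen t ! i)))"
        using z by (intro exI[of _ z] conjI exI[of _ "\<lambda>t. w t - z t"]) auto
    qed
  qed
  finally show ?thesis .
qed

section \<open>The formula and its computation\<close>

definition chain_step :: "action \<Rightarrow> action list \<Rightarrow> bool" where
  "chain_step \<tau> L = list_all (\<lambda>e. list_ex (\<lambda>\<sigma>. amid \<sigma> = fst e) L) (aends \<tau>)"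

text \<open>The entries of \<open>grid\<close> only count iterations; one for each grid point is
  enough by \<open>length_distinct_chain\<close>.\<close>

definition chain_lists :: "real list list \<Rightarrow> action list \<Rightarrow> action list list" where
  "chain_lists grid A = fold (\<lambda>_ Ls. Ls @ concat (map (\<lambda>L. map (\<lambda>\<tau>. \<tau> # L) (filter (\<lambda>\<tau>. chain_step \<tau> L) A)) Ls)) grid [[]]"

definition boxes :: "real list list \<Rightarrow> (real \<times> real) list list" where
  "boxes Xs = product_lists (map (\<lambda>X. concat (map (\<lambda>l. map (\<lambda>h. (l, h)) X) X)) Xs)"

text \<open>Transposes the list of positions. \<open>es\<close> supplies one empty list for each
  coordinate, which fixes the number of columns even if there are no points.\<close>

definition columns :: "(real list \<times> real list) list \<Rightarrow> real list list \<Rightarrow> real list list" where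
  "columns pts es = foldr (\<lambda>p cs. map (\<lambda>e. fst e # snd e) (zip (fst p) cs)) pts es"

text \<open>The generator of the cone that belongs to an action: its effect on the places, then the
  coordinates of its payout.\<close>

definition column :: "real list list \<Rightarrow> action \<Rightarrow> real list" where
  "column grid \<tau> = map (ainc \<tau>) grid @ apay \<tau>"

text \<open>The filter is the support condition of \<open>certificate\<close>, and the strict rays
  are its positivity on \<open>L\<close>.\<close>

definition cone_rows :: "real list list \<Rightarrow> real list \<Rightarrow> action list \<Rightarrow> action list \<Rightarrow> (bool \<times> real list) list" where
  "cone_rows grid zs A L = add_rays True (column grid) L
     (add_rays False (column grid) (filter (\<lambda>\<tau>. list_ex (\<lambda>\<sigma>. amid \<sigma> = amid \<tau>) L) A)
       (zero_rows (map (\<lambda>_. 0 :: real) grid @ zs)))"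

text \<open>\<open>l\<close>, \<open>h\<close> and \<open>g\<close> are numbers known to the
  program, so the case distinction and the division are settled when the formula is produced; only
  \<open>W\<close> contains variables.\<close>

definition hatpoly :: "real \<Rightarrow> real \<Rightarrow> rpoly \<Rightarrow> real \<Rightarrow> rpoly" where
  "hatpoly l h W g = (if l = h then (if g = l then PConst 1 else PConst 0)
     else if g = l then PMul (PConst (1 / (h - l))) (PAdd (PConst h) (PMul (PConst (- 1)) W))
     else if g = h then PMul (PConst (1 / (h - l))) (PAdd W (PConst (0 - l))) else PConst 0)"

definition lampoly :: "(real \<times> real) list \<Rightarrow> rpoly list \<Rightarrow> real list \<Rightarrow> rpoly" where
  "lampoly B WP a = foldr (\<lambda>e r. PMul (hatpoly (fst (fst e)) (snd (fst e)) (fst (snd e)) (snd (snd e))) r)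
     (zip B (zip WP a)) (PConst 1)"

definition nonneg :: "rpoly \<Rightarrow> qf_formula" where
  "nonneg p = FNeg (GtZero (PMul (PConst (- 1)) p))"

definition conj_form :: "qf_formula list \<Rightarrow> qf_formula" where
  "conj_form fs = foldr (\<lambda>f g. FConj f g) fs (EqZero (PConst 0))"

definition disj_form :: "qf_formula list \<Rightarrow> qf_formula" where
  "disj_form fs = foldr (\<lambda>f g. FDisj f g) fs (GtZero (PConst 0))"

definition boxform :: "(real \<times> real) list \<Rightarrow> rpoly list \<Rightarrow> qf_formula" where
  "boxform B WP = conj_form (map (\<lambda>e. FConj (nonneg (PAdd (snd e) (PConst (0 - fst (fst e)))))
     (nonneg (PAdd (PConst (snd (fst e))) (PMul (PConst (- 1)) (snd e))))) (zip B WP))"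

definition dotpoly :: "real list \<Rightarrow> rpoly list \<Rightarrow> rpoly" where
  "dotpoly r Y = foldr (\<lambda>e q. PAdd (PMul (PConst (fst e)) (snd e)) q) (zip r Y) (PConst 0)"

definition rowform :: "rpoly list \<Rightarrow> bool \<times> real list \<Rightarrow> qf_formula" where
  "rowform Y r = (if fst r then GtZero (dotpoly (snd r) Y) else nonneg (dotpoly (snd r) Y))"

definition cell_form :: "rpoly list \<Rightarrow> rpoly list \<Rightarrow> real list list \<Rightarrow> (real \<times> real) list \<Rightarrow>
    (bool \<times> real list) list \<Rightarrow> qf_formula" where
  "cell_form WP UP grid B R = FConj (boxform B WP)
     (conj_form (map (rowform (map (\<lambda>a. PMul (PConst (- 1)) (lampoly B WP a)) grid @ UP)) R))"

definition grid_form :: "rpoly list \<Rightarrow> rpoly list \<Rightarrow> real list \<Rightarrow> action list \<Rightarrow> real list list \<Rightarrow> real list list \<Rightarrow> qf_formula" where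
  "grid_form WP UP zs A grid Xs = disj_form (concat (map (\<lambda>B. map (\<lambda>L. cell_form WP UP grid B (cone_rows grid zs A L))
     (chain_lists grid A)) (boxes Xs)))"

definition hull_form :: "rpoly list \<Rightarrow> rpoly list \<Rightarrow> real list \<Rightarrow> real list list \<Rightarrow>
    (real list \<times> real list) list \<Rightarrow> qf_formula" where
  "hull_form WP UP zs es pts = grid_form WP UP zs (acts (product_lists (columns pts es)) zs pts)
     (product_lists (columns pts es)) (columns pts es)"

text \<open>The input serves as its own iteration counter. In positive dimension it has more entries
  than there are points; in dimension 0 all points equal \<open>[]\<close>, and the one iteration
  granted by the entry \<open>n\<close> yields the right set.\<close>

definition read_points :: "nat \<Rightarrow> real list \<Rightarrow> real list list" where
  "read_points d inp = (case inp of [] \<Rightarrow> [] | n # xs \<Rightarrow>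
     snd (snd (fold (\<lambda>_ s. if 0 < fst s then (fst s - 1, drop d (fst (snd s)), snd (snd s) @ [take d (fst (snd s))]) else s)
       inp (n, xs, []))))"

definition points_form :: "rpoly list \<Rightarrow> real list list \<Rightarrow> qf_formula" where
  "points_form vs ps = disj_form (map (\<lambda>p. conj_form (map (\<lambda>e. EqZero (PAdd (snd e) (PConst (0 - fst e)))) (zip p vs))) ps)"

section \<open>Computability of the formula\<close>

context stack_machine
begin

lemma cmp2: "cmp (\<lambda>p. F (fst p) (snd p)) \<Longrightarrow> cmp f \<Longrightarrow> cmp g \<Longrightarrow> cmp (\<lambda>c. F (f c) (g c))"
  using cmp_compose[OF _ cmp_pair, of "\<lambda>p. F (fst p) (snd p)" f g] by simp

lemma cmp3: "cmp (\<lambda>p. F (fst p) (fst (snd p)) (snd (snd p))) \<Longrightarrow> cmp f \<Longrightarrow> cmp g \<Longrightarrow> cmp h \<Longrightarrow>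
    cmp (\<lambda>c. F (f c) (g c) (h c))"
  using cmp_compose[OF _ cmp_pair[OF _ cmp_pair], of "\<lambda>p. F (fst p) (fst (snd p)) (snd (snd p))" f g h] by simp

lemma cmp4: "cmp (\<lambda>p. F (fst p) (fst (snd p)) (fst (snd (snd p))) (snd (snd (snd p)))) \<Longrightarrow>
    cmp f \<Longrightarrow> cmp g \<Longrightarrow> cmp h \<Longrightarrow> cmp k \<Longrightarrow> cmp (\<lambda>c. F (f c) (g c) (h c) (k c))"
  using cmp_compose[OF _ cmp_pair[OF _ cmp_pair[OF _ cmp_pair]],
    of "\<lambda>p. F (fst p) (fst (snd p)) (fst (snd (snd p))) (snd (snd (snd p)))" f g h k] by simp

lemma cmp_ndiff: "cmp f \<Longrightarrow> cmp g \<Longrightarrow> cmp (\<lambda>c. ndiff (f c) (g c))"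
  by (rule cmp2[of ndiff]) (unfold ndiff_def, intro cmp_lists)

lemma cmp_splittable: "cmp f \<Longrightarrow> cmp g \<Longrightarrow> cmp h \<Longrightarrow> cmp (\<lambda>c. splittable (f c) (g c) (h c))"
  by (rule cmp3[of splittable]) (unfold splittable_def, intro cmp_lists cmp_ndiff)

lemma cmp_split: "cmp f \<Longrightarrow> cmp g \<Longrightarrow> cmp h \<Longrightarrow> cmp k \<Longrightarrow> cmp (\<lambda>c. split (f c) (g c) (h c) (k c))"
  by (rule cmp4[of split]) (unfold split_def, intro cmp_lists)

lemma cmp_acts: "cmp f \<Longrightarrow> cmp g \<Longrightarrow> cmp h \<Longrightarrow> cmp (\<lambda>c. acts (f c) (g c) (h c))"
  by (rule cmp3[of acts]) (unfold acts_def, intro cmp_lists cmp_split cmp_splittable)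

lemma cmp_ainc: "cmp f \<Longrightarrow> cmp g \<Longrightarrow> cmp (\<lambda>c. ainc (f c) (g c))"
  by (rule cmp2[of ainc]) (unfold ainc_def, intro cmp_lists)

lemma cmp_chain_step: "cmp f \<Longrightarrow> cmp g \<Longrightarrow> cmp (\<lambda>c. chain_step (f c) (g c))"
  by (rule cmp2[of chain_step]) (unfold chain_step_def, intro cmp_lists)

lemma cmp_chain_lists: "cmp f \<Longrightarrow> cmp g \<Longrightarrow> cmp (\<lambda>c. chain_lists (f c) (g c))"
  by (rule cmp2[of chain_lists]) (unfold chain_lists_def, intro cmp_lists cmp_chain_step)

lemma cmp_boxes: "cmp f \<Longrightarrow> cmp (\<lambda>c. boxes (f c))"
  by (rule cmp_compose[of boxes]) (unfold boxes_def, intro cmp_lists)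

lemma cmp_columns: "cmp f \<Longrightarrow> cmp g \<Longrightarrow> cmp (\<lambda>c. columns (f c) (g c))"
  by (rule cmp2[of columns]) (unfold columns_def, intro cmp_lists)

lemma cmp_column: "cmp f \<Longrightarrow> cmp g \<Longrightarrow> cmp (\<lambda>c. column (f c) (g c))"
  by (rule cmp2[of column]) (unfold column_def, intro cmp_lists cmp_ainc)

lemma cmp_dot: "cmp f \<Longrightarrow> cmp g \<Longrightarrow> cmp (\<lambda>c. dot (f c) (g c))"
  by (rule cmp2[of dot]) (unfold dot_def, intro cmp_lists)

lemma cmp_add_ray: "cmp f \<Longrightarrow> cmp g \<Longrightarrow> cmp h \<Longrightarrow> cmp (\<lambda>c. add_ray (f c) (g c) (h c))"
  by (rule cmp3[of add_ray]) (unfold add_ray_def, intro cmp_lists cmp_dot)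

lemma cmp_add_rays: "cmp f \<Longrightarrow> cmp g \<Longrightarrow> cmp h \<Longrightarrow> cmp k \<Longrightarrow>
    cmp (\<lambda>c. add_rays (f c) (column (g c)) (h c) (k c))"
  by (rule cmp4[of "\<lambda>s g. add_rays s (column g)"])
     (unfold add_rays_def, intro cmp_lists cmp_add_ray cmp_column)

lemma cmp_zero_rows: "cmp f \<Longrightarrow> cmp (\<lambda>c. zero_rows (f c))"
  by (rule cmp_compose[of zero_rows]) (unfold zero_rows_def units_def, intro cmp_lists)

lemma cmp_cone_rows: "cmp f \<Longrightarrow> cmp g \<Longrightarrow> cmp h \<Longrightarrow> cmp k \<Longrightarrow> cmp (\<lambda>c. cone_rows (f c) (g c) (h c) (k c))"
  by (rule cmp4[of cone_rows]) (unfold cone_rows_def, intro cmp_lists cmp_add_rays cmp_zero_rows)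

lemma cmp_hatpoly: "cmp f \<Longrightarrow> cmp g \<Longrightarrow> cmp h \<Longrightarrow> cmp k \<Longrightarrow> cmp (\<lambda>c. hatpoly (f c) (g c) (h c) (k c))"
  by (rule cmp4[of hatpoly]) (unfold hatpoly_def, intro cmp_lists cmp_formulas)

lemma cmp_lampoly: "cmp f \<Longrightarrow> cmp g \<Longrightarrow> cmp h \<Longrightarrow> cmp (\<lambda>c. lampoly (f c) (g c) (h c))"
  by (rule cmp3[of lampoly]) (unfold lampoly_def, intro cmp_lists cmp_formulas cmp_hatpoly)

lemma cmp_nonneg: "cmp f \<Longrightarrow> cmp (\<lambda>c. nonneg (f c))"
  by (rule cmp_compose[of nonneg]) (unfold nonneg_def, intro cmp_lists cmp_formulas)

lemma cmp_conj_form: "cmp f \<Longrightarrow> cmp (\<lambda>c. conj_form (f c))"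
  by (rule cmp_compose[of conj_form]) (unfold conj_form_def, intro cmp_lists cmp_formulas)

lemma cmp_disj_form: "cmp f \<Longrightarrow> cmp (\<lambda>c. disj_form (f c))"
  by (rule cmp_compose[of disj_form]) (unfold disj_form_def, intro cmp_lists cmp_formulas)

lemma cmp_boxform: "cmp f \<Longrightarrow> cmp g \<Longrightarrow> cmp (\<lambda>c. boxform (f c) (g c))"
  by (rule cmp2[of boxform]) (unfold boxform_def, intro cmp_lists cmp_formulas cmp_conj_form cmp_nonneg)

lemma cmp_dotpoly: "cmp f \<Longrightarrow> cmp g \<Longrightarrow> cmp (\<lambda>c. dotpoly (f c) (g c))"
  by (rule cmp2[of dotpoly]) (unfold dotpoly_def, intro cmp_lists cmp_formulas)

lemma cmp_rowform: "cmp f \<Longrightarrow> cmp g \<Longrightarrow> cmp (\<lambda>c. rowform (f c) (g c))"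
  by (rule cmp2[of rowform]) (unfold rowform_def, intro cmp_lists cmp_formulas cmp_nonneg cmp_dotpoly)

lemma cmp_cell_form:
  assumes "cmp WP" "cmp UP" "cmp f" "cmp g" "cmp h"
  shows "cmp (\<lambda>c. cell_form (WP c) (UP c) (f c) (g c) (h c))"
proof -
  let ?F = "\<lambda>p. cell_form (fst (fst p)) (snd (fst p)) (fst (snd p)) (fst (snd (snd p))) (snd (snd (snd p)))"
  have "cmp ?F"
    unfolding cell_form_def by (intro cmp_lists cmp_formulas cmp_boxform cmp_conj_form cmp_rowform cmp_lampoly)
  from cmp_compose[OF this, of "\<lambda>c. ((WP c, UP c), f c, g c, h c)"] show ?thesis
    using assms by (simp add: cmp_pair)
qed

lemma cmp_grid_form:
  assumes "cmp WP" "cmp UP" "cmp zs" "cmp f" "cmp g" "cmp h"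
  shows "cmp (\<lambda>c. grid_form (WP c) (UP c) (zs c) (f c) (g c) (h c))"
proof -
  let ?F = "\<lambda>p. grid_form (fst (fst p)) (fst (snd (fst p))) (snd (snd (fst p))) (fst (snd p)) (fst (snd (snd p))) (snd (snd (snd p)))"
  have "cmp ?F"
    unfolding grid_form_def by (intro cmp_lists cmp_disj_form cmp_cell_form cmp_cone_rows cmp_chain_lists cmp_boxes)
  from cmp_compose[OF this, of "\<lambda>c. ((WP c, UP c, zs c), f c, g c, h c)"] show ?thesis
    using assms by (simp add: cmp_pair)
qed

lemma cmp_hull_form:
  assumes "cmp WP" "cmp UP" "cmp zs" "cmp es" "cmp f"
  shows "cmp (\<lambda>c. hull_form (WP c) (UP c) (zs c) (es c) (f c))"
  unfolding hull_form_def
  by (intro cmp_grid_form cmp_acts cmp_product_lists cmp_columns assms)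

text \<open>\<open>d\<close> is a fixed number, and a separate program is built for each
  \<open>d\<close> by induction.\<close>

lemma cmp_take:
  fixes f :: "'b::repr \<Rightarrow> 'a::repr list"
  shows "cmp f \<Longrightarrow> cmp (\<lambda>c. take d (f c))"
proof (rule cmp_compose[of "take d"])
  show "cmp (take d :: 'a list \<Rightarrow> 'a list)"
  proof (induction d)
    case (Suc d)
    have "cmp (\<lambda>c. case c of [] \<Rightarrow> [] | (y :: 'a) # ys \<Rightarrow> y # take d ys)"
      by (intro cmp_basic cmp_compose[OF Suc])
    moreover have "(\<lambda>c. case c of [] \<Rightarrow> [] | (y :: 'a) # ys \<Rightarrow> y # take d ys) = take (Suc d)"
      by (auto simp: fun_eq_iff split: list.split)
    ultimately show ?case by simp
  qed (simp add: cmp_Nil)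
qed

lemma cmp_drop:
  fixes f :: "'b::repr \<Rightarrow> 'a::repr list"
  shows "cmp f \<Longrightarrow> cmp (\<lambda>c. drop d (f c))"
proof (rule cmp_compose[of "drop d"])
  show "cmp (drop d :: 'a list \<Rightarrow> 'a list)"
  proof (induction d)
    case (Suc d)
    have "cmp (\<lambda>c. case c of [] \<Rightarrow> [] | (y :: 'a) # ys \<Rightarrow> drop d ys)"
      by (intro cmp_basic cmp_compose[OF Suc])
    moreover have "(\<lambda>c. case c of [] \<Rightarrow> [] | (y :: 'a) # ys \<Rightarrow> drop d ys) = drop (Suc d)"
      by (auto simp: fun_eq_iff split: list.split)
    ultimately show ?case by simp
  qed (simp add: cmp_id)
qed

lemma cmp_read_points: "cmp (read_points d)"
  unfolding read_points_def by (intro cmp_lists cmp_take cmp_drop)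

lemma cmp_points_form: "cmp f \<Longrightarrow> cmp g \<Longrightarrow> cmp (\<lambda>c. points_form (f c) (g c))"
  by (rule cmp2[of points_form])
     (unfold points_form_def, intro cmp_lists cmp_formulas cmp_conj_form cmp_disj_form)

lemma cmp_const_list: "(\<And>x. x \<in> set xs \<Longrightarrow> cmp (\<lambda>c :: 'b::repr. x)) \<Longrightarrow> cmp (\<lambda>c :: 'b. xs)"
proof (induction xs)
  case (Cons x xs)
  show ?case by (rule cmp_Cons) (use Cons in auto)
qed (rule cmp_Nil)

end

section \<open>Truth and variables of the formula\<close>

lemma holds_conj_form: "holds (conj_form fs) x \<longleftrightarrow> (\<forall>f\<in>set fs. holds f x)"
  by (induction fs) (auto simp: conj_form_def)

lemma holds_disj_form: "holds (disj_form fs) x \<longleftrightarrow> (\<exists>f\<in>set fs. holds f x)"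
  by (induction fs) (auto simp: disj_form_def)

lemma vars_conj_form: "formula_vars (conj_form fs) = (\<Union>f\<in>set fs. formula_vars f)"
  by (induction fs) (auto simp: conj_form_def)

lemma vars_disj_form: "formula_vars (disj_form fs) = (\<Union>f\<in>set fs. formula_vars f)"
  by (induction fs) (auto simp: disj_form_def)

lemma holds_nonneg: "holds (nonneg p) x \<longleftrightarrow> 0 \<le> poly_val p x"
  by (auto simp: nonneg_def)

lemma vars_nonneg: "formula_vars (nonneg p) = poly_vars p"
  by (simp add: nonneg_def)

lemma val_hatpoly: "poly_val (hatpoly l h W g) x = hatp l h (poly_val W x) g"
  by (simp add: hatpoly_def hatp_def)

lemma val_lampoly: "poly_val (lampoly B WP a) x = lam B (map (\<lambda>p. poly_val p x) WP) a"
proof (induction B arbitrary: WP a)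
  case Nil
  then show ?case by (simp add: lampoly_def)
next
  case (Cons b B)
  show ?case
  proof (cases "WP = [] \<or> a = []")
    case True
    then show ?thesis by (auto simp: lampoly_def lam_def)
  next
    case False
    then obtain W WP' g a' where "WP = W # WP'" "a = g # a'" by (metis list.exhaust)
    then show ?thesis using Cons[of WP' a'] by (simp add: lampoly_def val_hatpoly)
  qed
qed

lemma vars_lampoly: "poly_vars (lampoly B WP a) \<subseteq> (\<Union>p\<in>set WP. poly_vars p)"
proof -
  have "poly_vars (foldr (\<lambda>e r. PMul (hatpoly (fst (fst e)) (snd (fst e)) (fst (snd e)) (snd (snd e))) r) es (PConst 1))
      \<subseteq> (\<Union>e\<in>set es. poly_vars (fst (snd e)))" for es :: "((real \<times> real) \<times> rpoly \<times> real) list"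
    by (induction es) (auto simp: hatpoly_def split: if_splits)
  from this[of "zip B (zip WP a)"] show ?thesis
    unfolding lampoly_def by (fastforce dest: set_zip_rightD set_zip_leftD in_set_zipE)
qed

lemma val_dotpoly: "poly_val (dotpoly r Y) x = dot r (map (\<lambda>p. poly_val p x) Y)"
proof (induction r arbitrary: Y)
  case (Cons a r)
  then show ?case by (cases Y) (auto simp: dotpoly_def dot_def)
qed (simp add: dotpoly_def)

lemma vars_dotpoly: "poly_vars (dotpoly r Y) \<subseteq> (\<Union>p\<in>set Y. poly_vars p)"
proof -
  have "poly_vars (foldr (\<lambda>e q. PAdd (PMul (PConst (fst e)) (snd e)) q) es (PConst 0)) \<subseteq>
      (\<Union>e\<in>set es. poly_vars (snd e))" for es :: "(real \<times> rpoly) list"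
    by (induction es) auto
  from this[of "zip r Y"] show ?thesis
    unfolding dotpoly_def by (fastforce dest: set_zip_rightD set_zip_leftD)
qed

lemma holds_boxform: "holds (boxform B WP) x \<longleftrightarrow> in_box B (map (\<lambda>p. poly_val p x) WP)"
  by (auto simp: boxform_def holds_conj_form holds_nonneg in_box_def list_all_iff zip_map2)

lemma holds_rowforms: "(\<forall>r\<in>set R. holds (rowform Y r) x) \<longleftrightarrow> sat R (map (\<lambda>p. poly_val p x) Y)"
  unfolding sat_def rowform_def by (intro ball_cong) (auto simp: holds_nonneg val_dotpoly)

lemma holds_cell_form:
  "holds (cell_form WP UP grid B R) x \<longleftrightarrow> in_box B (map (\<lambda>p. poly_val p x) WP) \<and>
     sat R (map (\<lambda>a. - lam B (map (\<lambda>p. poly_val p x) WP) a) grid @ map (\<lambda>p. poly_val p x) UP)"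
  by (simp add: cell_form_def holds_boxform holds_conj_form holds_rowforms val_lampoly o_def)

lemma vars_cell_form:
  assumes "\<And>p. p \<in> set WP \<union> set UP \<Longrightarrow> poly_vars p \<subseteq> D"
  shows "formula_vars (cell_form WP UP grid B R) \<subseteq> D"
proof -
  have "formula_vars (boxform B WP) \<subseteq> D"
    using assms by (fastforce simp: boxform_def vars_conj_form vars_nonneg dest: set_zip_rightD)
  moreover have "formula_vars (rowform (map (\<lambda>a. PMul (PConst (- 1)) (lampoly B WP a)) grid @ UP) r) \<subseteq> D" for r
  proof -
    have "formula_vars (rowform Y r) \<subseteq> (\<Union>p\<in>set Y. poly_vars p)" for Y
      using vars_dotpoly by (auto simp: rowform_def vars_nonneg)
    moreover have "poly_vars (lampoly B WP a) \<subseteq> D" for a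
      using vars_lampoly[of B WP a] assms by blast
    ultimately show ?thesis using assms by fastforce
  qed
  ultimately show ?thesis by (auto simp: cell_form_def vars_conj_form)
qed

lemma vars_hull_form:
  assumes "\<And>p. p \<in> set WP \<union> set UP \<Longrightarrow> poly_vars p \<subseteq> D"
  shows "formula_vars (hull_form WP UP zs es pts) \<subseteq> D"
proof -
  have "formula_vars (cell_form WP UP g B R) \<subseteq> D" for g B R
    by (rule vars_cell_form) (rule assms)
  then show ?thesis by (auto simp: hull_form_def grid_form_def vars_disj_form)
qed

lemma set_boxes: "set (boxes Xs) = {B. list_all2 (\<lambda>b X. fst b \<in> set X \<and> snd b \<in> set X) B Xs}"
proof -
  have "b \<in> set (concat (map (\<lambda>l. map (\<lambda>h. (l, h)) X) X)) \<longleftrightarrow> fst b \<in> set X \<and> snd b \<in> set X"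
    for b and X :: "real list"
    by (cases b) auto
  then show ?thesis by (simp only: boxes_def product_lists_set list_all2_map2)
qed

lemma columns_props:
  assumes "\<And>p. p \<in> set pts \<Longrightarrow> length (fst p) = k"
  shows "length (columns pts (replicate k [])) = k \<and>
    (\<forall>i<k. columns pts (replicate k []) ! i = map (\<lambda>p. fst p ! i) pts)"
  using assms
proof (induction pts)
  case (Cons p pts)
  then show ?case by (simp add: columns_def)
qed (simp add: columns_def)

lemma points_in_grid:
  assumes "\<And>p. p \<in> set pts \<Longrightarrow> length (fst p) = k" "p \<in> set pts"
  shows "fst p \<in> set (product_lists (columns pts (replicate k [])))"
proof -
  have "list_all2 (\<lambda>w X. w \<in> set X) (fst p) (columns pts (replicate k []))"
    using columns_props[of pts k, OF assms(1)] assms by (auto simp: list_all2_conv_all_nth)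
  then show ?thesis by (simp add: product_lists_set)
qed

lemma list_ex_amid: "list_ex (\<lambda>\<sigma>. amid \<sigma> = a) L \<longleftrightarrow> a \<in> amid ` set L"
  by (induction L) auto

section \<open>Certificates as membership in a cone\<close>

context net
begin

lemma chain_step_iff: "\<tau> \<in> Act \<Longrightarrow> chain_step \<tau> L \<longleftrightarrow> (\<forall>a. 0 < ainc \<tau> a \<longrightarrow> a \<in> amid ` set L)"
proof -
  assume "\<tau> \<in> Act"
  from ends_eq[OF this] have "(\<forall>a. 0 < ainc \<tau> a \<longrightarrow> a \<in> amid ` set L) \<longleftrightarrow> fst ` set (aends \<tau>) \<subseteq> amid ` set L"
    by auto
  then show ?thesis by (auto simp: chain_step_def list_all_iff list_ex_amid)
qed

lemma set_chain_lists: "set (chain_lists xs (acts (product_lists Xs) zs pts)) =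
    {L. chain L \<and> set L \<subseteq> Act \<and> length L \<le> length xs}"
proof -
  let ?A = "acts (product_lists Xs) zs pts"
  let ?step = "\<lambda>_ Ls. Ls @ concat (map (\<lambda>L. map (\<lambda>\<tau>. \<tau> # L) (filter (\<lambda>\<tau>. chain_step \<tau> L) ?A)) Ls)"
  have "set (fold ?step xs Ls) = {L. chain L \<and> set L \<subseteq> Act \<and> length L \<le> n + length xs}"
    if "set Ls = {L. chain L \<and> set L \<subseteq> Act \<and> length L \<le> n}" for n Ls
    using that
  proof (induction xs arbitrary: n Ls)
    case (Cons x xs)
    have "set (?step x Ls) = {L. chain L \<and> set L \<subseteq> Act \<and> length L \<le> Suc n}" (is "_ = ?R")
    proof (rule Set.set_eqI)
      fix L show "L \<in> set (?step x Ls) \<longleftrightarrow> L \<in> ?R"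
        using Cons.prems by (cases L) (auto simp: chain_step_iff)
    qed
    from Cons.IH[OF this] show ?case by simp
  qed simp
  moreover have "set [[]] = {L. chain L \<and> set L \<subseteq> Act \<and> length L \<le> 0}" by auto
  ultimately have "set (fold ?step xs [[]]) = {L. chain L \<and> set L \<subseteq> Act \<and> length L \<le> 0 + length xs}"
    by blast
  then show ?thesis unfolding chain_lists_def by simp
qed

lemma length_distinct_chain:
  assumes "distinct (map amid L)" "set L \<subseteq> Act"
  shows "length L \<le> length (product_lists Xs)"
proof -
  have "length L = card (amid ` set L)" using assms(1) by (metis distinct_card length_map set_map)
  also have "\<dots> \<le> card V" using assms(2) amid_V by (intro card_mono) auto
  also have "\<dots> \<le> length (product_lists Xs)" by (rule card_length)
  finally show ?thesis .
qed

text \<open>The first entries of the vector express conservation at the places, which accounts for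
  the sign of \<open>- lam\<close>. The last \<open>m\<close> entries compare payouts, where
  \<open>inj\<close> passes from vectors to coordinates.\<close>

lemma cone_certificate:
  fixes b :: "nat \<Rightarrow> 'v"
  assumes vec: "\<And>u. vec u = (\<Sum>i<m. u ! i *\<^sub>R b i)"
    and inj: "\<And>c d i. (\<Sum>i<m. c i *\<^sub>R b i) = (\<Sum>i<m. d i *\<^sub>R b i) \<Longrightarrow> i < m \<Longrightarrow> c i = (d i :: real)"
    and len: "length zs = m" "\<And>p. p \<in> set pts \<Longrightarrow> length (snd p) = m" "length u = m"
    and L: "chain L" "set L \<subseteq> Act" and B: "B \<in> set (boxes Xs)" "in_box B w"
  shows "sat (cone_rows (product_lists Xs) zs (acts (product_lists Xs) zs pts) L)
      (map (\<lambda>a. - lam B w a) (product_lists Xs) @ u) \<longleftrightarrow> (\<exists>z. certificate w (vec u) B L z)"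
proof -
  let ?g = "product_lists Xs"
  let ?A = "acts ?g zs pts"
  let ?A' = "filter (\<lambda>\<tau>. list_ex (\<lambda>\<sigma>. amid \<sigma> = amid \<tau>) L) ?A"
  let ?y = "map (\<lambda>a. - lam B w a) ?g @ u"
  have A': "set ?A' = {\<tau>\<in>Act. amid \<tau> \<in> amid ` set L}" by (auto simp: list_ex_amid)
  have pay: "length (apay \<tau>) = m" if "\<tau> \<in> Act" for \<tau>
    using that len by (cases rule: Act_cases) (auto simp: split_def)
  have "sat (cone_rows ?g zs ?A L) ?y \<longleftrightarrow>
    (\<exists>z. (\<forall>t. 0 \<le> z t) \<and> (\<forall>t. 0 < z t \<longrightarrow> t \<in> set ?A') \<and> (\<forall>t\<in>set L. 0 < z t) \<and>
      (\<forall>i<length (map (\<lambda>_. 0 :: real) ?g @ zs). ?y ! i = (\<Sum>t\<in>set ?A'. z t * column ?g t ! i)))"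
    unfolding cone_rows_def using pay L len by (intro sat_cone) (auto simp: column_def list_ex_amid)
  also have "\<dots> \<longleftrightarrow> (\<exists>z. certificate w (vec u) B L z)"
  proof (rule ex_cong1)
    fix z :: "action \<Rightarrow> real"
    show "(\<forall>t. 0 \<le> z t) \<and> (\<forall>t. 0 < z t \<longrightarrow> t \<in> set ?A') \<and> (\<forall>t\<in>set L. 0 < z t) \<and>
      (\<forall>i<length (map (\<lambda>_. 0 :: real) ?g @ zs). ?y ! i = (\<Sum>t\<in>set ?A'. z t * column ?g t ! i)) \<longleftrightarrow>
      certificate w (vec u) B L z" (is "?P \<and> ?Q \<and> ?R \<and> ?S \<longleftrightarrow> _")
    proof -
      have B1: "list_all2 (\<lambda>b X. fst b \<in> set X \<and> snd b \<in> set X) B Xs" using B(1) by (simp add: set_boxes)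
      have cert: "certificate w (vec u) B L z \<longleftrightarrow>
          ?P \<and> ?Q \<and> ?R \<and> (\<forall>a\<in>V. lam B w a + eff z a = 0) \<and> payoff z = vec u"
        unfolding certificate_def A' by (simp only: B1 B(2) L simp_thms mem_Collect_eq)
      have S: "?S \<longleftrightarrow> (\<forall>a\<in>V. lam B w a + eff z a = 0) \<and> payoff z = vec u" if "?P \<and> ?Q"
      proof -
      from that have P: "0 \<le> z t" and Q: "0 < z t \<Longrightarrow> t \<in> set ?A'" for t by blast+
      have ext: "(\<Sum>t\<in>set ?A'. z t * f t) = (\<Sum>t\<in>Act. z t * f t)" for f
      proof (rule sum.mono_neutral_left)
        show "\<forall>t\<in>Act - set ?A'. z t * f t = 0"
        proof
          fix t assume "t \<in> Act - set ?A'"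
          then have "z t = 0" using P[of t] Q[of t] by (auto simp: order.order_iff_strict)
          then show "z t * f t = 0" by simp
        qed
      qed (auto simp: A')
      have "?S \<longleftrightarrow> (\<forall>i<length ?g. - lam B w (?g ! i) = eff z (?g ! i)) \<and>
          (\<forall>i<m. u ! i = (\<Sum>t\<in>Act. z t * apay t ! i))"
      proof -
        have 1: "?y ! i = (\<Sum>t\<in>set ?A'. z t * column ?g t ! i) \<longleftrightarrow> - lam B w (?g ! i) = eff z (?g ! i)"
          if "i < length ?g" for i
          using that unfolding ext by (simp add: column_def nth_append eff_def)
        have 2: "?y ! (length ?g + i) = (\<Sum>t\<in>set ?A'. z t * column ?g t ! (length ?g + i)) \<longleftrightarrow>
            u ! i = (\<Sum>t\<in>Act. z t * apay t ! i)" for i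
          unfolding ext by (simp add: column_def nth_append)
        have 3: "(\<forall>i<n + m. T i) \<longleftrightarrow> (\<forall>i<n. T i) \<and> (\<forall>i<m. T (n + i))" for n T
          by (metis add_diff_inverse_nat nat_add_left_cancel_less trans_less_add1)
        show ?thesis using 1 2 by (simp add: len(1) 3)
      qed
      also have "(\<forall>i<length ?g. - lam B w (?g ! i) = eff z (?g ! i)) \<longleftrightarrow> (\<forall>a\<in>V. lam B w a + eff z a = 0)"
        by (simp add: all_set_conv_all_nth add_eq_0_iff eq_commute[of "- lam _ _ _"])
      also have "(\<forall>i<m. u ! i = (\<Sum>t\<in>Act. z t * apay t ! i)) \<longleftrightarrow> payoff z = vec u"
      proof -
        have "payoff z = (\<Sum>i<m. (\<Sum>t\<in>Act. z t * apay t ! i) *\<^sub>R b i)"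
          unfolding payoff_def vec by (simp add: scaleR_sum_right scaleR_sum_left) (rule sum.swap)
        then have "payoff z = vec u \<longleftrightarrow> (\<Sum>i<m. u ! i *\<^sub>R b i) = (\<Sum>i<m. (\<Sum>t\<in>Act. z t * apay t ! i) *\<^sub>R b i)"
          unfolding vec[of u] by (simp only:) (rule eq_commute)
        also have "\<dots> \<longleftrightarrow> (\<forall>i<m. u ! i = (\<Sum>t\<in>Act. z t * apay t ! i))"
        proof
          assume "(\<Sum>i<m. u ! i *\<^sub>R b i) = (\<Sum>i<m. (\<Sum>t\<in>Act. z t * apay t ! i) *\<^sub>R b i)"
          from inj[OF this] show "\<forall>i<m. u ! i = (\<Sum>t\<in>Act. z t * apay t ! i)" by blast
        next
          assume "\<forall>i<m. u ! i = (\<Sum>t\<in>Act. z t * apay t ! i)"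
          then have "u ! i *\<^sub>R b i = (\<Sum>t\<in>Act. z t * apay t ! i) *\<^sub>R b i" if "i \<in> {..<m}" for i
            using that by (simp only: lessThan_iff)
          then show "(\<Sum>i<m. u ! i *\<^sub>R b i) = (\<Sum>i<m. (\<Sum>t\<in>Act. z t * apay t ! i) *\<^sub>R b i)"
            by (rule sum.cong[OF HOL.refl])
        qed
        finally show ?thesis by (rule sym)
      qed
      finally show ?thesis .
      qed
      have "(p \<and> q \<Longrightarrow> s = t) \<Longrightarrow> (p \<and> q \<and> r \<and> s) = (p \<and> q \<and> r \<and> t)" for p q r s t by blast
      from this[OF S] show ?thesis unfolding cert .
    qed
  qed
  finally show ?thesis .
qed

end

section \<open>Coordinates\<close>

lemma det_in_field:
  fixes A :: "real mat"
  assumes K: "0 \<in> K" "1 \<in> K" "\<And>x y. x \<in> K \<Longrightarrow> y \<in> K \<Longrightarrow> x + y \<in> K" "\<And>x y. x \<in> K \<Longrightarrow> y \<in> K \<Longrightarrow> x - y \<in> K"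
    "\<And>x y. x \<in> K \<Longrightarrow> y \<in> K \<Longrightarrow> x * y \<in> K"
    and A: "A \<in> carrier_mat n n" "\<And>i j. i < n \<Longrightarrow> j < n \<Longrightarrow> A $$ (i, j) \<in> K"
  shows "det A \<in> K"
proof -
  have sum: "(\<And>i. i \<in> I \<Longrightarrow> f i \<in> K) \<Longrightarrow> sum f I \<in> K" for f :: "(nat \<Rightarrow> nat) \<Rightarrow> real" and I
    by (induction I rule: infinite_finite_induct) (auto intro: K)
  have prod: "(\<And>i. i \<in> I \<Longrightarrow> f i \<in> K) \<Longrightarrow> prod f I \<in> K" for f :: "nat \<Rightarrow> real" and I
    by (induction I rule: infinite_finite_induct) (auto intro: K)
  have "- 1 \<in> K" using K(4)[OF K(1,2)] by simp
  then have sign: "(signof p :: real) \<in> K" for p :: "nat \<Rightarrow> nat" using K(2) by (auto simp: sign_def)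
  show ?thesis
    unfolding det_def'[OF A(1)]
  proof (intro sum K(5) sign prod)
    fix p i assume "p \<in> {p. p permutes {0..<n}}" "i \<in> {0..<n}"
    then show "A $$ (i, p i) \<in> K" using A(2) permutes_in_image[of p "{0..<n}" i] by auto
  qed
qed

text \<open>Cramer's rule, with determinants treated by the Leibniz formula in
  \<open>det_in_field\<close>. It is applied to the field of numbers computable from the permitted
  constants.\<close>

lemma left_inverse_in_field:
  fixes M R :: "nat \<Rightarrow> nat \<Rightarrow> real"
  assumes K: "0 \<in> K" "1 \<in> K" "\<And>x y. x \<in> K \<Longrightarrow> y \<in> K \<Longrightarrow> x + y \<in> K" "\<And>x y. x \<in> K \<Longrightarrow> y \<in> K \<Longrightarrow> x - y \<in> K"
    "\<And>x y. x \<in> K \<Longrightarrow> y \<in> K \<Longrightarrow> x * y \<in> K" "\<And>x y. x \<in> K \<Longrightarrow> y \<in> K \<Longrightarrow> x / y \<in> K"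
    and M: "\<And>i j. i < n \<Longrightarrow> j < n \<Longrightarrow> M i j \<in> K"
    and RM: "\<And>i j. i < n \<Longrightarrow> j < n \<Longrightarrow> (\<Sum>l<n. R i l * M l j) = (if i = j then 1 else 0)"
    and ij: "i < n" "j < n"
  shows "R i j \<in> K"
proof -
  define A where "A = mat n n (\<lambda>(i, j). M i j)"
  define B where "B = mat n n (\<lambda>(i, j). R i j)"
  have carr: "A \<in> carrier_mat n n" "B \<in> carrier_mat n n" by (auto simp: A_def B_def)
  have BA: "B * A = 1\<^sub>m n"
    by (rule eq_matI) (auto simp: A_def B_def scalar_prod_def RM atLeast0LessThan)
  have "det B * det A = 1" using det_mult[OF carr(2,1)] BA by simp
  then have d0: "det A \<noteq> 0" by auto
  note adj = adj_mat[OF carr(1)]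
  have "adj_mat A = (B * A) * adj_mat A" using adj(1) BA by simp
  also have "\<dots> = B * (A * adj_mat A)" using carr adj(1) by (intro assoc_mult_mat) auto
  also have "\<dots> = det A \<cdot>\<^sub>m B" using carr by (simp add: adj(2) mult_smult_distrib[OF carr(2) one_carrier_mat])
  finally have "adj_mat A $$ (i, j) = det A * R i j" using ij by (simp add: B_def)
  then have R: "R i j = adj_mat A $$ (i, j) / det A" using d0 by simp
  have "det (mat_delete A j i) \<in> K"
  proof (rule det_in_field[OF K(1-5)])
    show "mat_delete A j i \<in> carrier_mat (n - 1) (n - 1)" using carr(1) by (rule mat_delete_carrier)
    fix i' j' assume "i' < n - 1" "j' < n - 1"
    then show "mat_delete A j i $$ (i', j') \<in> K"
      using M by (auto simp: mat_delete_def A_def)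
  qed
  moreover have "(- 1 :: real) ^ l \<in> K" for l
  proof (induction l)
    case (Suc l)
    then show ?case using K(5)[OF K(4)[OF K(1,2)] Suc] by simp
  qed (simp add: K(2))
  ultimately have "adj_mat A $$ (i, j) \<in> K"
    using ij carr by (auto simp: adj_mat_def cofactor_def intro: K(5))
  moreover have "det A \<in> K" using carr M by (intro det_in_field[OF K(1-5)]) (auto simp: A_def)
  ultimately show ?thesis unfolding R by (intro K(6))
qed

lemma length_coords [simp]: "length (coords bs v) = length bs"
  by (simp add: coords_def)

lemma list_basis_expand:
  assumes "list_basis bs X" "v \<in> X"
  shows "v = (\<Sum>i<length bs. coords bs v ! i *\<^sub>R bs ! i)"
proof -
  have "v = (\<Sum>b\<in>set bs. representation (set bs) v b *\<^sub>R b)"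
    using assms by (intro sum_representation_eq[symmetric]) (auto simp: list_basis_def)
  also have "\<dots> = (\<Sum>i<length bs. representation (set bs) v (bs ! i) *\<^sub>R bs ! i)"
    using assms by (intro sum.reindex_bij_betw[symmetric] bij_betw_nth) (auto simp: list_basis_def)
  finally show ?thesis by (simp add: coords_def)
qed

lemma coords_sum:
  assumes "list_basis bs X" "j < length bs"
  shows "coords bs (\<Sum>i<length bs. c i *\<^sub>R bs ! i) ! j = c j"
proof -
  have ind: "independent (set bs)" "distinct bs" using assms by (auto simp: list_basis_def)
  have mem: "c i *\<^sub>R bs ! i \<in> span (set bs)" if "i \<in> {..<length bs}" for i
    using that by (intro span_scale span_base) simp
  have "representation (set bs) (\<Sum>i<length bs. c i *\<^sub>R bs ! i) =
      (\<lambda>b. \<Sum>i<length bs. representation (set bs) (c i *\<^sub>R bs ! i) b)"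
    by (rule representation_sum[OF ind(1)]) (rule mem)
  then have "coords bs (\<Sum>i<length bs. c i *\<^sub>R bs ! i) ! j =
      (\<Sum>i<length bs. representation (set bs) (c i *\<^sub>R bs ! i) (bs ! j))"
    using assms(2) by (simp add: coords_def)
  also have "\<dots> = (\<Sum>i<length bs. if i = j then c i else 0)"
  proof (rule sum.cong)
    fix i assume i: "i \<in> {..<length bs}"
    have "representation (set bs) (c i *\<^sub>R bs ! i) (bs ! j) = c i * representation (set bs) (bs ! i) (bs ! j)"
      using i by (simp add: representation_scale[OF ind(1)] span_base)
    then show "representation (set bs) (c i *\<^sub>R bs ! i) (bs ! j) = (if i = j then c i else 0)"
      using i assms(2) ind(2) by (simp add: representation_basis[OF ind(1)] nth_eq_iff_index_eq)
  qed simp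
  also have "\<dots> = c j" using assms(2) by simp
  finally show ?thesis .
qed

lemma coords_lincomb:
  assumes "list_basis bs UNIV" "j < length bs"
  shows "coords bs (\<Sum>i\<in>I. c i *\<^sub>R f i) ! j = (\<Sum>i\<in>I. c i * coords bs (f i) ! j)"
proof -
  have ind: "independent (set bs)" and sp: "\<And>v. v \<in> span (set bs)" using assms by (auto simp: list_basis_def)
  show ?thesis using assms(2)
    by (simp add: coords_def representation_sum[OF ind sp] representation_scale[OF ind sp])
qed

lemma coords_mix:
  assumes "list_basis bs UNIV" "j < length bs"
  shows "coords bs (t *\<^sub>R x + s *\<^sub>R y) ! j = t * coords bs x ! j + s * coords bs y ! j"
proof -
  have ind: "independent (set bs)" and sp: "\<And>v. v \<in> span (set bs)" using assms by (auto simp: list_basis_def)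
  show ?thesis using assms(2)
    by (simp add: coords_def representation_add[OF ind sp sp] representation_scale[OF ind sp])
qed

lemma coords_inject: "list_basis bs UNIV \<Longrightarrow> coords bs x = coords bs y \<Longrightarrow> x = y"
  using list_basis_expand[of bs UNIV x] list_basis_expand[of bs UNIV y] by simp

lemma list_basis_length:
  assumes "list_basis bs X" "list_basis es X"
  shows "length bs = length es"
proof -
  have "length bs = dim X" if "list_basis bs X" for bs :: "'a list"
    using that unfolding list_basis_def by (metis dim_span_eq_card_independent distinct_card)
  then show ?thesis using assms by simp
qed

lemma list_basisI:
  fixes e :: "nat \<Rightarrow> 'v::real_vector"
  assumes sp: "\<And>v. \<exists>c. v = (\<Sum>i<n. c i *\<^sub>R e i)"
    and ind: "\<And>c i. (\<Sum>i<n. c i *\<^sub>R e i) = 0 \<Longrightarrow> i < n \<Longrightarrow> c i = 0"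
  shows "list_basis (map e [0..<n]) UNIV"
proof -
  have inj: "inj_on e {..<n}"
  proof (rule inj_onI)
    fix i j assume ij: "i \<in> {..<n}" "j \<in> {..<n}" "e i = e j"
    define c where "c l = (if l = i then 1 else 0) - (if l = j then 1 else (0::real))" for l
    have "(\<Sum>l<n. c l *\<^sub>R e l) = (\<Sum>l<n. if l = i then e l else 0) - (\<Sum>l<n. if l = j then e l else 0)"
      unfolding sum_subtractf[symmetric] by (intro sum.cong) (auto simp: c_def)
    then have "(\<Sum>l<n. c l *\<^sub>R e l) = 0" using ij by simp
    from ind[OF this, of i] ij show "i = j" by (auto simp: c_def split: if_splits)
  qed
  have set: "set (map e [0..<n]) = e ` {..<n}" by auto
  have "independent (e ` {..<n})"
  proof (rule ccontr)
    assume "\<not> independent (e ` {..<n})"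
    then obtain u where u: "\<exists>v\<in>e ` {..<n}. u v \<noteq> 0" "(\<Sum>v\<in>e ` {..<n}. u v *\<^sub>R v) = 0"
      by (auto simp: dependent_finite)
    then have "(\<Sum>i<n. u (e i) *\<^sub>R e i) = 0" by (simp add: sum.reindex[OF inj])
    from ind[OF this] u(1) show False by auto
  qed
  moreover have "v \<in> span (e ` {..<n})" for v
  proof -
    obtain c where "v = (\<Sum>i<n. c i *\<^sub>R e i)" using sp by blast
    then show ?thesis by (simp only:) (intro span_sum span_scale span_base, auto)
  qed
  moreover have "distinct (map e [0..<n])" using inj by (simp add: distinct_map atLeast0LessThan)
  ultimately show ?thesis unfolding list_basis_def set by auto
qed

lemma sum_split: "(\<Sum>i<k + m. f i) = (\<Sum>i<k. f i) + (\<Sum>i<(m::nat). f (k + i))"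
  by (induction m) (auto simp: add.assoc)

text \<open>Existence of decompositions gives spanning, and uniqueness for the vector 0 gives
  independence. The lines come first, so the position of a vector consists of its first
  \<open>k\<close> coordinates.\<close>

lemma decomposition_basis:
  fixes U :: "'v::real_vector set" and W :: "nat \<Rightarrow> 'v set"
  assumes dec: "direct_sum_decomposition U W k" and us: "list_basis us U"
    and w: "\<And>i. i \<in> {1..k} \<Longrightarrow> list_basis [w i] (W i)"
  shows "list_basis (map (\<lambda>i. if i < k then w (Suc i) else us ! (i - k)) [0..<k + length us]) UNIV"
proof (rule list_basisI)
  let ?e = "\<lambda>i. if i < k then w (Suc i) else us ! (i - k)"
  have U: "subspace U" and W: "\<And>i. i \<in> {1..k} \<Longrightarrow> subspace (W i)"
    and uni: "\<And>v. \<exists>!p. fst p \<in> U \<and> snd p \<in> PiE {1..k} W \<and> v = fst p + (\<Sum>i=1..k. snd p i)"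
    using dec by (auto simp: direct_sum_decomposition_def)
  have sp: "(\<Sum>i<k + length us. c i *\<^sub>R ?e i) = (\<Sum>i<k. c i *\<^sub>R w (Suc i)) + (\<Sum>j<length us. c (k + j) *\<^sub>R us ! j)" for c
    unfolding sum_split by simp
  have shift: "(\<Sum>i=1..k. f i) = (\<Sum>i<k. f (Suc i))" for f :: "nat \<Rightarrow> 'v"
    by (simp add: sum.atLeast1_atMost_eq lessThan_atLeast0)
  have Wmem: "W i = {a *\<^sub>R w i | a. True}" if "i \<in> {1..k}" for i
    using w[OF that] by (auto simp: list_basis_def span_singleton)
  fix v :: 'v
  obtain p where p: "fst p \<in> U" "snd p \<in> PiE {1..k} W" "v = fst p + (\<Sum>i=1..k. snd p i)"
    using uni[of v] by blast
  have "\<forall>i\<in>{1..k}. \<exists>a. snd p i = a *\<^sub>R w i"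
    using p(2) Wmem by (auto dest!: PiE_mem)
  then obtain a where a: "\<And>i. i \<in> {1..k} \<Longrightarrow> snd p i = a i *\<^sub>R w i" by metis
  define c where "c i = (if i < k then a (Suc i) else coords us (fst p) ! (i - k))" for i
  have "(\<Sum>i=1..k. snd p i) = (\<Sum>i<k. c i *\<^sub>R w (Suc i))"
    unfolding shift by (intro sum.cong) (auto simp: a c_def)
  moreover have "fst p = (\<Sum>j<length us. c (k + j) *\<^sub>R us ! j)"
    using list_basis_expand[OF us p(1)] by (simp add: c_def)
  ultimately have "v = (\<Sum>i<k + length us. c i *\<^sub>R ?e i)" unfolding sp p(3) by simp
  then show "\<exists>c. v = (\<Sum>i<k + length us. c i *\<^sub>R ?e i)" by blast
next
  let ?e = "\<lambda>i. if i < k then w (Suc i) else us ! (i - k)"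
  fix c :: "nat \<Rightarrow> real" and i
  assume zero: "(\<Sum>i<k + length us. c i *\<^sub>R ?e i) = 0" and i: "i < k + length us"
  have U: "subspace U" and W: "\<And>i. i \<in> {1..k} \<Longrightarrow> subspace (W i)"
    and uni: "\<And>v. \<exists>!p. fst p \<in> U \<and> snd p \<in> PiE {1..k} W \<and> v = fst p + (\<Sum>i=1..k. snd p i)"
    using dec by (auto simp: direct_sum_decomposition_def)
  have wW: "w i \<in> W i" "w i \<noteq> 0" if "i \<in> {1..k}" for i
    using w[OF that] span_base[of "w i" "{w i}"] by (auto simp: list_basis_def)
  define u where "u = (\<Sum>j<length us. c (k + j) *\<^sub>R us ! j)"
  define g where "g = restrict (\<lambda>i. c (i - 1) *\<^sub>R w i) {1..k}"
  define g0 where "g0 = restrict (\<lambda>i. 0 :: 'v) {1..k}"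
  have uU: "u \<in> U"
    using us U by (auto simp: u_def list_basis_def intro!: subspace_sum subspace_scale)
      (metis nth_mem span_base)
  have "(\<Sum>i=1..k. g i) = (\<Sum>i<k. c i *\<^sub>R w (Suc i))"
    by (simp add: sum.atLeast1_atMost_eq lessThan_atLeast0 g_def)
  then have 1: "0 = u + (\<Sum>i=1..k. g i)"
    using zero unfolding sum_split u_def by (simp add: add.commute)
  have 2: "g \<in> PiE {1..k} W" "g0 \<in> PiE {1..k} W"
    using wW W by (auto simp: g_def g0_def subspace_scale subspace_0)
  have 3: "0 = 0 + (\<Sum>i=1..k. g0 i)" by (simp add: g0_def)
  have "p = q" if "fst p \<in> U \<and> snd p \<in> PiE {1..k} W \<and> 0 = fst p + (\<Sum>i=1..k. snd p i)"
    "fst q \<in> U \<and> snd q \<in> PiE {1..k} W \<and> 0 = fst q + (\<Sum>i=1..k. snd q i)" for p q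
    using ex1_implies_ex[OF uni[of 0]] uni[of 0] that unfolding Ex1_def by metis
  from this[of "(u, g)" "(0, g0)"] have "(u, g) = (0, g0)"
    using uU subspace_0[OF U] 1 2 3 unfolding fst_conv snd_conv by blast
  then have u0: "u = 0" and g: "g = g0" by auto
  show "c i = 0"
  proof (cases "i < k")
    case True
    then have "g (Suc i) = 0" by (simp add: g g0_def)
    then show ?thesis using wW(2)[of "Suc i"] True by (simp add: g_def)
  next
    case False
    define j where "j = i - k"
    have j: "j < length us" "i = k + j" using False i by (auto simp: j_def)
    have "c (k + j) = coords us u ! j" unfolding u_def by (rule coords_sum[OF us j(1), symmetric])
    moreover have "coords us 0 ! j = 0" using coords_sum[OF us j(1), of "\<lambda>_. 0"] by simp
    ultimately show ?thesis using j u0 by simp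
  qed
qed

section \<open>Computing the hull\<close>

lemma G_hull_subset: "S \<subseteq> G_hull \<Lambda> S"
proof -
  have "(G_step \<Lambda> ^^ 0) S \<subseteq> G_hull \<Lambda> S" unfolding G_hull_def by blast
  then show ?thesis by simp
qed

lemma G_step_increasing: "0 \<in> \<Lambda> \<Longrightarrow> S \<subseteq> G_step \<Lambda> S"
proof
  fix x assume "0 \<in> \<Lambda>" "x \<in> S"
  then have "(1 / 2) *\<^sub>R x + (1 - 1 / 2) *\<^sub>R x \<in> G_step \<Lambda> S"
    unfolding G_step_def by (intro CollectI exI[of _ "1 / 2"] exI[of _ x]) auto
  then show "x \<in> G_step \<Lambda> S" by (simp flip: scaleR_left_distrib)
qed

text \<open>Because 0 lies in \<Lambda>, the stages increase and \<open>x\<close> and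
  \<open>y\<close> occur at a common one.\<close>

lemma G_hull_closed:
  assumes "0 \<in> \<Lambda>" "x \<in> G_hull \<Lambda> S" "y \<in> G_hull \<Lambda> S" "x - y \<in> \<Lambda>" "0 \<le> t" "t \<le> 1"
  shows "t *\<^sub>R x + (1 - t) *\<^sub>R y \<in> G_hull \<Lambda> S"
proof (cases "t = 0 \<or> t = 1")
  case True
  then show ?thesis using assms by auto
next
  case False
  have mono: "(G_step \<Lambda> ^^ a) S \<subseteq> (G_step \<Lambda> ^^ (a + b)) S" for a b
    by (induction b) (use G_step_increasing[OF assms(1)] in \<open>auto intro: subset_trans\<close>)
  obtain a b where "x \<in> (G_step \<Lambda> ^^ a) S" "y \<in> (G_step \<Lambda> ^^ b) S"
    using assms(2,3) unfolding G_hull_def by blast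
  then have "x \<in> (G_step \<Lambda> ^^ (a + b)) S" "y \<in> (G_step \<Lambda> ^^ (a + b)) S"
    using mono[of a b] mono[of b a] by (auto simp: add.commute)
  then have "t *\<^sub>R x + (1 - t) *\<^sub>R y \<in> G_step \<Lambda> ((G_step \<Lambda> ^^ (a + b)) S)"
    using assms False unfolding G_step_def[of \<Lambda> "(G_step \<Lambda> ^^ (a + b)) S"]
    by (intro CollectI exI[of _ t] exI[of _ x] exI[of _ y]) auto
  then have "t *\<^sub>R x + (1 - t) *\<^sub>R y \<in> (G_step \<Lambda> ^^ Suc (a + b)) S" by simp
  then show ?thesis unfolding G_hull_def by blast
qed

lemma G_hull_induct:
  assumes "x \<in> G_hull \<Lambda> S" and "\<And>x. x \<in> S \<Longrightarrow> P x"
    and step: "\<And>x y t. P x \<Longrightarrow> P y \<Longrightarrow> x - y \<in> \<Lambda> \<Longrightarrow> 0 \<le> t \<Longrightarrow> t \<le> 1 \<Longrightarrow> P (t *\<^sub>R x + (1 - t) *\<^sub>R y)"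
  shows "P x"
proof -
  have "\<forall>x\<in>(G_step \<Lambda> ^^ n) S. P x" for n
  proof (induction n)
    case (Suc n)
    show ?case
    proof
      fix x assume "x \<in> (G_step \<Lambda> ^^ Suc n) S"
      then obtain t y z where "x = t *\<^sub>R y + (1 - t) *\<^sub>R z" "y \<in> (G_step \<Lambda> ^^ n) S" "z \<in> (G_step \<Lambda> ^^ n) S"
        "y - z \<in> \<Lambda>" "0 < t" "t < 1"
        by (auto simp: G_step_def[of \<Lambda> "(G_step \<Lambda> ^^ n) S"])
      then show "P x" using Suc step by auto
    qed
  qed (use assms(2) in simp)
  then show ?thesis using assms(1) unfolding G_hull_def by blast
qed

lemma G_hull_empty: "G_hull {} S = S"
proof -
  have "(G_step {} ^^ n) S \<subseteq> S" for n
    by (cases n) (auto simp: G_step_def)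
  then show ?thesis using G_hull_subset[of S "{}"] unfolding G_hull_def by blast
qed

lemma axis_nth: "axis p q \<Longrightarrow> p \<noteq> [] \<Longrightarrow> \<exists>i<length p. \<forall>j<length p. j \<noteq> i \<longrightarrow> p ! j = q ! j"
proof (induction p q rule: axis.induct)
  case (2 x p y q)
  show ?case
  proof (cases "p = q")
    case True
    then show ?thesis by (intro exI[of _ 0]) (auto simp: nth_Cons split: nat.split)
  next
    case False
    then have xy: "x = y" "axis p q" using 2(2) by auto
    then have "p \<noteq> []" using False by (cases q) auto
    then obtain i where "i < length p" "\<forall>j<length p. j \<noteq> i \<longrightarrow> p ! j = q ! j" using 2(1) xy by blast
    then show ?thesis using xy by (intro exI[of _ "Suc i"]) (auto simp: nth_Cons split: nat.split)
  qed
qed auto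

lemma nth_axis: "length p = length q \<Longrightarrow> (\<And>j. j < length p \<Longrightarrow> j \<noteq> i \<Longrightarrow> p ! j = q ! j) \<Longrightarrow> axis p q"
proof (induction p q arbitrary: i rule: list_induct2)
  case (Cons x p y q)
  show ?case
  proof (cases i)
    case 0
    have "p = q" using Cons.prems[of "Suc _"] Cons.hyps 0 by (intro nth_equalityI) auto
    then show ?thesis by simp
  next
    case (Suc i')
    have "axis p q" using Cons.prems[of "Suc _"] Suc by (intro Cons.IH[of i']) auto
    then show ?thesis using Cons.prems[of 0] Suc by simp
  qed
qed simp

definition linpoly :: "real list \<Rightarrow> rpoly" where
  "linpoly r = foldr (\<lambda>e q. PAdd (PMul (PConst (fst e)) (PVar (snd e))) q) (zip r [0..<length r]) (PConst 0)"

lemma val_linpoly: "length x = length r \<Longrightarrow> poly_val (linpoly r) x = dot r x"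
proof -
  assume l: "length x = length r"
  have "poly_val (foldr (\<lambda>e q. PAdd (PMul (PConst (fst e)) (PVar (snd e))) q) es (PConst 0)) x =
      sum_list (map (\<lambda>e. fst e * x ! snd e) es)" for es :: "(real \<times> nat) list"
    by (induction es) auto
  then have "poly_val (linpoly r) x = (\<Sum>i<length r. r ! i * x ! i)"
    by (simp add: linpoly_def sum_list_sum_nth atLeast0LessThan)
  then show ?thesis using l by (simp add: dot_conv_sum)
qed

lemma vars_linpoly: "poly_vars (linpoly r) \<subseteq> {..<length r}"
proof -
  have "poly_vars (foldr (\<lambda>e q. PAdd (PMul (PConst (fst e)) (PVar (snd e))) q) es (PConst 0)) \<subseteq> snd ` set es"
    for es :: "(real \<times> nat) list"
    by (induction es) auto
  from this[of "zip r [0..<length r]"] show ?thesis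
    unfolding linpoly_def by (fastforce dest: set_zip_rightD)
qed

lemma set_read_points:
  assumes "\<And>p. p \<in> set ps \<Longrightarrow> length p = d"
  shows "set (read_points d (real (length ps) # concat ps)) = set ps"
proof -
  let ?f = "\<lambda>_ s. if 0 < fst s then (fst s - 1, drop d (fst (snd s)), snd (snd s) @ [take d (fst (snd s))]) else s"
  have "snd (snd (fold ?f fuel (real (length ps), concat ps, acc))) = acc @ take (length fuel) ps"
    if "\<And>p. p \<in> set ps \<Longrightarrow> length p = d" for fuel :: "real list" and ps :: "real list list" and acc
    using that
  proof (induction fuel arbitrary: ps acc)
    case (Cons x fuel)
    show ?case
    proof (cases ps)
      case Nil
      have "fold ?f fuel (0 :: real, [] :: real list, acc) = (0, [], acc)" by (induction fuel) auto
      then show ?thesis by (simp add: Nil)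
    next
      case (Cons p qs)
      have "take d p = p" "drop d p = []" using Cons.prems Cons by auto
      then show ?thesis using Cons.IH[of qs "acc @ [p]"] Cons.prems Cons by simp
    qed
  qed simp
  from this[OF assms, of ps "real (length ps) # concat ps" "[]"]
  have "read_points d (real (length ps) # concat ps) = take (Suc (length (concat ps))) ps"
    by (simp add: read_points_def)
  moreover have "set (take (Suc (length (concat ps))) ps) = set ps"
  proof (cases "d = 0")
    case True
    then have "p = []" if "p \<in> set ps" for p using assms[OF that] by simp
    then show ?thesis by (cases ps) (auto dest: in_set_takeD)
  next
    case False
    have "length (concat ps) = length ps * d"
      using assms by (induction ps) auto
    then have "length ps \<le> Suc (length (concat ps))" using False by (simp add: le_SucI)
    then show ?thesis by simp
  qed
  ultimately show ?thesis by simp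
qed

text \<open>Positivity of \<open>k\<close> ensures that 0 lies in \<Lambda>; the theorem treats
  \<open>k = 0\<close> separately.\<close>

locale line_decomposition =
  fixes U :: "'v::real_vector set" and W :: "nat \<Rightarrow> 'v set" and k :: nat
    and us :: "'v list" and w :: "nat \<Rightarrow> 'v"
  assumes dec: "direct_sum_decomposition U W k" and us: "list_basis us U"
    and w: "\<And>i. i \<in> {1..k} \<Longrightarrow> list_basis [w i] (W i)" and k: "0 < k"
begin

abbreviation "m \<equiv> length us"

definition es :: "'v list" where
  "es = map (\<lambda>i. if i < k then w (Suc i) else us ! (i - k)) [0..<k + m]"

definition \<Lambda> :: "'v set" where
  "\<Lambda> = (\<Union>i\<in>{1..k}. {u + w | u w. u \<in> U \<and> w \<in> W i})"

definition vec :: "real list \<Rightarrow> 'v" where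
  "vec b = (\<Sum>j<m. b ! j *\<^sub>R us ! j)"

definition pos :: "real list \<Rightarrow> 'v" where
  "pos a = (\<Sum>i<k. a ! i *\<^sub>R w (Suc i))"

text \<open>Position and \<open>U\<close>-part of a vector in the adapted basis
  \<open>es\<close>.\<close>

abbreviation "alpha x \<equiv> take k (coords es x)"
abbreviation "beta x \<equiv> drop k (coords es x)"

lemma es: "list_basis es UNIV"
  unfolding es_def using decomposition_basis[OF dec us w] .

lemma length_es: "length es = k + m"
  by (simp add: es_def)

lemma subspace_U: "subspace U" and subspace_W: "i \<in> {1..k} \<Longrightarrow> subspace (W i)"
  using dec by (auto simp: direct_sum_decomposition_def)

lemma w_in_W: "i \<in> {1..k} \<Longrightarrow> w i \<in> W i"
  using w[of i] span_base[of "w i" "{w i}"] by (auto simp: list_basis_def)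

lemma vec_in_U: "vec b \<in> U"
proof -
  have "us ! j \<in> U" if "j < m" for j
    using us span_base[OF nth_mem[OF that]] by (simp add: list_basis_def)
  then show ?thesis unfolding vec_def using subspace_U by (intro subspace_sum subspace_scale) auto
qed

lemma sum_es: "(\<Sum>i<length es. c i *\<^sub>R es ! i) = (\<Sum>i<k. c i *\<^sub>R w (Suc i)) + (\<Sum>j<m. c (k + j) *\<^sub>R us ! j)"
  unfolding length_es sum_split by (simp add: es_def)

lemma decompose: "x = pos (alpha x) + vec (beta x)"
  using list_basis_expand[OF es, of x] unfolding sum_es by (simp add: pos_def vec_def length_es)

lemma vec_mix: "length b = m \<Longrightarrow> length c = m \<Longrightarrow> vec (mix t b c) = t *\<^sub>R vec b + (1 - t) *\<^sub>R vec c"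
  by (simp add: vec_def mix_def scaleR_left_distrib sum.distrib scaleR_sum_right)

lemma pos_mix: "length p = k \<Longrightarrow> length q = k \<Longrightarrow> pos (mix t p q) = t *\<^sub>R pos p + (1 - t) *\<^sub>R pos q"
  by (simp add: pos_def mix_def scaleR_left_distrib sum.distrib scaleR_sum_right)

lemma coords_es_mix: "coords es (t *\<^sub>R x + (1 - t) *\<^sub>R y) = mix t (coords es x) (coords es y)"
  by (rule nth_equalityI) (simp_all add: coords_mix[OF es] mix_def)

lemma alpha_mix: "alpha (t *\<^sub>R x + (1 - t) *\<^sub>R y) = mix t (alpha x) (alpha y)"
  unfolding coords_es_mix by (simp add: mix_def take_map take_zip)

lemma beta_mix: "beta (t *\<^sub>R x + (1 - t) *\<^sub>R y) = mix t (beta x) (beta y)"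
  unfolding coords_es_mix by (simp add: mix_def drop_map drop_zip)

lemma zero_in_Lambda: "0 \<in> \<Lambda>"
  unfolding \<Lambda>_def using k subspace_0[OF subspace_U] subspace_0[OF subspace_W[of 1]]
  by (intro UN_I[of 1]) force+

lemma Lambda_axis: "x - y \<in> \<Lambda> \<Longrightarrow> axis (alpha x) (alpha y)"
proof -
  assume "x - y \<in> \<Lambda>"
  then obtain i u v where i: "i \<in> {1..k}" "u \<in> U" "v \<in> W i" "x - y = u + v" by (auto simp: \<Lambda>_def)
  obtain a where v: "v = a *\<^sub>R w i" using w[OF i(1)] i(3) by (auto simp: list_basis_def span_singleton)
  \<comment> \<open>Lines are numbered from 1 but coordinates from 0, hence
    \<open>i - 1\<close>.\<close>
  define c where "c l = (if l < k then (if l = i - 1 then a else 0) else coords us u ! (l - k))" for l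
  have "(\<Sum>l<k. c l *\<^sub>R w (Suc l)) = (\<Sum>l<k. if l = i - 1 then a *\<^sub>R w (Suc l) else 0)"
    by (intro sum.cong) (auto simp: c_def)
  also have "\<dots> = v"
  proof -
    have "i - 1 < k" "Suc (i - 1) = i" using i(1) by auto
    then show ?thesis by (simp add: v)
  qed
  finally have "x - y = (\<Sum>l<length es. c l *\<^sub>R es ! l)"
    unfolding sum_es i(4) using list_basis_expand[OF us i(2)] by (simp add: c_def)
  then have c: "coords es (x - y) ! j = c j" if "j < length es" for j
    using coords_sum[OF es that] by simp
  have "coords es x ! j = coords es y ! j" if "j < k" "j \<noteq> i - 1" for j
    using c[of j] that coords_mix[OF es, of j 1 x "- 1" y] by (simp add: c_def length_es)
  then show ?thesis by (intro nth_axis[of _ _ "i - 1"]) (auto simp: length_es)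
qed

lemma axis_Lambda:
  assumes "axis p q" "length p = k" "u \<in> U" "v \<in> U"
  shows "(pos p + u) - (pos q + v) \<in> \<Lambda>"
proof -
  have lq: "length q = k" using axis_length[OF assms(1)] assms(2) by simp
  obtain i where i: "i < k" "\<And>j. j < k \<Longrightarrow> j \<noteq> i \<Longrightarrow> p ! j = q ! j"
    using axis_nth[OF assms(1)] assms(2) k by (metis length_0_conv less_numeral_extra(3))
  have "pos p - pos q = (\<Sum>j<k. (p ! j - q ! j) *\<^sub>R w (Suc j))"
    by (simp add: pos_def scaleR_left_diff_distrib sum_subtractf)
  also have "\<dots> = (\<Sum>j<k. if j = i then (p ! j - q ! j) *\<^sub>R w (Suc j) else 0)"
    using i(2) by (intro sum.cong) auto
  also have "\<dots> = (p ! i - q ! i) *\<^sub>R w (Suc i)" using i(1) by simp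
  finally have "(pos p + u) - (pos q + v) = (u - v) + (p ! i - q ! i) *\<^sub>R w (Suc i)"
    by (simp add: algebra_simps)
  moreover have "u - v \<in> U" using assms subspace_U by (simp add: subspace_diff)
  moreover have "(p ! i - q ! i) *\<^sub>R w (Suc i) \<in> W (Suc i)"
    using i(1) subspace_W[of "Suc i"] w_in_W[of "Suc i"] by (simp add: subspace_scale)
  ultimately have "(pos p + u) - (pos q + v) \<in> {u + w | u w. u \<in> U \<and> w \<in> W (Suc i)}" by blast
  then show ?thesis unfolding \<Lambda>_def using i(1) by (intro UN_I[of "Suc i"]) simp_all
qed

definition grid_axes :: "(real list \<times> real list) list \<Rightarrow> real list list" where
  "grid_axes pts = columns pts (replicate k [])"

text \<open>Certificates mediate: \<open>reached\<close> propagates through the hull and gives a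
  certificate, while the fibres of the hull form an axis-convex family, which makes certificates
  sound.\<close>

lemma hull_iff:
  assumes pts: "set pts = (\<lambda>x. (alpha x, beta x)) ` S"
  defines "Xs \<equiv> grid_axes pts"
  defines "A \<equiv> acts (product_lists Xs) (replicate m 0) pts"
  shows "x \<in> G_hull \<Lambda> S \<longleftrightarrow> (\<exists>B\<in>set (boxes Xs). \<exists>L\<in>set (chain_lists (product_lists Xs) A).
    in_box B (alpha x) \<and> sat (cone_rows (product_lists Xs) (replicate m 0) A L)
      (map (\<lambda>a. - lam B (alpha x) a) (product_lists Xs) @ beta x))"
proof -
  have len: "length (fst p) = k" "length (snd p) = m" if "p \<in> set pts" for p
    using that pts by (auto simp: length_es)
  have lX: "length Xs = k"
    using columns_props[of pts k, OF len(1)] by (simp add: Xs_def grid_axes_def)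
  interpret net Xs pts "replicate m 0" vec
  proof
    show "fst p \<in> set (product_lists Xs)" if "p \<in> set pts" for p
      unfolding Xs_def grid_axes_def by (rule points_in_grid[OF len(1) that])
    show "vec (replicate m 0) = 0" by (simp add: vec_def)
  qed
  have inj: "c i = d i" if "(\<Sum>i<m. c i *\<^sub>R us ! i) = (\<Sum>i<m. d i *\<^sub>R us ! i)" "i < m" for c d i
    using coords_sum[OF us that(2), of c] coords_sum[OF us that(2), of d] that(1) by simp
  have cone: "sat (cone_rows (product_lists Xs) (replicate m 0) A L)
      (map (\<lambda>a. - lam B (alpha x) a) (product_lists Xs) @ beta x) \<longleftrightarrow>
      (\<exists>z. certificate (alpha x) (vec (beta x)) B L z)"
    if "chain L" "set L \<subseteq> Act" "B \<in> set (boxes Xs)" "in_box B (alpha x)" for B L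
    unfolding A_def
    by (rule cone_certificate[where m = m and b = "\<lambda>j. us ! j"])
       (use that len inj in \<open>simp_all add: vec_def length_es\<close>)
  have cert: "(\<exists>B\<in>set (boxes Xs). \<exists>L\<in>set (chain_lists (product_lists Xs) A). in_box B (alpha x) \<and>
      sat (cone_rows (product_lists Xs) (replicate m 0) A L) (map (\<lambda>a. - lam B (alpha x) a) (product_lists Xs) @ beta x)) \<longleftrightarrow>
    (\<exists>B L z. certificate (alpha x) (vec (beta x)) B L z \<and> length L \<le> length (product_lists Xs))"
    (is "?l \<longleftrightarrow> ?r")
  proof
    assume ?l
    then obtain B L where BL: "B \<in> set (boxes Xs)" "L \<in> set (chain_lists (product_lists Xs) A)" "in_box B (alpha x)"
      "sat (cone_rows (product_lists Xs) (replicate m 0) A L) (map (\<lambda>a. - lam B (alpha x) a) (product_lists Xs) @ beta x)"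
      by blast
    have L: "chain L" "set L \<subseteq> Act" "length L \<le> length (product_lists Xs)"
      using BL(2) unfolding A_def set_chain_lists by auto
    have "\<exists>z. certificate (alpha x) (vec (beta x)) B L z"
      using BL(4) unfolding cone[OF L(1,2) BL(1,3)] .
    with L(3) show ?r by blast
  next
    assume ?r
    then obtain B L z where c: "certificate (alpha x) (vec (beta x)) B L z" "length L \<le> length (product_lists Xs)" by blast
    have BL: "chain L" "set L \<subseteq> Act" "B \<in> set (boxes Xs)" "in_box B (alpha x)"
      using certificateD(1-4)[OF c(1)] by (simp_all add: set_boxes)
    have "\<exists>z. certificate (alpha x) (vec (beta x)) B L z" using c(1) by blast
    then have "sat (cone_rows (product_lists Xs) (replicate m 0) A L)
      (map (\<lambda>a. - lam B (alpha x) a) (product_lists Xs) @ beta x)"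
      unfolding cone[OF BL] .
    moreover have "L \<in> set (chain_lists (product_lists Xs) A)"
      using BL(1,2) c(2) unfolding A_def set_chain_lists by simp
    ultimately show ?l using BL(3,4) by blast
  qed
  show ?thesis unfolding cert
  proof
    assume "x \<in> G_hull \<Lambda> S"
    then have "reached (alpha x) (vec (beta x))"
    proof (rule G_hull_induct)
      fix x assume "x \<in> S"
      then have "(alpha x, beta x) \<in> set pts" using pts by blast
      from reached_point[OF this] show "reached (alpha x) (vec (beta x))" by simp
    next
      fix x y t
      assume "reached (alpha x) (vec (beta x))" "reached (alpha y) (vec (beta y))"
        "x - y \<in> \<Lambda>" "0 \<le> t" "t \<le> (1 :: real)"
      then show "reached (alpha (t *\<^sub>R x + (1 - t) *\<^sub>R y)) (vec (beta (t *\<^sub>R x + (1 - t) *\<^sub>R y)))"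
        unfolding alpha_mix beta_mix using Lambda_axis[of x y]
        by (simp add: vec_mix length_es reached_mix)
    qed
    from certificate_exists[OF this] obtain B L z
      where c: "certificate (alpha x) (vec (beta x)) B L z" and d: "distinct (map amid L)" by blast
    have "length L \<le> length (product_lists Xs)"
      by (rule length_distinct_chain[OF d certificateD(4)[OF c]])
    with c show "\<exists>B L z. certificate (alpha x) (vec (beta x)) B L z \<and> length L \<le> length (product_lists Xs)" by blast
  next
    assume "\<exists>B L z. certificate (alpha x) (vec (beta x)) B L z \<and> length L \<le> length (product_lists Xs)"
    then obtain B L z where c: "certificate (alpha x) (vec (beta x)) B L z" by blast
    \<comment> \<open>The fibre of the hull over the position \<open>a\<close>, translated into
      \<open>U\<close>.\<close>
    define K where "K a = {u \<in> U. pos a + u \<in> G_hull \<Lambda> S}" for a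
    have "axis_convex k K"
      unfolding axis_convex_def
    proof (intro allI impI)
      fix p q u v and t :: real
      assume *: "length p = k" "axis p q" "u \<in> K p" "v \<in> K q" "0 \<le> t" "t \<le> 1"
      then have uv: "u \<in> U" "v \<in> U" "pos p + u \<in> G_hull \<Lambda> S" "pos q + v \<in> G_hull \<Lambda> S" by (auto simp: K_def)
      have "t *\<^sub>R (pos p + u) + (1 - t) *\<^sub>R (pos q + v) \<in> G_hull \<Lambda> S"
        using * uv by (intro G_hull_closed zero_in_Lambda axis_Lambda)
      moreover have "length q = k" using axis_length[OF *(2)] *(1) by simp
      ultimately have "pos (mix t p q) + (t *\<^sub>R u + (1 - t) *\<^sub>R v) \<in> G_hull \<Lambda> S"
        using *(1) by (simp add: pos_mix scaleR_right_distrib algebra_simps)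
      moreover have "t *\<^sub>R u + (1 - t) *\<^sub>R v \<in> U"
        using uv subspace_U by (intro subspace_add subspace_scale)
      ultimately show "t *\<^sub>R u + (1 - t) *\<^sub>R v \<in> K (mix t p q)" by (simp add: K_def)
    qed
    moreover have "vec (snd p) \<in> K (fst p)" if "p \<in> set pts" for p
    proof -
      obtain y where "y \<in> S" "p = (alpha y, beta y)" using \<open>p \<in> set pts\<close> pts by auto
      then show ?thesis
        using decompose[of y] vec_in_U G_hull_subset[of S \<Lambda>] by (auto simp: K_def)
    qed
    ultimately have "vec (beta x) \<in> K (alpha x)"
      using lX by (intro certificate_sound[OF c]) (auto simp: length_es)
    then show "x \<in> G_hull \<Lambda> S" using decompose[of x] by (simp add: K_def)
  qed
qed

end

section \<open>The program for a fixed decomposition\<close>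

context stack_machine
begin

text \<open>\<open>()\<close> and 0 have the same code, so any argument can be replaced by
  \<open>()\<close> before the constant is produced.\<close>

lemma cmp_const_any: "cmp (\<lambda>_ :: unit. x) \<Longrightarrow> cmp (\<lambda>_. x)"
proof -
  assume x: "cmp (\<lambda>_ :: unit. x)"
  have "cmp (\<lambda>_. 0 :: real)" by (rule cmp_zero)
  then have "cmp (\<lambda>_. ())" by (rule cmp_as_code) (simp add: rep_real_def rep_unit_def)
  from cmp_compose[OF x this] show ?thesis .
qed

lemma cmp_linpoly:
  assumes "\<And>a. a \<in> set r \<Longrightarrow> cmp (\<lambda>_ :: unit. a)"
  shows "cmp (\<lambda>_. linpoly r)"
proof -
  have "(\<And>e. e \<in> set es \<Longrightarrow> cmp (\<lambda>_ :: unit. fst e)) \<Longrightarrow>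
      cmp (\<lambda>_. foldr (\<lambda>e q. PAdd (PMul (PConst (fst e)) (PVar (snd e))) q) es (PConst 0))"
    for es :: "(real \<times> nat) list"
  proof (induction es)
    case Nil
    show ?case unfolding foldr.simps id_def by (intro cmp_formulas cmp_basic)
  next
    case (Cons e es)
    show ?case unfolding foldr.simps o_def
      by (rule cmp_PAdd[OF cmp_PMul[OF cmp_PConst[OF cmp_const_any] cmp_PVar] Cons.IH])
        (use Cons.prems in auto)
  qed
  from this[of "zip r [0..<length r]"] show ?thesis
    unfolding linpoly_def using assms by (metis prod.collapse set_zip_leftD)
qed

text \<open>Serves the case \<open>k = 0\<close>, where the hull is the input set itself.\<close>

lemma describes_points:
  assumes bs: "list_basis bs UNIV"
  shows "\<exists>f. cmp f \<and> (\<forall>xs. describes bs (f (real (length xs) # concat (map (coords bs) xs))) (set xs))"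
proof (intro exI conjI allI)
  let ?d = "length bs"
  let ?vs = "map PVar [0..<?d]"
  let ?f = "\<lambda>inp. points_form ?vs (read_points ?d inp)"
  show "cmp ?f"
    by (intro cmp_points_form cmp_read_points cmp_const_list) (auto intro: cmp_PVar)
  fix xs :: "'a list"
  let ?ps = "read_points ?d (real (length xs) # concat (map (coords bs) xs))"
  have ps: "set ?ps = coords bs ` set xs"
  proof -
    have "set (read_points ?d (real (length (map (coords bs) xs)) # concat (map (coords bs) xs))) =
        set (map (coords bs) xs)"
      by (rule set_read_points) auto
    then show ?thesis by simp
  qed
  have point: "(\<forall>e\<in>set (zip p ?vs). poly_val (snd e) x = fst e) \<longleftrightarrow> x = p"
    if "length p = ?d" "length x = ?d" for p x :: "real list"
  proof -
    have "(\<forall>e\<in>set (zip p ?vs). poly_val (snd e) x = fst e) \<longleftrightarrow> (\<forall>i<?d. x ! i = p ! i)"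
      using that by (simp add: all_set_conv_all_nth)
    also have "\<dots> \<longleftrightarrow> x = p" using that by (simp add: list_eq_iff_nth_eq)
    finally show ?thesis .
  qed
  have "holds (points_form ?vs ?ps) (coords bs v) \<longleftrightarrow> v \<in> set xs" for v
  proof -
    have "holds (points_form ?vs ?ps) (coords bs v) \<longleftrightarrow>
        (\<exists>p\<in>set ?ps. \<forall>e\<in>set (zip p ?vs). poly_val (snd e) (coords bs v) = fst e)"
      by (simp add: points_form_def holds_disj_form holds_conj_form)
    also have "\<dots> \<longleftrightarrow> (\<exists>p\<in>set ?ps. coords bs v = p)"
      by (intro bex_cong HOL.refl point) (auto simp: ps)
    also have "\<dots> \<longleftrightarrow> v \<in> set xs"
      unfolding ps using coords_inject[OF bs] by blast
    finally show ?thesis .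
  qed
  then have "set xs = {v. holds (points_form ?vs ?ps) (coords bs v)}" by blast
  moreover have "formula_vars (points_form ?vs ps) \<subseteq> {..<?d}" for ps
    by (fastforce simp: points_form_def vars_disj_form vars_conj_form dest: set_zip_rightD)
  ultimately show "describes bs (?f (real (length xs) # concat (map (coords bs) xs))) (set xs)"
    unfolding describes_def by blast
qed


lemma holds_hull_form:
  "holds (hull_form WP UP zs es pts) x \<longleftrightarrow> (\<exists>B\<in>set (boxes (columns pts es)).
     \<exists>L\<in>set (chain_lists (product_lists (columns pts es)) (acts (product_lists (columns pts es)) zs pts)).
       in_box B (map (\<lambda>p. poly_val p x) WP) \<and>
       sat (cone_rows (product_lists (columns pts es)) zs (acts (product_lists (columns pts es)) zs pts) L)
         (map (\<lambda>a. - lam B (map (\<lambda>p. poly_val p x) WP) a) (product_lists (columns pts es)) @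
          map (\<lambda>p. poly_val p x) UP))"
  by (simp add: hull_form_def grid_form_def holds_disj_form holds_cell_form)

text \<open>Inputs arrive in coordinates for \<open>bs\<close>, whereas the net works in those for
  \<open>es\<close>. The change of basis is linear; it acts on the input points as numbers and on
  the variables of the formula as linear polynomials.\<close>

lemma describes_hull:
  fixes bs :: "'v::real_vector list"
  assumes "line_decomposition U W k us w" and bs: "list_basis bs UNIV"
    and C: "decomposition_constants bs us w k \<subseteq> C"
  shows "\<exists>f. cmp f \<and> (\<forall>xs. describes bs (f (real (length xs) # concat (map (coords bs) xs)))
    (G_hull (line_decomposition.\<Lambda> U W k) (set xs)))"
proof -
  interpret line_decomposition U W k us w by fact
  define d where "d = length bs"
  have d: "length es = d" unfolding d_def by (rule list_basis_length[OF es bs])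
  \<comment> \<open>The inverse matrix has the columns \<open>coords bs (es ! j)\<close>, whose
    entries are permitted constants; the entries of \<open>R\<close> may fail to be permitted and
    are computed from those.\<close>
  define R where "R i j = coords es (bs ! j) ! i" for i j
  define row where "row i = map (R i) [0..<d]" for i
  have row: "length (row i) = d" for i by (simp add: row_def)
  have dot_row: "dot (row i) (coords bs x) = coords es x ! i" if "i < d" for i x
  proof -
    have "coords es (\<Sum>j<d. coords bs x ! j *\<^sub>R bs ! j) ! i = (\<Sum>j<d. coords bs x ! j * R i j)"
      unfolding R_def using that d by (intro coords_lincomb[OF es]) simp
    also have "(\<Sum>j<d. coords bs x ! j *\<^sub>R bs ! j) = x"
      unfolding d_def by (rule list_basis_expand[OF bs UNIV_I, symmetric])
    finally show ?thesis
      by (simp add: dot_conv_sum row_def d_def[symmetric] mult.commute)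
  qed
  have R: "cmp (\<lambda>_ :: unit. R i j)" if "i < d" "j < d" for i j
  proof -
    let ?K = "{x. cmp (\<lambda>_ :: unit. x :: real)}"
    have "R i j \<in> ?K"
    proof (rule left_inverse_in_field[where M = "\<lambda>i j. coords bs (es ! j) ! i" and n = d])
      fix i j assume ij: "i < d" "j < d"
      have "es ! j \<in> set us \<union> w ` {1..k}"
        using ij(2) d unfolding length_es by (auto simp: es_def)
      moreover have "coords bs (es ! j) ! i \<in> set (coords bs (es ! j))"
        using ij(1) by (simp add: d_def)
      ultimately have "coords bs (es ! j) ! i \<in> C"
        using C unfolding decomposition_constants_def by blast
      then show "coords bs (es ! j) ! i \<in> ?K" by (simp add: cmp_const)
      have es_j: "es ! j = (\<Sum>l<length es. (if l = j then 1 else 0) *\<^sub>R es ! l)"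
      proof -
        have "(\<Sum>l<length es. (if l = j then 1 else 0) *\<^sub>R es ! l) = (\<Sum>l<length es. if l = j then es ! l else 0)"
          by (intro sum.cong) auto
        then show ?thesis using ij d by simp
      qed
      have "coords es (\<Sum>l<length es. (if l = j then 1 else 0) *\<^sub>R es ! l) ! i = (if i = j then 1 else 0)"
        using ij d by (intro coords_sum[OF es]) simp
      then have unit: "coords es (es ! j) ! i = (if i = j then 1 else 0)" unfolding es_j[symmetric] .
      have "(\<Sum>l<d. R i l * coords bs (es ! j) ! l) = coords es (\<Sum>l<d. coords bs (es ! j) ! l *\<^sub>R bs ! l) ! i"
        using coords_lincomb[OF es, of i "\<lambda>l. coords bs (es ! j) ! l" "\<lambda>l. bs ! l" "{..<d}"] ij d
        by (simp add: R_def mult.commute)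
      also have "(\<Sum>l<d. coords bs (es ! j) ! l *\<^sub>R bs ! l) = es ! j"
        unfolding d_def by (rule list_basis_expand[OF bs UNIV_I, symmetric])
      also have "coords es (es ! j) ! i = (if i = j then 1 else 0)" by (rule unit)
      finally show "(\<Sum>l<d. R i l * coords bs (es ! j) ! l) = (if i = j then 1 else 0)" .
    qed (use that in \<open>auto intro: cmp_basic\<close>)
    then show ?thesis by simp
  qed
  define WR where "WR = map row [0..<k]"
  define UR where "UR = map row [k..<k + m]"
  have rows: "r \<in> set WR \<union> set UR \<Longrightarrow> \<exists>i<d. r = row i" for r
    using d unfolding length_es by (auto simp: WR_def UR_def) (metis trans_less_add1)
  have entries: "cmp (\<lambda>_ :: unit. a)" if "r \<in> set WR \<union> set UR" "a \<in> set r" for r a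
    using rows[OF that(1)] that(2) R by (auto simp: row_def)
  define point where "point p = (map (\<lambda>r. dot r p) WR, map (\<lambda>r. dot r p) UR)" for p
  have point: "point (coords bs x) = (alpha x, beta x)" for x
  proof -
    have "map (\<lambda>r. dot r (coords bs x)) WR = alpha x"
      using d unfolding length_es WR_def
      by (intro nth_equalityI) (simp_all add: length_es dot_row)
    moreover have "map (\<lambda>r. dot r (coords bs x)) UR = beta x"
      using d unfolding length_es UR_def
      by (intro nth_equalityI) (simp_all add: length_es dot_row)
    ultimately show ?thesis by (simp add: point_def)
  qed
  let ?F = "\<lambda>pts. hull_form (map linpoly WR) (map linpoly UR) (replicate m 0) (replicate k []) pts"
  let ?f = "\<lambda>inp. ?F (map point (read_points d inp))"
  have "cmp ?f"
  proof (intro cmp_hull_form)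
    show "cmp (\<lambda>_ :: real list. map linpoly WR)" "cmp (\<lambda>_ :: real list. map linpoly UR)"
      by (rule cmp_const_list, use entries in \<open>auto intro!: cmp_linpoly\<close>)+
    show "cmp (\<lambda>_ :: real list. replicate m (0 :: real))" "cmp (\<lambda>_ :: real list. replicate k ([] :: real list))"
      by (rule cmp_const_list, auto intro: cmp_zero cmp_Nil)+
    have "cmp (\<lambda>_ :: real list \<times> real list. WR)" "cmp (\<lambda>_ :: real list \<times> real list. UR)"
      by (rule cmp_const_list, rule cmp_const_list, rule cmp_const_any, use entries in auto)+
    then have "cmp point"
      unfolding point_def by (intro cmp_pair cmp_map cmp_dot cmp_fst cmp_snd cmp_id cmp_const_list)
        (use entries in \<open>auto intro: cmp_const_any\<close>)
    then show "cmp (\<lambda>inp. map point (read_points d inp))"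
      by (intro cmp_map cmp_read_points) (rule cmp_compose[of point fst, OF _ cmp_fst_prim])
  qed
  moreover have "describes bs (?f (real (length xs) # concat (map (coords bs) xs))) (G_hull \<Lambda> (set xs))" for xs
  proof -
    define pts where "pts = map point (read_points d (real (length xs) # concat (map (coords bs) xs)))"
    have "set (read_points d (real (length (map (coords bs) xs)) # concat (map (coords bs) xs))) = set (map (coords bs) xs)"
      by (rule set_read_points) (auto simp: d_def)
    then have pts: "set pts = (\<lambda>x. (alpha x, beta x)) ` set xs"
      by (simp add: pts_def image_image point)
    have vals: "map (\<lambda>p. poly_val p (coords bs v)) (map linpoly WR) = alpha v"
      "map (\<lambda>p. poly_val p (coords bs v)) (map linpoly UR) = beta v" for v
    proof -
      have "poly_val (linpoly r) (coords bs v) = dot r (coords bs v)" if "r \<in> set WR \<union> set UR" for r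
        using rows[OF that] row by (intro val_linpoly) (auto simp: d_def)
      then have "map (\<lambda>p. poly_val p (coords bs v)) (map linpoly rs) = map (\<lambda>r. dot r (coords bs v)) rs"
        if "set rs \<subseteq> set WR \<union> set UR" for rs
        using that by (auto simp: subset_eq)
      then show "map (\<lambda>p. poly_val p (coords bs v)) (map linpoly WR) = alpha v"
        "map (\<lambda>p. poly_val p (coords bs v)) (map linpoly UR) = beta v"
        using point[of v] by (simp_all only: point_def prod.inject Un_upper1 Un_upper2)
    qed
    have "holds (?F pts) (coords bs v) \<longleftrightarrow> v \<in> G_hull \<Lambda> (set xs)" for v
      unfolding holds_hull_form vals hull_iff[OF pts] grid_axes_def ..
    moreover have "formula_vars (?F pts) \<subseteq> {..<d}"
    proof (rule vars_hull_form)
      fix p assume "p \<in> set (map linpoly WR) \<union> set (map linpoly UR)"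
      then obtain i where "p = linpoly (row i)" using rows by auto
      then show "poly_vars p \<subseteq> {..<d}" using vars_linpoly[of "row i"] by (simp add: row)
    qed
    ultimately show ?thesis unfolding describes_def d_def[symmetric] pts_def[symmetric] by simp
  qed
  ultimately show ?thesis by blast
qed

end

theorem theorem2:
  fixes U \<Lambda> :: "'v::real_vector set" and W :: "nat \<Rightarrow> 'v set" and k :: nat
  assumes finite_dim: "\<exists>B :: 'v set. finite B \<and> span B = UNIV"
    and decomp: "direct_sum_decomposition U W k"
    and dim_W: "\<forall>i\<in>{1..k}. dim (W i) = 1"
    and Lambda: "\<Lambda> = (\<Union>i\<in>{1..k}. {u + w | u w. u \<in> U \<and> w \<in> W i})"
  shows "(\<forall>S. finite S \<longrightarrow> semialgebraic (G_hull \<Lambda> S)) \<and>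
    (\<forall>bs us w. list_basis bs UNIV \<and> list_basis us U \<and> (\<forall>i\<in>{1..k}. list_basis [w i] (W i)) \<longrightarrow>
       (\<exists>p. constants p \<subseteq> decomposition_constants bs us w k \<and>
            (\<forall>S xs. set xs = S \<longrightarrow> outputs_description bs p xs (G_hull \<Lambda> S))))"
proof -
  have algorithm: "\<exists>p. constants p \<subseteq> decomposition_constants bs us w k \<and>
      (\<forall>S xs. set xs = S \<longrightarrow> outputs_description bs p xs (G_hull \<Lambda> S))"
    if bs: "list_basis bs UNIV" and us: "list_basis us U" and w: "\<forall>i\<in>{1..k}. list_basis [w i] (W i)" for bs us w
  proof -
    interpret stack_machine "decomposition_constants bs us w k"
      by standard (auto simp: decomposition_constants_def)
    have "\<exists>f. cmp f \<and> (\<forall>xs. describes bs (f (real (length xs) # concat (map (coords bs) xs))) (G_hull \<Lambda> (set xs)))"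
    proof (cases "k = 0")
      case True
      then have "\<Lambda> = {}" using Lambda by simp
      then show ?thesis using describes_points[OF bs] by (simp add: G_hull_empty)
    next
      case False
      then have lines: "line_decomposition U W k us w" using decomp us w by unfold_locales auto
      have "\<Lambda> = line_decomposition.\<Lambda> U W k" unfolding line_decomposition.\<Lambda>_def[OF lines] by (rule Lambda)
      then show ?thesis using describes_hull[OF lines bs order.refl] by simp
    qed
    then obtain f where f: "cmp f"
      "\<And>xs. describes bs (f (real (length xs) # concat (map (coords bs) xs))) (G_hull \<Lambda> (set xs))" by blast
    obtain p where p: "constants p \<subseteq> decomposition_constants bs us w k"
      "\<And>xs. exec p (st xs) (st (encode_formula (f xs)))"
      using cmp_prog[OF f(1)] by blast
    have "input_store bs xs = st (real (length xs) # concat (map (coords bs) xs))" for xs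
      by (auto simp: input_store_def st_def mem_def)
    then have "outputs_description bs p xs (G_hull \<Lambda> (set xs))" for xs
      unfolding outputs_description_def using p(2) f(2)[of xs] by (metis st_simps(1))
    then show ?thesis using p(1) by blast
  qed
  obtain B :: "'v set" where B: "finite B" "span B = UNIV" using finite_dim by blast
  have "\<exists>bs. list_basis bs X" if "subspace X" for X :: "'v set"
  proof -
    obtain D where D: "D \<subseteq> X" "independent D" "X \<subseteq> span D" by (rule real_vector.basis_exists[of X]) (rule that)
    have "finite D" using real_vector.independent_span_bound[OF B(1) D(2)] B(2) by simp
    then obtain bs where "set bs = D" "distinct bs" using finite_distinct_list by metis
    moreover have "span D = X" using D(3) real_vector.span_minimal[OF D(1) that] by (rule order.antisym[rotated])
    ultimately show ?thesis using D by (auto simp: list_basis_def)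
  qed
  note basis = this
  have sub: "subspace U" "\<And>i. i \<in> {1..k} \<Longrightarrow> subspace (W i)"
    using decomp by (auto simp: direct_sum_decomposition_def)
  obtain bs us where bs: "list_basis bs (UNIV :: 'v set)" and us: "list_basis us U"
    using basis[OF sub(1)] basis[OF subspace_UNIV] by blast
  have "\<exists>v. list_basis [v] (W i)" if i: "i \<in> {1..k}" for i
  proof -
    obtain ws where ws: "list_basis ws (W i)" using basis[OF sub(2)[OF i]] by blast
    then have "length ws = dim (W i)"
      unfolding list_basis_def by (metis dim_span_eq_card_independent distinct_card)
    then have "length ws = 1" using dim_W i by simp
    then show ?thesis using ws by (auto simp: length_Suc_conv)
  qed
  then obtain w where w: "\<forall>i\<in>{1..k}. list_basis [w i] (W i)" by metis
  \<comment> \<open>Semi-algebraicity is read off from the algorithm: its output on an enumeration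
    of \<open>S\<close> is a description of the hull.\<close>
  have "semialgebraic (G_hull \<Lambda> S)" if S: "finite S" for S
  proof -
    obtain xs where "set xs = S" using finite_list[OF S] by blast
    then show ?thesis
      using algorithm[OF bs us w] bs unfolding semialgebraic_def outputs_description_def by blast
  qed
  then show ?thesis using algorithm by blast
qed

end
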